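(* For each integer $n\ge 0$, the map sending a weakly holomorphic modular form $f\in M^!_{n+2}$ (identified with an element of $\mathrm{gr}_{n+2}\mathcal{O}(X)$) to the class of the one-form $\omega_f:=f\,\omega\,\mathsf{T}^n$ induces a canonical isomorphism of $\mathbb{Q}$-vector spaces $$\varpi:\ M_{n+2}^!\,/\,\mathcal{D}^{n+1}M^!_{-n}\ \overset{\sim}{\longrightarrow}\ H^1_{dR}(\mathcal{M}_{1,1};\mathscr{V}_n).$$
   Context: For $m\in\mathbb{Z}$, $M_m^!$ is the $\mathbb{Q}$-vector space of weakly holomorphic modular forms of weight $m$ for $\mathrm{SL}_2(\mathbb{Z})$ with rational Fourier coefficients: holomorphic functions $f$ on the upper half plane $\mathfrak{H}$ with $f(\gamma z)=(cz+d)^m f(z)$ for all $\gamma=\begin{pmatrix}a&b\\c&d\end{pmatrix}\in \mathrm{SL}_2(\mathbb{Z})$ and with Fourier expansion $f=\sum_{k\ge -N}a_kq^k$, $a_k\in\mathbb{Q}$, $q=e^{2\pi i z}$. The operator is $\mathcal{D}=q\frac{d}{dq}$; by Bol's identity $\mathcal{D}^{n+1}$ maps $M^!_{-n}$ into $M^!_{n+2}$ for $n\ge0$. Work over $\mathbb{Q}$. Let $\Delta=u^3-27v^2$ and $X=\operatorname{Spec}\mathbb{Q}[u,v][\Delta^{-1}]$, with the action of $\mathbb{G}_m$ given by $\lambda\cdot(u,v)=(\lambda^4u,\lambda^6v)$; this grades $\mathcal{O}(X)=\bigoplus_m\mathrm{gr}_m\mathcal{O}(X)$ by weight ($u$ has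 weight 4, $v$ has weight 6). The substitution $u=20\,\mathsf{G}_4$, $v=\frac73\mathsf{G}_6$, where $\mathsf{G}_{2k}=-\frac{B_{2k}}{4k}+\sum_{m\ge1}\sigma_{2k-1}(m)q^m$, identifies $\mathrm{gr}_m\mathcal{O}(X)$ with $M_m^!$ for all $m$. The moduli stack of elliptic curves over $\mathbb{Q}$ is $\mathcal{M}_{1,1}=\mathbb{G}_m\backslash\!\backslash X$ (universal curve $y^2=4x^3-ux-v$). Put $$\psi=\frac1{12}\frac{d\Delta}{\Delta},\qquad \omega=\frac32\,\frac{2u\,dv-3v\,du}{\Delta}.$$ The bundle $\mathscr{V}=\mathcal{O}_X\mathsf{S}\oplus\mathcal{O}_X\mathsf{T}$ ($\mathsf{T}=dx/y$, $\mathsf{S}=x\,dx/y$), with $\lambda\cdot\mathsf{S}=\lambda\mathsf{S}$, $\lambda\cdot\mathsf{T}=\lambda^{-1}\mathsf{T}$, carries the $\mathbb{G}_m$-invariant Gauss--Manin connection $\nabla\mathsf{S}=\psi\,\mathsf{S}-\frac{u}{12}\omega\,\mathsf{T}$, $\nabla\mathsf{T}=\omega\,\mathsf{S}-\psi\,\mathsf{T}$; $\mathscr{V}_n=\mathrm{Sym}^n\mathscr{V}$ with the induced connection. All of these descend to $\mathcal{M}_{1,1}$. $H^\bullet_{dR}(\mathcal{M}_{1,1};\mathscr{V}_n)$ is the algebraic de Rham cohomology of the stack with coefficients in $(\mathscr{V}_n,\nabla)$. Concretely, let $j:Z\hookrightarrow X$ be the closed subscheme $\Delta=1$, on which $\boldsymbol{\mu}_{12}\subset\mathbb{G}_m$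 acts; then $\mathcal{M}_{1,1}=\boldsymbol{\mu}_{12}\backslash\!\backslash Z$ with $Z\to\mathcal{M}_{1,1}$ étale and $Z$ affine, so it is the cohomology of the complex of $\boldsymbol{\mu}_{12}$-invariants of the global de Rham complex $\Gamma(Z,\Omega_Z^\bullet\otimes j^*\mathscr{V}_n)$ with differential $\nabla$. The class of $\omega_f$ is the class of $j^*\omega_f$ in this complex. *)

theory Defs
  imports
    "HOL-Analysis.Analysis"
    "HOL-Computational_Algebra.Computational_Algebra"
    "HOL-Algebra.AbelCoset"
    "HOL-Algebra.Module"
    "HOL-Number_Theory.Cong"
begin

section \<open>Rational vector spaces and quotients\<close>

text \<open>A vector space over the rationals is a module, in the sense of HOL-Algebra, over the
  following ring. The multiplicative fields of a module record play no role.\<close>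

definition rat_ring :: "rat ring" where
  "rat_ring = \<lparr>carrier = UNIV, mult = (*), one = 1, zero = 0, add = (+)\<rparr>"

definition rat_space :: "'a::ab_group_add set \<Rightarrow> (rat \<Rightarrow> 'a \<Rightarrow> 'a) \<Rightarrow> (rat, 'a) module" where
  "rat_space V s = \<lparr>carrier = V, mult = undefined, one = undefined, zero = 0, add = (+), smult = s\<rparr>"

text \<open>The quotient of \<open>M\<close> by a subspace \<open>U\<close>: cosets \<open>x + U\<close>, where \<open>c\<close> times the coset \<open>x + U\<close> is \<open>c x + U\<close>.\<close>

definition quot_space :: "(rat, 'a) module \<Rightarrow> 'a set \<Rightarrow> (rat, 'a set) module" where
  "quot_space M U =
     \<lparr>carrier = a_rcosets\<^bsub>M\<^esub> U, mult = undefined, one = undefined, zero = U,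
      add = (\<lambda>A B. A <+>\<^bsub>M\<^esub> B), smult = (\<lambda>c A. \<Union>a\<in>A. U +>\<^bsub>M\<^esub> (c \<odot>\<^bsub>M\<^esub> a))\<rparr>"

definition quot_map :: "(rat, 'b) module \<Rightarrow> 'b set \<Rightarrow> ('a \<Rightarrow> 'b) \<Rightarrow> 'a set \<Rightarrow> 'b set" where
  "quot_map M U h A = (\<Union>a\<in>A. U +>\<^bsub>M\<^esub> h a)"

definition rat_space_iso :: "(rat, 'a) module \<Rightarrow> (rat, 'b) module \<Rightarrow> ('a \<Rightarrow> 'b) \<Rightarrow> bool" where
  "rat_space_iso M N h \<longleftrightarrow>
     module rat_ring M \<and> module rat_ring N \<and>
     h \<in> iso (add_monoid M) (add_monoid N) \<and>
     (\<forall>c. \<forall>x\<in>carrier M. h (c \<odot>\<^bsub>M\<^esub> x) = c \<odot>\<^bsub>N\<^esub> h x)"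


section \<open>Weakly holomorphic modular forms\<close>

text \<open>Functions on the upper half plane are represented by functions on the complex plane that
  vanish outside it.\<close>

definition nome :: "complex \<Rightarrow> complex" where
  "nome z = exp (2 * of_real pi * \<i> * z)"

definition wh_modular_forms :: "int \<Rightarrow> (complex \<Rightarrow> complex) set" where
  "wh_modular_forms m =
     {f. (\<forall>z. Im z \<le> 0 \<longrightarrow> f z = 0) \<and>
         f holomorphic_on {z. Im z > 0} \<and>
         (\<forall>a b c d :: int. a * d - b * c = 1 \<longrightarrow>
            (\<forall>z. Im z > 0 \<longrightarrow>
               f ((of_int a * z + of_int b) / (of_int c * z + of_int d)) =
               (of_int c * z + of_int d) powi m * f z)) \<and>
         (\<exists>(N::int) (a :: int \<Rightarrow> rat). \<forall>z. Im z > 0 \<longrightarrow>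
            (\<lambda>k::nat. of_rat (a (int k - N)) * nome z powi (int k - N)) sums f z)}"

definition wh_space :: "int \<Rightarrow> (rat, complex \<Rightarrow> complex) module" where
  "wh_space m =
     \<lparr>carrier = wh_modular_forms m, mult = undefined, one = undefined, zero = (\<lambda>z. 0),
      add = (\<lambda>f g z. f z + g z), smult = (\<lambda>c f z. of_rat c * f z)\<rparr>"

text \<open>The operator \<open>q d/dq\<close>; since \<open>q = exp (2 \<pi> i z)\<close> it is \<open>(2 \<pi> i)\<^sup>-\<^sup>1 d/dz\<close>.\<close>

definition qD :: "(complex \<Rightarrow> complex) \<Rightarrow> complex \<Rightarrow> complex" where
  "qD f z = (if Im z > 0 then deriv f z / (2 * of_real pi * \<i>) else 0)"

fun bernoulli_number :: "nat \<Rightarrow> rat" where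
  "bernoulli_number 0 = 1"
| "bernoulli_number (Suc n) =
     - (1 / of_nat (n + 2)) * (\<Sum>k\<le>n. of_nat ((n + 2) choose k) * bernoulli_number k)"

text \<open>\<open>eisenstein k\<close> is the normalised Eisenstein series of weight \<open>2 k\<close>.\<close>

definition eisenstein :: "nat \<Rightarrow> complex \<Rightarrow> complex" where
  "eisenstein k z =
     of_rat (- bernoulli_number (2 * k) / of_nat (4 * k)) +
     (\<Sum>m. of_nat (\<Sum>d | d dvd Suc m. d ^ (2 * k - 1)) * nome z ^ Suc m)"


section \<open>The coordinate ring of X\<close>

text \<open>The ring \<open>\<rat>[u,v]\<close> is \<open>rat poly poly\<close>, with \<open>v\<close> the outer variable: the coefficient of
  \<open>u\<^sup>i v\<^sup>j\<close> in \<open>p\<close> is \<open>coeff (coeff p j) i\<close>. Since \<open>\<rat>[u,v]\<close> is a domain, its localisation at \<open>\<Delta>\<close>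
  is a subring of the field of fractions.\<close>

type_synonym quv = "rat poly poly"
type_synonym kuv = "quv fract"

definition pu :: quv where "pu = [:[:0, 1:]:]"
definition pv :: quv where "pv = [:0, 1:]"
definition pDelta :: quv where "pDelta = pu ^ 3 - 27 * pv ^ 2"

definition Xu :: kuv where "Xu = Fract pu 1"
definition Xv :: kuv where "Xv = Fract pv 1"
definition Delta :: kuv where "Delta = Xu ^ 3 - 27 * Xv ^ 2"

definition rat_const :: "rat \<Rightarrow> kuv" where
  "rat_const c = Fract [:[:c:]:] 1"

definition OX :: "kuv set" where
  "OX = {Fract p (pDelta ^ k) | p k. True}"

text \<open>The piece of weight \<open>m\<close>: numerators are weighted homogeneous of weight \<open>m + 12 k\<close>.\<close>

definition gr :: "int \<Rightarrow> kuv set" where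
  "gr m = {Fract p (pDelta ^ k) | p k.
     \<forall>i j. coeff (coeff p j) i \<noteq> 0 \<longrightarrow> 4 * int i + 6 * int j = m + 12 * int k}"

text \<open>The restriction to \<open>\<mu>\<^sub>1\<^sub>2\<close> of the action of the multiplicative group corresponds to reducing the grading modulo 12:
  \<open>gr12 r\<close> is the sum of all \<open>gr m\<close> with \<open>m\<close> congruent to \<open>r\<close> (note that \<open>\<Delta>\<close> has weight 12).\<close>

definition gr12 :: "int \<Rightarrow> kuv set" where
  "gr12 r = {Fract p (pDelta ^ k) | p k.
     \<forall>i j. coeff (coeff p j) i \<noteq> 0 \<longrightarrow> [4 * int i + 6 * int j = r] (mod 12)}"

definition eval_uv :: "quv \<Rightarrow> complex \<Rightarrow> complex \<Rightarrow> complex" where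
  "eval_uv p x y = poly (map_poly (\<lambda>a. poly (map_poly of_rat a) x) p) y"

text \<open>\<open>f\<close> arises from \<open>a\<close> by the substitution \<open>u = 20 G\<^sub>4\<close>, \<open>v = (7/3) G\<^sub>6\<close>.\<close>

definition substitution :: "kuv \<Rightarrow> (complex \<Rightarrow> complex) \<Rightarrow> bool" where
  "substitution a f \<longleftrightarrow>
     (\<exists>p k. a = Fract p (pDelta ^ k) \<and>
        f = (\<lambda>z. if Im z > 0
               then eval_uv p (20 * eisenstein 2 z) (7/3 * eisenstein 3 z) /
                    eval_uv pDelta (20 * eisenstein 2 z) (7/3 * eisenstein 3 z) ^ k
               else 0))"

definition gr_of_form :: "int \<Rightarrow> (complex \<Rightarrow> complex) \<Rightarrow> kuv" where
  "gr_of_form m f = (THE a. a \<in> gr m \<and> substitution a f)"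


section \<open>Differential forms on X\<close>

text \<open>The extension of a derivation to the field of fractions by the quotient rule; \<open>fract_deriv_Fract\<close>
  shows that the description determines it.\<close>

definition fract_deriv :: "('a::idom \<Rightarrow> 'a) \<Rightarrow> 'a fract \<Rightarrow> 'a fract" where
  "fract_deriv \<delta> x =
     (THE y. \<forall>a b. b \<noteq> 0 \<longrightarrow> x = Fract a b \<longrightarrow> y = Fract (\<delta> a * b - a * \<delta> b) (b * b))"

lemma fract_deriv_Fract:
  fixes \<delta> :: "'a::idom \<Rightarrow> 'a"
  assumes mult: "\<And>p q. \<delta> (p * q) = \<delta> p * q + p * \<delta> q" and "b \<noteq> 0"
  shows "fract_deriv \<delta> (Fract a b) = Fract (\<delta> a * b - a * \<delta> b) (b * b)"
proof -
  have wd: "Fract (\<delta> a * b - a * \<delta> b) (b * b) = Fract (\<delta> c * d - c * \<delta> d) (d * d)"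
    if "d \<noteq> 0" and "Fract a b = Fract c d" for c d
  proof -
    have eq: "a * d = c * b"
      using that \<open>b \<noteq> 0\<close> by (simp add: eq_fract)
    then have eq': "\<delta> a * d + a * \<delta> d = \<delta> c * b + c * \<delta> b"
      by (metis mult)
    have "(\<delta> a * b - a * \<delta> b) * (d * d) - (\<delta> c * d - c * \<delta> d) * (b * b)
        = b * d * ((\<delta> a * d + a * \<delta> d) - (\<delta> c * b + c * \<delta> b))
          - (a * d - c * b) * (b * \<delta> d + d * \<delta> b)"
      by (simp add: algebra_simps)
    with eq eq' have "(\<delta> a * b - a * \<delta> b) * (d * d) = (\<delta> c * d - c * \<delta> d) * (b * b)"
      by simp
    with that \<open>b \<noteq> 0\<close> show ?thesis
      by (simp add: eq_fract)
  qed
  show ?thesis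
    unfolding fract_deriv_def
    by (rule the_equality) (use wd \<open>b \<noteq> 0\<close> in blast)+
qed

definition Du :: "kuv \<Rightarrow> kuv" where "Du = fract_deriv (map_poly pderiv)"
definition Dv :: "kuv \<Rightarrow> kuv" where "Dv = fract_deriv pderiv"

lemma Du_Fract:
  assumes "b \<noteq> 0"
  shows "Du (Fract a b) = Fract (map_poly pderiv a * b - a * map_poly pderiv b) (b * b)"
proof -
  have sum: "pderiv (sum f A) = (\<Sum>k\<in>A. pderiv (f k))" for f :: "nat \<Rightarrow> rat poly" and A
    by (induction A rule: infinite_finite_induct) (simp_all add: pderiv_add)
  have "map_poly pderiv (p * q) = map_poly pderiv p * q + p * map_poly pderiv q" for p q :: quv
    by (rule poly_eqI)
       (simp add: coeff_map_poly coeff_mult sum pderiv_mult sum.distrib, simp add: ac_simps)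
  then show ?thesis
    unfolding Du_def using assms by (rule fract_deriv_Fract)
qed

lemma Dv_Fract: "b \<noteq> 0 \<Longrightarrow> Dv (Fract a b) = Fract (pderiv a * b - a * pderiv b) (b * b)"
  unfolding Dv_def
  by (intro fract_deriv_Fract) (simp_all add: pderiv_mult algebra_simps)

text \<open>A one-form \<open>\<alpha> du + \<beta> dv\<close> is given by its components. The names \<open>psi_u\<close>, \<open>psi_v\<close>, \<open>omega_u\<close>,
  \<open>omega_v\<close> stand for those of \<open>\<psi> = d\<Delta> / (12 \<Delta>)\<close> and \<open>\<omega> = (3/2) (2 u dv - 3 v du) / \<Delta>\<close>.\<close>

definition psi_u :: kuv where "psi_u = 1/12 * (Du Delta / Delta)"
definition psi_v :: kuv where "psi_v = 1/12 * (Dv Delta / Delta)"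
definition omega_u :: kuv where "omega_u = 3/2 * (- 3 * Xv / Delta)"
definition omega_v :: kuv where "omega_v = 3/2 * (2 * Xu / Delta)"


section \<open>The bundles with connection on X\<close>

text \<open>The symmetric algebra on \<open>S\<close> and \<open>T\<close> is the polynomial ring in \<open>S\<close> and \<open>T\<close>, with \<open>T\<close> the outer
  variable: the coefficient of \<open>S\<^sup>i T\<^sup>j\<close> in \<open>P\<close> is \<open>coeff (coeff P j) i\<close>. The sections of the \<open>n\<close>-th
  symmetric power are the elements of degree \<open>n\<close> with coefficients in \<open>OX\<close>.\<close>

type_synonym sym = "kuv poly poly"

definition scal :: "kuv \<Rightarrow> sym" where "scal a = [:[:a:]:]"
definition gS :: sym where "gS = [:[:0, 1:]:]"
definition gT :: sym where "gT = [:0, 1:]"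

definition Vn :: "nat \<Rightarrow> sym set" where
  "Vn n = {P. \<forall>i j. coeff (coeff P j) i \<in> OX \<and> (coeff (coeff P j) i \<noteq> 0 \<longrightarrow> i + j = n)}"

text \<open>The part of \<open>Vn n\<close> of weight congruent to \<open>r\<close> modulo 12, where \<open>S\<close> has weight 1 and \<open>T\<close> has
  weight \<open>-1\<close>.\<close>

definition V12 :: "nat \<Rightarrow> int \<Rightarrow> sym set" where
  "V12 n r = {P \<in> Vn n. \<forall>i j. coeff (coeff P j) i \<in> gr12 (r - int i + int j)}"

text \<open>The connection on the symmetric powers is the derivation of the symmetric algebra that
  extends the derivation of the coefficients and takes the values
  \<open>\<nabla>S = \<psi> S - (u/12) \<omega> T\<close> and \<open>\<nabla>T = \<omega> S - \<psi> T\<close>; hence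
  \<open>\<nabla>P = dP + (\<partial>P/\<partial>S) \<nabla>S + (\<partial>P/\<partial>T) \<nabla>T\<close>, with \<open>d\<close> acting on coefficients. Below are the
  contractions of \<open>\<nabla>\<close> with \<open>\<partial>/\<partial>u\<close> and \<open>\<partial>/\<partial>v\<close>.\<close>

definition nabla_u :: "sym \<Rightarrow> sym" where
  "nabla_u P =
     map_poly (map_poly Du) P
     + map_poly pderiv P * (scal psi_u * gS - scal (Xu / 12 * omega_u) * gT)
     + pderiv P * (scal omega_u * gS - scal psi_u * gT)"

definition nabla_v :: "sym \<Rightarrow> sym" where
  "nabla_v P =
     map_poly (map_poly Dv) P
     + map_poly pderiv P * (scal psi_v * gS - scal (Xu / 12 * omega_v) * gT)
     + pderiv P * (scal omega_v * gS - scal psi_v * gT)"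

text \<open>The de Rham complex on \<open>X\<close> with coefficients in \<open>Vn n\<close>: a pair \<open>(A, B)\<close> is the one-form
  \<open>A du + B dv\<close>, and a two-form is given by its coefficient of \<open>du \<and> dv\<close>.\<close>

definition X0 :: "nat \<Rightarrow> (rat, sym) module" where
  "X0 n = rat_space (Vn n) (\<lambda>c P. scal (rat_const c) * P)"

definition X1 :: "nat \<Rightarrow> (rat, sym \<times> sym) module" where
  "X1 n = rat_space (Vn n \<times> Vn n) (\<lambda>c (A, B). (scal (rat_const c) * A, scal (rat_const c) * B))"

definition X2 :: "nat \<Rightarrow> (rat, sym) module" where
  "X2 n = X0 n"

definition nabla0 :: "sym \<Rightarrow> sym \<times> sym" where
  "nabla0 P = (nabla_u P, nabla_v P)"

definition nabla1 :: "sym \<times> sym \<Rightarrow> sym" where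
  "nabla1 = (\<lambda>(A, B). nabla_u B - nabla_v A)"


section \<open>The de Rham complex on Z and its invariants\<close>

text \<open>For the closed subscheme \<open>Z\<close> given by \<open>\<Delta> = 1\<close>, the de Rham algebra of \<open>Z\<close> is that of \<open>X\<close>
  modulo the differential ideal generated by \<open>\<Delta> - 1\<close>, that is, the ideal generated by \<open>\<Delta> - 1\<close>
  and \<open>d\<Delta>\<close>. The sets \<open>I0\<close>, \<open>I1\<close>, \<open>I2\<close> are the multiples of this ideal in the forms of degree
  0, 1, 2 with coefficients in \<open>Vn n\<close>.\<close>

definition I0 :: "nat \<Rightarrow> sym set" where
  "I0 n = {scal (Delta - 1) * P | P. P \<in> Vn n}"

definition I1 :: "nat \<Rightarrow> (sym \<times> sym) set" where
  "I1 n = {(scal (Delta - 1) * A + scal (Du Delta) * P, scal (Delta - 1) * B + scal (Dv Delta) * P)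
           | A B P. A \<in> Vn n \<and> B \<in> Vn n \<and> P \<in> Vn n}"

definition I2 :: "nat \<Rightarrow> sym set" where
  "I2 n = {scal (Delta - 1) * P + (scal (Du Delta) * B - scal (Dv Delta) * A)
           | A B P. A \<in> Vn n \<and> B \<in> Vn n \<and> P \<in> Vn n}"

definition Z0 :: "nat \<Rightarrow> (rat, sym set) module" where
  "Z0 n = quot_space (X0 n) (I0 n)"

definition Z1 :: "nat \<Rightarrow> (rat, (sym \<times> sym) set) module" where
  "Z1 n = quot_space (X1 n) (I1 n)"

definition Z2 :: "nat \<Rightarrow> (rat, sym set) module" where
  "Z2 n = quot_space (X2 n) (I2 n)"

definition nablaZ0 :: "nat \<Rightarrow> sym set \<Rightarrow> (sym \<times> sym) set" where
  "nablaZ0 n = quot_map (X1 n) (I1 n) nabla0"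

definition nablaZ1 :: "nat \<Rightarrow> (sym \<times> sym) set \<Rightarrow> sym set" where
  "nablaZ1 n = quot_map (X2 n) (I2 n) nabla1"

text \<open>The \<open>\<mu>\<^sub>1\<^sub>2\<close>-invariants are the part of degree 0 for the induced grading by integers modulo 12,
  the image of the part of weight 0 modulo 12 on \<open>X\<close>; here \<open>du\<close> has weight 4 and \<open>dv\<close> weight 6.\<close>

definition inv0 :: "nat \<Rightarrow> sym set set" where
  "inv0 n = {I0 n +>\<^bsub>X0 n\<^esub> P | P. P \<in> V12 n 0}"

definition inv1 :: "nat \<Rightarrow> (sym \<times> sym) set set" where
  "inv1 n = {I1 n +>\<^bsub>X1 n\<^esub> (A, B) | A B. A \<in> V12 n (- 4) \<and> B \<in> V12 n (- 6)}"

definition closed1 :: "nat \<Rightarrow> (rat, (sym \<times> sym) set) module" where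
  "closed1 n = (Z1 n)\<lparr>carrier := {\<eta> \<in> inv1 n. nablaZ1 n \<eta> = \<zero>\<^bsub>Z2 n\<^esub>}\<rparr>"

definition exact1 :: "nat \<Rightarrow> (sym \<times> sym) set set" where
  "exact1 n = nablaZ0 n ` inv0 n"

definition H1dR :: "nat \<Rightarrow> (rat, (sym \<times> sym) set set) module" where
  "H1dR n = quot_space (closed1 n) (exact1 n)"

definition H1_class :: "nat \<Rightarrow> sym \<times> sym \<Rightarrow> (sym \<times> sym) set set" where
  "H1_class n \<eta> = exact1 n +>\<^bsub>closed1 n\<^esub> (I1 n +>\<^bsub>X1 n\<^esub> \<eta>)"

text \<open>The one-form \<open>\<omega>\<^sub>f = f \<omega> T\<^sup>n\<close> on \<open>X\<close>.\<close>

definition omega_form :: "nat \<Rightarrow> (complex \<Rightarrow> complex) \<Rightarrow> sym \<times> sym" where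
  "omega_form n f =
     (let a = gr_of_form (int n + 2) f in (scal (a * omega_u) * gT ^ n, scal (a * omega_v) * gT ^ n))"

definition bol_image :: "nat \<Rightarrow> (complex \<Rightarrow> complex) set" where
  "bol_image n = (qD ^^ (n + 1)) ` wh_modular_forms (- int n)"

end

theory Submission
  imports Defs "HOL-Complex_Analysis.Complex_Analysis"
begin

text \<open>
  Both sides are computed as the same quotient of the graded piece \<open>gr (n + 2)\<close> of the coordinate ring.

  On the cohomological side, the curve \<open>Z\<close> has no two-forms, and contraction with the vector field
  \<open>vt = 6 v \<partial>/\<partial>u + (u\<^sup>2/3) \<partial>/\<partial>v\<close>, which annihilates \<open>\<Delta>\<close> and satisfies \<open>\<psi>(vt) = 0\<close> and
  \<open>\<omega>(vt) = 1\<close>, turns one-forms on \<open>Z\<close> into sections (\<open>I1_iff\<close>). The cohomology is thus the cokernel of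
  the contracted connection \<open>nabla_vt\<close> on invariant sections. If \<open>s\<^sub>i\<close> denotes the coefficient of
  \<open>S\<^sup>i T\<^sup>n\<^sup>-\<^sup>i\<close>, the \<open>i\<close>-th coefficient of \<open>nabla_vt s\<close> is
  \<open>vt s\<^sub>i + (n - i + 1) s\<^sub>i\<^sub>-\<^sub>1 - (i + 1) (u/12) s\<^sub>i\<^sub>+\<^sub>1\<close>. As \<open>n - i + 1\<close> is invertible for \<open>i > 0\<close>, a
  primitive can be chosen step by step so as to clear every coefficient except that of \<open>T\<^sup>n\<close>; this
  is the recursion \<open>descend\<close>. Every class is therefore represented by some \<open>a \<omega> T\<^sup>n\<close>, and such a form
  is exact if and only if the recursion, started at some \<open>b\<close>, ends with 0. Invariance under
  \<open>\<mu>\<^sub>1\<^sub>2\<close> only fixes weights modulo 12, but a function on \<open>Z\<close> of given weight modulo 12 has one and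
  only one representative on \<open>X\<close> of each integral weight in that class (\<open>gr12_homogenize\<close>, \<open>gr_J_zero\<close>), so that
  \<open>a\<close> may be taken in \<open>gr (n + 2)\<close> and \<open>b\<close> in \<open>gr (-n)\<close>. The result is \<open>H1dR_presentation\<close>.

  On the modular side, the substitution of Eisenstein series identifies \<open>gr m\<close> with the weakly holomorphic
  forms of weight \<open>m\<close> (\<open>wh_eq_form_of\<close>, \<open>form_of_inj\<close>). This rests on the classical facts for the full
  modular group, developed here for power series in \<open>q\<close> with rational coefficients: modularity of the
  Eisenstein series of weights 4 and 6, nonvanishing of the discriminant, generation of the ring
  of modular forms by the two series (\<open>mform_eq_peval\<close>) and their algebraic independence
  (\<open>peval_injective\<close>). By Ramanujan's differential equations \<open>vt\<close> corresponds to \<open>q d/dq - (m/12) E\<close> on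
  weight \<open>m\<close>, where \<open>E\<close> is the Eisenstein series of weight 2 (\<open>form_of_derivative\<close>).

  To compare the two, let \<open>f\<^sub>k\<close> be the forms produced by the recursion from \<open>a\<close> and \<open>b\<close>, ending with 0. The
  coefficients \<open>g\<^sub>j\<close> of \<open>\<Sum>\<^sub>k f\<^sub>k (x + E/12)\<^sup>n\<^sup>-\<^sup>k\<close> in \<open>x\<close>, which are the coordinates in a frame where the
  connection is \<open>q d/dq\<close> plus a constant nilpotent matrix, satisfy \<open>q dg\<^sub>0/dq = a\<close> and
  \<open>q dg\<^sub>j/dq = -(n - j + 1) g\<^sub>j\<^sub>-\<^sub>1\<close>, with \<open>g\<^sub>n = b\<close>. Hence the \<open>(n + 1)\<close>-st iterate of \<open>q d/dq\<close> maps \<open>b\<close> to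
  \<open>(-1)\<^sup>n n! a\<close> (\<open>bol_identity\<close>), which exhibits the kernel of the class map as the image of Bol's
  operator. The first isomorphism theorem concludes.
\<close>

section \<open>Quotients of rational vector spaces\<close>

lemma cring_rat_ring: "cring rat_ring"
proof (rule cringI)
  show "abelian_group rat_ring"
  proof (rule abelian_groupI)
    fix x assume "x \<in> carrier rat_ring"
    show "\<exists>y\<in>carrier rat_ring. y \<oplus>\<^bsub>rat_ring\<^esub> x = \<zero>\<^bsub>rat_ring\<^esub>"
      by (rule bexI[of _ "- x"]) (auto simp: rat_ring_def)
  qed (auto simp: rat_ring_def)
  show "Group.comm_monoid rat_ring"
    by (rule comm_monoidI) (auto simp: rat_ring_def)
qed (auto simp: rat_ring_def algebra_simps)

lemma carrier_rat_ring [simp]: "carrier rat_ring = UNIV"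
  by (simp add: rat_ring_def)

lemma module_rat_ringI:
  assumes "abelian_group M"
    and "\<And>c x. x \<in> carrier M \<Longrightarrow> c \<odot>\<^bsub>M\<^esub> x \<in> carrier M"
    and "\<And>c d x. x \<in> carrier M \<Longrightarrow> (c + d) \<odot>\<^bsub>M\<^esub> x = c \<odot>\<^bsub>M\<^esub> x \<oplus>\<^bsub>M\<^esub> d \<odot>\<^bsub>M\<^esub> x"
    and "\<And>c x y. x \<in> carrier M \<Longrightarrow> y \<in> carrier M \<Longrightarrow>
           c \<odot>\<^bsub>M\<^esub> (x \<oplus>\<^bsub>M\<^esub> y) = c \<odot>\<^bsub>M\<^esub> x \<oplus>\<^bsub>M\<^esub> c \<odot>\<^bsub>M\<^esub> y"
    and "\<And>c d x. x \<in> carrier M \<Longrightarrow> (c * d) \<odot>\<^bsub>M\<^esub> x = c \<odot>\<^bsub>M\<^esub> (d \<odot>\<^bsub>M\<^esub> x)"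
    and "\<And>x. x \<in> carrier M \<Longrightarrow> 1 \<odot>\<^bsub>M\<^esub> x = x"
  shows "module rat_ring M"
  by (rule moduleI) (use assms cring_rat_ring in \<open>auto simp: rat_ring_def\<close>)

lemma module_rat_ring_rules:
  assumes "module rat_ring M"
  shows "x \<in> carrier M \<Longrightarrow> c \<odot>\<^bsub>M\<^esub> x \<in> carrier M"
    and "x \<in> carrier M \<Longrightarrow> (c + d) \<odot>\<^bsub>M\<^esub> x = c \<odot>\<^bsub>M\<^esub> x \<oplus>\<^bsub>M\<^esub> d \<odot>\<^bsub>M\<^esub> x"
    and "x \<in> carrier M \<Longrightarrow> y \<in> carrier M \<Longrightarrow>
           c \<odot>\<^bsub>M\<^esub> (x \<oplus>\<^bsub>M\<^esub> y) = c \<odot>\<^bsub>M\<^esub> x \<oplus>\<^bsub>M\<^esub> c \<odot>\<^bsub>M\<^esub> y"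
    and "x \<in> carrier M \<Longrightarrow> (c * d) \<odot>\<^bsub>M\<^esub> x = c \<odot>\<^bsub>M\<^esub> (d \<odot>\<^bsub>M\<^esub> x)"
    and "x \<in> carrier M \<Longrightarrow> 1 \<odot>\<^bsub>M\<^esub> x = x"
  using module.smult_closed[OF assms, of c x] module.smult_l_distr[OF assms, of c d x]
    module.smult_r_distr[OF assms, of c x y] module.smult_assoc1[OF assms, of c d x]
    module.smult_one[OF assms, of x]
  by (simp_all add: rat_ring_def)

lemma module_rat_space:
  fixes V :: "'a::ab_group_add set"
  assumes "0 \<in> V" and "\<And>x y. x \<in> V \<Longrightarrow> y \<in> V \<Longrightarrow> x + y \<in> V" and "\<And>x. x \<in> V \<Longrightarrow> - x \<in> V"
    and "\<And>c x. x \<in> V \<Longrightarrow> s c x \<in> V"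
    and "\<And>c d x. s (c + d) x = s c x + s d x" and "\<And>c x y. s c (x + y) = s c x + s c y"
    and "\<And>c d x. s (c * d) x = s c (s d x)" and "\<And>x. s 1 x = x"
  shows "module rat_ring (rat_space V s)"
proof (rule module_rat_ringI)
  show "abelian_group (rat_space V s)"
    by (rule abelian_groupI)
       (use assms(1-3) in \<open>auto simp: rat_space_def algebra_simps add_eq_0_iff\<close>)
qed (use assms in \<open>auto simp: rat_space_def\<close>)

lemma submodule_rat_ringI:
  assumes M: "module rat_ring M" and "U \<subseteq> carrier M" and "\<zero>\<^bsub>M\<^esub> \<in> U"
    and "\<And>x y. x \<in> U \<Longrightarrow> y \<in> U \<Longrightarrow> x \<oplus>\<^bsub>M\<^esub> y \<in> U" and smult: "\<And>c x. x \<in> U \<Longrightarrow> c \<odot>\<^bsub>M\<^esub> x \<in> U"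
  shows "submodule U rat_ring M"
proof -
  interpret module rat_ring M by (rule M)
  have minus: "\<ominus>\<^bsub>M\<^esub> x \<in> U" if "x \<in> U" for x
  proof -
    have x: "x \<in> carrier M" using that assms by auto
    have "\<one>\<^bsub>rat_ring\<^esub> \<in> carrier rat_ring" by simp
    then have "\<ominus>\<^bsub>M\<^esub> x = (\<ominus>\<^bsub>rat_ring\<^esub> \<one>\<^bsub>rat_ring\<^esub>) \<odot>\<^bsub>M\<^esub> x"
      using x smult_l_minus[of "\<one>\<^bsub>rat_ring\<^esub>" x] by simp
    then show ?thesis using smult[OF that] by simp
  qed
  show ?thesis
    by (rule submoduleI) (use assms minus in auto)
qed

locale rat_quotient =
  fixes M :: "(rat, 'a) module" and U
  assumes module_M: "module rat_ring M" and submodule_U: "submodule U rat_ring M"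
begin

sublocale M: module rat_ring M by (rule module_M)

sublocale abelian_subgroup U M
  by (rule abelian_subgroupI3)
     (use submodule_U in \<open>auto simp: submodule_def intro: additive_subgroupI M.abelian_group_axioms\<close>)

lemma U_smult: "x \<in> U \<Longrightarrow> c \<odot>\<^bsub>M\<^esub> x \<in> U"
  using submodule.smult_closed[OF submodule_U] by simp

lemma rcos_eq_iff:
  assumes "x \<in> carrier M" "y \<in> carrier M"
  shows "U +>\<^bsub>M\<^esub> x = U +>\<^bsub>M\<^esub> y \<longleftrightarrow> x \<oplus>\<^bsub>M\<^esub> \<ominus>\<^bsub>M\<^esub> y \<in> U"
  using a_rcos_module[OF assms(2,1)] a_repr_independence'[of x y] a_rcos_self[OF assms(1)] assms
  by metis

lemma rcos_eqI:
  assumes "x \<in> carrier M" "y \<in> carrier M" "u \<in> U" "x = u \<oplus>\<^bsub>M\<^esub> y"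
  shows "U +>\<^bsub>M\<^esub> x = U +>\<^bsub>M\<^esub> y"
  using assms by (simp add: rcos_eq_iff M.a_assoc M.r_neg)

lemma in_rcosD:
  assumes "y \<in> U +>\<^bsub>M\<^esub> x" shows "\<exists>u\<in>U. y = u \<oplus>\<^bsub>M\<^esub> x"
  using assms by (auto simp: a_r_coset_def')

lemma carrier_quot: "carrier (quot_space M U) = (\<lambda>x. U +>\<^bsub>M\<^esub> x) ` carrier M"
  by (auto simp: quot_space_def A_RCOSETS_def')

lemma zero_quot: "\<zero>\<^bsub>quot_space M U\<^esub> = U"
  by (simp add: quot_space_def)

lemma rcos_zero: "U +>\<^bsub>M\<^esub> \<zero>\<^bsub>M\<^esub> = U"
  by (rule a_rcos_const) simp

lemma rcos_add:
  assumes "x \<in> carrier M" "y \<in> carrier M"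
  shows "(U +>\<^bsub>M\<^esub> x) \<oplus>\<^bsub>quot_space M U\<^esub> (U +>\<^bsub>M\<^esub> y) = U +>\<^bsub>M\<^esub> (x \<oplus>\<^bsub>M\<^esub> y)"
  using a_rcos_sum[OF assms] by (simp add: quot_space_def)

text \<open>A union over a coset that does not depend on the representative is its value at any one of
  them; both the scalar multiplication of a quotient and the maps between quotients are such unions.\<close>

lemma Union_rcos:
  assumes "x \<in> carrier M" and "\<And>u. u \<in> U \<Longrightarrow> F (u \<oplus>\<^bsub>M\<^esub> x) = F x"
  shows "(\<Union>a\<in>U +>\<^bsub>M\<^esub> x. F a) = F x"
proof -
  have "F a = F x" if "a \<in> U +>\<^bsub>M\<^esub> x" for a
    using in_rcosD[OF that] assms(2) by metis
  then show ?thesis using a_rcos_self[OF assms(1)] by blast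
qed

lemma rcos_smult:
  assumes x: "x \<in> carrier M"
  shows "c \<odot>\<^bsub>quot_space M U\<^esub> (U +>\<^bsub>M\<^esub> x) = U +>\<^bsub>M\<^esub> (c \<odot>\<^bsub>M\<^esub> x)"
proof -
  have "U +>\<^bsub>M\<^esub> (c \<odot>\<^bsub>M\<^esub> (u \<oplus>\<^bsub>M\<^esub> x)) = U +>\<^bsub>M\<^esub> (c \<odot>\<^bsub>M\<^esub> x)" if u: "u \<in> U" for u
  proof (rule rcos_eqI)
    have "u \<in> carrier M" using u by simp
    then show "c \<odot>\<^bsub>M\<^esub> (u \<oplus>\<^bsub>M\<^esub> x) \<in> carrier M" "c \<odot>\<^bsub>M\<^esub> x \<in> carrier M"
      "c \<odot>\<^bsub>M\<^esub> (u \<oplus>\<^bsub>M\<^esub> x) = c \<odot>\<^bsub>M\<^esub> u \<oplus>\<^bsub>M\<^esub> c \<odot>\<^bsub>M\<^esub> x"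
      using x by (auto intro!: module_rat_ring_rules[OF module_M])
  qed (rule U_smult[OF u])
  then show ?thesis
    using Union_rcos[OF x, of "\<lambda>a. U +>\<^bsub>M\<^esub> (c \<odot>\<^bsub>M\<^esub> a)"] by (simp add: quot_space_def)
qed

lemma module_quot: "module rat_ring (quot_space M U)"
proof (rule module_rat_ringI)
  have zero: "\<zero>\<^bsub>quot_space M U\<^esub> = U +>\<^bsub>M\<^esub> \<zero>\<^bsub>M\<^esub>"
    by (simp add: zero_quot rcos_zero)
  show "abelian_group (quot_space M U)"
  proof (rule abelian_groupI)
    fix x assume "x \<in> carrier (quot_space M U)"
    then obtain a where a: "a \<in> carrier M" "x = U +>\<^bsub>M\<^esub> a" by (auto simp: carrier_quot)
    show "\<exists>y\<in>carrier (quot_space M U). y \<oplus>\<^bsub>quot_space M U\<^esub> x = \<zero>\<^bsub>quot_space M U\<^esub>"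
      by (rule bexI[of _ "U +>\<^bsub>M\<^esub> (\<ominus>\<^bsub>M\<^esub> a)"])
         (use a in \<open>auto simp: zero carrier_quot M.l_neg rcos_add\<close>)
  qed (auto simp: carrier_quot zero rcos_add M.a_ac)
qed (auto simp: carrier_quot rcos_add rcos_smult module_rat_ring_rules[OF module_M])

end

lemma submodule_kernel:
  assumes M: "module rat_ring M" and N: "module rat_ring N"
    and add: "\<And>x y. x \<in> carrier M \<Longrightarrow> y \<in> carrier M \<Longrightarrow> h (x \<oplus>\<^bsub>M\<^esub> y) = h x \<oplus>\<^bsub>N\<^esub> h y"
    and smult: "\<And>c x. x \<in> carrier M \<Longrightarrow> h (c \<odot>\<^bsub>M\<^esub> x) = c \<odot>\<^bsub>N\<^esub> h x"
    and closed: "\<And>x. x \<in> carrier M \<Longrightarrow> h x \<in> carrier N"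
  shows "abelian_group_hom M N h" and "submodule {x \<in> carrier M. h x = \<zero>\<^bsub>N\<^esub>} rat_ring M"
proof -
  interpret M: module rat_ring M by (rule M)
  interpret N: module rat_ring N by (rule N)
  show "abelian_group_hom M N h"
  proof (rule abelian_group_homI[OF M.abelian_group_axioms N.abelian_group_axioms])
    show "group_hom (add_monoid M) (add_monoid N) h"
      using add closed
      by (intro group_hom.intro group_hom_axioms.intro M.a_group N.a_group) (simp add: hom_def)
  qed
  then interpret h: abelian_group_hom M N h .
  show "submodule {x \<in> carrier M. h x = \<zero>\<^bsub>N\<^esub>} rat_ring M"
  proof (rule submodule_rat_ringI[OF M])
    show "c \<odot>\<^bsub>M\<^esub> x \<in> {x \<in> carrier M. h x = \<zero>\<^bsub>N\<^esub>}" if "x \<in> {x \<in> carrier M. h x = \<zero>\<^bsub>N\<^esub>}" for c x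
      using that smult[of x c] N.smult_r_null[of c] module_rat_ring_rules(1)[OF M, of x c]
      by simp
  qed auto
qed

text \<open>The first isomorphism theorem. Scalar multiplication in the quotient is defined by a union over a
  coset, so the linearity of the induced map comes from the lemmas on representatives above.\<close>

lemma rat_space_iso_kernel:
  assumes M: "module rat_ring M" and N: "module rat_ring N"
    and add: "\<And>x y. x \<in> carrier M \<Longrightarrow> y \<in> carrier M \<Longrightarrow> h (x \<oplus>\<^bsub>M\<^esub> y) = h x \<oplus>\<^bsub>N\<^esub> h y"
    and smult: "\<And>c x. x \<in> carrier M \<Longrightarrow> h (c \<odot>\<^bsub>M\<^esub> x) = c \<odot>\<^bsub>N\<^esub> h x"
    and onto: "h ` carrier M = carrier N"
    and U: "U = {x \<in> carrier M. h x = \<zero>\<^bsub>N\<^esub>}"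
  shows "submodule U rat_ring M \<and>
    (\<exists>\<Phi>. rat_space_iso (quot_space M U) N \<Phi> \<and> (\<forall>x\<in>carrier M. \<Phi> (U +>\<^bsub>M\<^esub> x) = h x))"
proof -
  have closed: "h x \<in> carrier N" if "x \<in> carrier M" for x
    using onto that by blast
  note hom = submodule_kernel[OF M N add smult closed]
  have sub: "submodule U rat_ring M"
    using hom(2) by (simp add: U)
  interpret Q: rat_quotient M U
    by (rule rat_quotient.intro[OF M sub])
  define \<Phi> where "\<Phi> X = the_elem (h ` X)" for X
  have val: "\<Phi> (U +>\<^bsub>M\<^esub> x) = h x" if x: "x \<in> carrier M" for x
  proof -
    have "h ` (U +>\<^bsub>M\<^esub> x) = (\<Union>a\<in>U +>\<^bsub>M\<^esub> x. {h a})"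
      by (rule UNION_singleton_eq_range [symmetric])
    also have "\<dots> = {h x}"
    proof (rule Q.Union_rcos[OF x])
      fix u assume "u \<in> U"
      then have "u \<in> {x \<in> carrier M. h x = \<zero>\<^bsub>N\<^esub>}" by (simp only: U)
      then have "u \<in> carrier M" "h u = \<zero>\<^bsub>N\<^esub>" by blast+
      then show "{h (u \<oplus>\<^bsub>M\<^esub> x)} = {h x}"
        using add[of u x] x closed[OF x] abelian_monoid.l_zero[of N "h x"] N
        by (simp add: module_def abelian_group_def)
    qed
    finally show ?thesis by (simp add: \<Phi>_def)
  qed
  have ker: "U = a_kernel M N h"
    by (simp only: U a_kernel_def')
  have "\<Phi> \<in> iso (M A_Mod U) (add_monoid N)"
    unfolding \<Phi>_def ker by (rule abelian_group_hom.A_FactGroup_iso_set[OF hom(1) onto])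
  then have "\<Phi> \<in> iso (add_monoid (quot_space M U)) (add_monoid N)"
    by (simp add: A_FactGroup_def' quot_space_def iso_def hom_def)
  moreover have "\<Phi> (c \<odot>\<^bsub>quot_space M U\<^esub> X) = c \<odot>\<^bsub>N\<^esub> \<Phi> X" if "X \<in> carrier (quot_space M U)" for c X
  proof -
    from that obtain x where x: "x \<in> carrier M" "X = U +>\<^bsub>M\<^esub> x"
      by (auto simp: Q.carrier_quot)
    then show ?thesis
      by (simp add: Q.rcos_smult val module_rat_ring_rules(1)[OF M] smult)
  qed
  ultimately have "rat_space_iso (quot_space M U) N \<Phi>"
    by (auto simp: rat_space_iso_def Q.module_quot N)
  with val sub show ?thesis by blast
qed

section \<open>Weights in the coordinate ring\<close>

subsection \<open>Polynomials\<close>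

text \<open>The weights of the terms of a polynomial. Inclusions between such sets express homogeneity for the
  grading by integers and for the grading by integers modulo 12 at once.\<close>

definition wts :: "quv \<Rightarrow> int set" where
  "wts p = {4 * int i + 6 * int j | i j. coeff (coeff p j) i \<noteq> 0}"

lemma wts_0 [simp]: "wts 0 = {}"
  by (simp add: wts_def)

lemma wts_monom: "wts (monom (monom c i) j) \<subseteq> {4 * int i + 6 * int j}"
  by (auto simp: wts_def)

lemma const_eq_monom: "[:[:c:]:] = monom (monom c 0) 0"
  and pu_eq_monom: "pu = monom (monom 1 1) 0" and pv_eq_monom: "pv = monom (monom 1 0) 1"
  by (simp_all add: monom_0 monom_Suc pu_def pv_def one_pCons)

lemma wts_const: "wts [:[:c:]:] \<subseteq> {0}"
  using wts_monom[of c 0 0] by (simp add: const_eq_monom)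

lemma wts_1 [simp]: "wts 1 = {0}"
proof -
  have "(1 :: quv) = monom (monom 1 0) 0" by simp
  moreover have "0 \<in> wts 1"
    unfolding wts_def by (intro CollectI exI[of _ 0]) simp
  ultimately show ?thesis using wts_monom[of 1 0 0] by auto
qed

lemma wts_pu: "wts pu \<subseteq> {4}" and wts_pv: "wts pv \<subseteq> {6}"
  using wts_monom[of 1 1 0] wts_monom[of 1 0 1] by (simp_all add: pu_eq_monom pv_eq_monom)

lemma wts_add: "wts (p + q) \<subseteq> wts p \<union> wts q"
  by (fastforce simp: wts_def)

lemma wts_uminus [simp]: "wts (- p) = wts p"
  by (simp add: wts_def)

lemma wts_mult: "wts (p * q) \<subseteq> {s + t | s t. s \<in> wts p \<and> t \<in> wts q}"
proof
  fix w assume "w \<in> wts (p * q)"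
  then obtain m n where w: "w = 4 * int m + 6 * int n" and nz: "coeff (coeff (p * q) n) m \<noteq> 0"
    by (auto simp: wts_def)
  have "coeff (coeff (p * q) n) m =
        (\<Sum>j\<le>n. \<Sum>i\<le>m. coeff (coeff p j) i * coeff (coeff q (n - j)) (m - i))"
    by (simp add: coeff_mult coeff_sum)
  then obtain j i where "j \<le> n" "i \<le> m" "coeff (coeff p j) i \<noteq> 0" "coeff (coeff q (n - j)) (m - i) \<noteq> 0"
    using nz by (metis (no_types, lifting) atMost_iff mult_eq_0_iff sum.not_neutral_contains_not_neutral)
  moreover from this have "w = (4 * int i + 6 * int j) + (4 * int (m - i) + 6 * int (n - j))"
    by (simp add: w algebra_simps of_nat_diff)
  ultimately show "w \<in> {s + t | s t. s \<in> wts p \<and> t \<in> wts q}"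
    unfolding wts_def by blast
qed

lemma wts_mult_subset:
  assumes "wts p \<subseteq> A" "wts q \<subseteq> B" "\<And>s t. s \<in> A \<Longrightarrow> t \<in> B \<Longrightarrow> s + t \<in> C"
  shows "wts (p * q) \<subseteq> C"
  using wts_mult[of p q] assms by fast

lemma wts_power:
  assumes "wts p \<subseteq> {w}" shows "wts (p ^ k) \<subseteq> {int k * w}"
proof (induction k)
  case (Suc k)
  have "wts (p * p ^ k) \<subseteq> {int (Suc k) * w}"
    by (rule wts_mult_subset[OF assms Suc]) (simp add: algebra_simps)
  then show ?case by simp
qed simp

lemma wts_Delta_power: "wts (pDelta ^ k) \<subseteq> {12 * int k}"
proof -
  have "wts (- (27 * pv ^ 2)) \<subseteq> {12}"
    unfolding wts_uminus numeral_poly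
    by (rule wts_mult_subset[OF wts_const wts_power[OF wts_pv]]) simp
  then have "wts pDelta \<subseteq> {12}"
    using wts_add[of "pu ^ 3" "- (27 * pv ^ 2)"] wts_power[OF wts_pu, of 3]
    by (auto simp: pDelta_def)
  from wts_power[OF this, of k] show ?thesis by (simp add: mult.commute)
qed

lemma wts_Du: "wts (map_poly pderiv p) \<subseteq> (\<lambda>w. w - 4) ` wts p"
proof
  fix w assume "w \<in> wts (map_poly pderiv p)"
  then obtain i j where "w = 4 * int i + 6 * int j" "coeff (coeff p j) (Suc i) \<noteq> 0"
    by (auto simp: wts_def coeff_map_poly coeff_pderiv)
  then have "w = (4 * int (Suc i) + 6 * int j) - 4" "4 * int (Suc i) + 6 * int j \<in> wts p"
    unfolding wts_def by (simp, blast)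
  then show "w \<in> (\<lambda>w. w - 4) ` wts p" by blast
qed

lemma wts_Dv: "wts (pderiv p) \<subseteq> (\<lambda>w. w - 6) ` wts p"
proof
  fix w assume "w \<in> wts (pderiv p)"
  then obtain i j where "w = 4 * int i + 6 * int j" "coeff (of_nat (Suc j) * coeff p (Suc j)) i \<noteq> 0"
    by (auto simp: wts_def coeff_pderiv)
  then have "w = 4 * int i + 6 * int j" "coeff (coeff p (Suc j)) i \<noteq> 0"
    by (auto simp: of_nat_poly)
  then have "w = (4 * int i + 6 * int (Suc j)) - 6" "4 * int i + 6 * int (Suc j) \<in> wts p"
    unfolding wts_def by (simp, blast)
  then show "w \<in> (\<lambda>w. w - 6) ` wts p" by blast
qed

text \<open>Induction over the terms of \<open>p\<close>. The last case is restricted to terms that occur in \<open>p\<close>, so that the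
  homogeneity of \<open>p\<close> is available there.\<close>

lemma quv_monomial_induct [case_names zero add monom]:
  assumes "P 0" and "\<And>a b. P a \<Longrightarrow> P b \<Longrightarrow> P (a + b)"
    and "\<And>i j. coeff (coeff p j) i \<noteq> 0 \<Longrightarrow> P (monom (monom (coeff (coeff p j) i) i) j)"
  shows "P (p :: quv)"
proof -
  have sum: "P (sum f A)" if "\<And>x. x \<in> A \<Longrightarrow> P (f x)" for f :: "nat \<Rightarrow> quv" and A
    using that assms(1,2) by (induction A rule: infinite_finite_induct) auto
  have mono: "monom (sum g A) j = (\<Sum>i\<in>A. monom (g i) j)" for g :: "nat \<Rightarrow> rat poly" and A j
    by (induction A rule: infinite_finite_induct) (simp_all add: add_monom [symmetric])
  have "p = (\<Sum>j\<le>degree p. monom (\<Sum>i\<le>degree (coeff p j). monom (coeff (coeff p j) i) i) j)"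
    by (simp add: poly_as_sum_of_monoms)
  also have "\<dots> = (\<Sum>j\<le>degree p. \<Sum>i\<le>degree (coeff p j). monom (monom (coeff (coeff p j) i) i) j)"
    by (simp add: mono)
  also have "P \<dots>"
  proof (intro sum)
    fix i j show "P (monom (monom (coeff (coeff p j) i) i) j)"
      by (cases "coeff (coeff p j) i = 0") (use assms in auto)
  qed
  finally show ?thesis .
qed

lemma monom_monom_eq: "monom (monom c i) j = [:[:c:]:] * pu ^ i * pv ^ j"
proof -
  have "pv ^ j = monom 1 j" by (simp add: pv_def monom_altdef)
  moreover have "pu ^ i = [:monom 1 i:]"
  proof (induction i)
    case (Suc i)
    then show ?case by (simp add: pu_def monom_Suc mult.commute)
  qed (simp add: one_pCons)
  ultimately show ?thesis
    by (simp add: smult_monom mult.commute)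
qed

subsection \<open>The field of fractions\<close>

lemma pDelta_nonzero [simp]: "pDelta \<noteq> 0"
proof
  assume "pDelta = 0"
  moreover have "coeff (coeff pDelta 0) 3 = 1"
    by (simp add: pDelta_def pu_def pv_def eval_nat_numeral coeff_pCons numeral_poly)
  ultimately show False by simp
qed

lemma to_fract_numeral: "to_fract (numeral k) = numeral k"
  by (metis of_nat_fract of_nat_numeral to_fract_def)

lemma kuv_numeral_nonzero [simp]: "(numeral k :: kuv) \<noteq> 0"
  unfolding to_fract_numeral [symmetric] by simp

lemma to_fract_power: "to_fract (p ^ k) = to_fract p ^ k"
  by (induction k) simp_all

lemma Xu_eq: "Xu = to_fract pu" and Xv_eq: "Xv = to_fract pv"
  by (simp_all add: Xu_def Xv_def to_fract_def)

lemma Delta_eq: "Delta = to_fract pDelta"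
  by (simp add: Delta_def pDelta_def Xu_eq Xv_eq to_fract_power to_fract_numeral)

lemma Delta_nonzero [simp]: "Delta \<noteq> 0"
  by (simp add: Delta_eq)

lemma Fract_pDelta: "Fract p (pDelta ^ k) = to_fract p / Delta ^ k"
  by (simp add: Fract_conv_to_fract Delta_eq to_fract_power)

lemma rat_const_eq: "rat_const c = to_fract [:[:c:]:]"
  by (simp add: rat_const_def to_fract_def)

lemma rat_const_add: "rat_const (c + d) = rat_const c + rat_const d"
  and rat_const_mult: "rat_const (c * d) = rat_const c * rat_const d"
  and rat_const_0 [simp]: "rat_const 0 = 0" and rat_const_1 [simp]: "rat_const 1 = 1"
  and rat_const_minus: "rat_const (- c) = - rat_const c"
  unfolding rat_const_eq
  by (simp_all add: to_fract_add [symmetric] to_fract_mult [symmetric] to_fract_uminus [symmetric]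
        one_pCons [symmetric] del: to_fract_add to_fract_mult to_fract_uminus)

lemma rat_const_numeral: "rat_const (numeral k) = numeral k"
  by (simp add: rat_const_eq numeral_poly [symmetric] to_fract_numeral)

lemma rat_const_inverse_numeral: "rat_const (1 / numeral k) = 1 / numeral k"
proof -
  have "rat_const (1 / numeral k) * numeral k = 1"
    by (simp add: rat_const_numeral [symmetric] rat_const_mult [symmetric])
  then show ?thesis by (simp add: field_simps)
qed

lemma rat_const_of_nat: "rat_const (of_nat n) = of_nat n"
  by (induction n) (simp_all add: rat_const_add)

subsection \<open>Graded pieces\<close>

text \<open>The ring \<open>OX\<close> and the pieces \<open>gr\<close> and \<open>gr12\<close> are the cases of all weights, of one weight and of a residue
  class of weights.\<close>

definition graded :: "int set \<Rightarrow> kuv set" where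
  "graded W = {to_fract p / Delta ^ k | p k. \<forall>w\<in>wts p. w - 12 * int k \<in> W}"

lemma OX_eq: "OX = graded UNIV"
  by (simp add: OX_def graded_def Fract_pDelta)

lemma gr_eq: "gr m = graded {m}"
proof -
  have "(\<forall>i j. coeff (coeff p j) i \<noteq> 0 \<longrightarrow> 4 * int i + 6 * int j = m + 12 * int k) \<longleftrightarrow>
        (\<forall>w\<in>wts p. w - 12 * int k \<in> {m})" for p k
    by (auto simp: wts_def algebra_simps)
  then show ?thesis
    by (simp add: gr_def graded_def Fract_pDelta)
qed

lemma gr12_eq: "gr12 r = graded {w. [w = r] (mod 12)}"
proof -
  have cong: "[w - 12 * int k = r] (mod 12) \<longleftrightarrow> [w = r] (mod 12)" for w k
  proof -
    have "[w - 12 * int k = w] (mod 12)" by (simp add: cong_iff_dvd_diff)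
    then show ?thesis using cong_trans cong_sym by blast
  qed
  have "(\<forall>i j. coeff (coeff p j) i \<noteq> 0 \<longrightarrow> [4 * int i + 6 * int j = r] (mod 12)) \<longleftrightarrow>
        (\<forall>w\<in>wts p. w - 12 * int k \<in> {w. [w = r] (mod 12)})" for p and k :: nat
    unfolding wts_def cong mem_Collect_eq by blast
  then show ?thesis
    by (simp add: gr12_def graded_def Fract_pDelta)
qed

lemma gradedI: "\<forall>w\<in>wts p. w - 12 * int k \<in> W \<Longrightarrow> to_fract p / Delta ^ k \<in> graded W"
  unfolding graded_def by blast

lemma gradedE:
  assumes "a \<in> graded W"
  obtains p k where "a = to_fract p / Delta ^ k" "\<And>w. w \<in> wts p \<Longrightarrow> w - 12 * int k \<in> W"
  using assms unfolding graded_def by blast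

lemma graded_mono: "W \<subseteq> W' \<Longrightarrow> a \<in> graded W \<Longrightarrow> a \<in> graded W'"
  unfolding graded_def by blast

lemma graded_OX: "a \<in> graded W \<Longrightarrow> a \<in> OX"
  by (simp add: OX_eq graded_mono)

lemma graded_to_fract: "wts p \<subseteq> W \<Longrightarrow> to_fract p \<in> graded W"
  using gradedI[of p 0 W] by auto

lemma graded_0 [simp]: "0 \<in> graded W"
  using graded_to_fract[of 0 W] by simp

lemma graded_add:
  assumes "a \<in> graded W" "b \<in> graded W" shows "a + b \<in> graded W"
proof -
  obtain p k where p: "a = to_fract p / Delta ^ k" "\<And>w. w \<in> wts p \<Longrightarrow> w - 12 * int k \<in> W"
    using assms(1) by (elim gradedE) blast
  obtain q l where q: "b = to_fract q / Delta ^ l" "\<And>w. w \<in> wts q \<Longrightarrow> w - 12 * int l \<in> W"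
    using assms(2) by (elim gradedE) blast
  have eq: "a + b = to_fract (p * pDelta ^ l + q * pDelta ^ k) / Delta ^ (k + l)"
    by (simp add: p q Delta_eq to_fract_power field_simps power_add)
  have "wts (p * pDelta ^ l) \<subseteq> {w. w - 12 * int (k + l) \<in> W}"
    by (rule wts_mult_subset[OF subset_refl wts_Delta_power]) (use p(2) in \<open>auto simp: algebra_simps\<close>)
  moreover have "wts (q * pDelta ^ k) \<subseteq> {w. w - 12 * int (k + l) \<in> W}"
    by (rule wts_mult_subset[OF subset_refl wts_Delta_power]) (use q(2) in \<open>auto simp: algebra_simps\<close>)
  ultimately show ?thesis
    unfolding eq by (intro gradedI) (use wts_add in blast)
qed

lemma graded_mult:
  assumes "a \<in> graded A" "b \<in> graded B" "\<And>s t. s \<in> A \<Longrightarrow> t \<in> B \<Longrightarrow> s + t \<in> C"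
  shows "a * b \<in> graded C"
proof -
  obtain p k where p: "a = to_fract p / Delta ^ k" "\<And>w. w \<in> wts p \<Longrightarrow> w - 12 * int k \<in> A"
    using assms(1) by (elim gradedE) blast
  obtain q l where q: "b = to_fract q / Delta ^ l" "\<And>w. w \<in> wts q \<Longrightarrow> w - 12 * int l \<in> B"
    using assms(2) by (elim gradedE) blast
  have eq: "a * b = to_fract (p * q) / Delta ^ (k + l)"
    by (simp add: p q power_add)
  have "wts (p * q) \<subseteq> {w. w - 12 * int (k + l) \<in> C}"
  proof (rule wts_mult_subset[OF subset_refl subset_refl])
    fix s t assume "s \<in> wts p" "t \<in> wts q"
    then have "(s - 12 * int k) + (t - 12 * int l) \<in> C" using p(2) q(2) assms(3) by blast
    then show "s + t \<in> {w. w - 12 * int (k + l) \<in> C}" by (simp add: algebra_simps)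
  qed
  then show ?thesis unfolding eq by (intro gradedI) auto
qed

lemma graded_uminus: "a \<in> graded W \<Longrightarrow> - a \<in> graded W"
proof (elim gradedE)
  fix p k assume "a = to_fract p / Delta ^ k" "\<And>w. w \<in> wts p \<Longrightarrow> w - 12 * int k \<in> W"
  then show "- a \<in> graded W"
    using gradedI[of "- p" k W] by simp
qed

lemma graded_diff: "a \<in> graded W \<Longrightarrow> b \<in> graded W \<Longrightarrow> a - b \<in> graded W"
  using graded_add[of a W "- b"] graded_uminus[of b W] by simp

lemma graded_const [simp, intro]: "rat_const c \<in> graded {0}"
  unfolding rat_const_eq by (intro graded_to_fract wts_const)

lemma graded_scale: "a \<in> graded W \<Longrightarrow> rat_const c * a \<in> graded W"
  by (rule graded_mult[OF graded_const]) auto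

lemma graded_numeral: "a \<in> graded W \<Longrightarrow> numeral k * a \<in> graded W"
  using graded_scale[of a W "numeral k"] by (simp add: rat_const_numeral)

lemma graded_of_nat: "a \<in> graded W \<Longrightarrow> of_nat k * a \<in> graded W"
  using graded_scale[of a W "of_nat k"] by (simp add: rat_const_of_nat)

lemma graded_divide_numeral: "a \<in> graded W \<Longrightarrow> a / numeral k \<in> graded W"
  using graded_scale[of a W "1 / numeral k"] by (simp add: rat_const_inverse_numeral)

lemma graded_Xu: "Xu \<in> graded {4}" and graded_Xv: "Xv \<in> graded {6}"
  unfolding Xu_eq Xv_eq by (intro graded_to_fract wts_pu wts_pv)+

lemma graded_Delta: "Delta \<in> graded {12}"
  unfolding Delta_eq using wts_Delta_power[of 1] by (intro graded_to_fract) simp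

lemma graded_inverse_Delta: "1 / Delta \<in> graded {- 12}"
  using gradedI[of 1 1] by auto

lemma graded_power: "a \<in> graded {w} \<Longrightarrow> a ^ k \<in> graded {int k * w}"
proof (induction k)
  case 0 then show ?case using graded_const[of 1] by simp
next
  case (Suc k)
  then have "a * a ^ k \<in> graded {int (Suc k) * w}"
    by (intro graded_mult[of a "{w}" "a ^ k" "{int k * w}"]) (auto simp: algebra_simps)
  then show ?case by simp
qed

subsection \<open>Derivations\<close>

lemma fract_deriv_rules:
  fixes \<delta> :: "'a::idom \<Rightarrow> 'a"
  assumes mult: "\<And>p q. \<delta> (p * q) = \<delta> p * q + p * \<delta> q" and add: "\<And>p q. \<delta> (p + q) = \<delta> p + \<delta> q"
  shows "fract_deriv \<delta> (to_fract p) = to_fract (\<delta> p)"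
    and "fract_deriv \<delta> (x + y) = fract_deriv \<delta> x + fract_deriv \<delta> y"
    and "fract_deriv \<delta> (x * y) = fract_deriv \<delta> x * y + x * fract_deriv \<delta> y"
proof -
  note F = fract_deriv_Fract[of \<delta>, OF mult]
  have one: "\<delta> 1 = 0" using mult[of 1 1] by (simp only: mult_1_left mult_1_right add_cancel_right_right)
  show "fract_deriv \<delta> (to_fract p) = to_fract (\<delta> p)"
    by (simp add: to_fract_def F one)
  obtain a b where x: "x = Fract a b" "b \<noteq> 0" by (cases x) auto
  obtain c d where y: "y = Fract c d" "d \<noteq> 0" by (cases y) auto
  show "fract_deriv \<delta> (x + y) = fract_deriv \<delta> x + fract_deriv \<delta> y"
    by (simp add: x y F mult add eq_fract) (simp add: algebra_simps)
  show "fract_deriv \<delta> (x * y) = fract_deriv \<delta> x * y + x * fract_deriv \<delta> y"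
    by (simp add: x y F mult eq_fract) (simp add: algebra_simps)
qed

lemma map_poly_pderiv_mult:
  "map_poly pderiv (p * q) = map_poly pderiv p * q + p * map_poly pderiv (q :: quv)"
proof -
  have sum: "pderiv (sum f A) = (\<Sum>k\<in>A. pderiv (f k))" for f :: "nat \<Rightarrow> rat poly" and A
    by (induction A rule: infinite_finite_induct) (simp_all add: pderiv_add)
  show ?thesis
    by (rule poly_eqI)
       (simp add: coeff_map_poly coeff_mult sum pderiv_mult sum.distrib, simp add: ac_simps)
qed

lemma map_poly_pderiv_add:
  "map_poly pderiv (p + q) = map_poly pderiv p + map_poly pderiv (q :: quv)"
  by (rule poly_eqI) (simp add: coeff_map_poly pderiv_add)

lemmas Du_rules = fract_deriv_rules[of "map_poly pderiv :: quv \<Rightarrow> quv",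
    OF map_poly_pderiv_mult map_poly_pderiv_add, folded Du_def]

lemma pderiv_mult': "pderiv (p * q) = pderiv p * q + p * pderiv (q :: quv)"
  by (simp add: pderiv_mult algebra_simps)

lemmas Dv_rules = fract_deriv_rules[of "pderiv :: quv \<Rightarrow> quv",
    OF pderiv_mult' pderiv_add, folded Dv_def]

lemma Du_const [simp]: "Du (rat_const c) = 0" and Dv_const [simp]: "Dv (rat_const c) = 0"
  by (simp_all add: rat_const_eq Du_rules(1) Dv_rules(1) map_poly_pCons pderiv_pCons)

lemma Du_Xu [simp]: "Du Xu = 1" and Du_Xv [simp]: "Du Xv = 0"
  and Dv_Xu [simp]: "Dv Xu = 0" and Dv_Xv [simp]: "Dv Xv = 1"
proof -
  have "map_poly pderiv (1 :: quv) = 0" by (simp add: one_pCons map_poly_pCons)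
  then show "Du Xu = 1" "Du Xv = 0" "Dv Xu = 0" "Dv Xv = 1"
    by (simp_all add: Xu_eq Xv_eq pu_def pv_def Du_rules(1) Dv_rules(1) map_poly_pCons pderiv_pCons
        pderiv_1 one_pCons [symmetric])
qed

text \<open>The vector field dual to \<open>\<omega>\<close> in the basis \<open>\<psi>\<close>, \<open>\<omega>\<close>. It annihilates \<open>\<Delta>\<close>, hence is tangent to \<open>Z\<close>,
  and it raises weights by 2. On \<open>u\<close> and \<open>v\<close> it is Ramanujan's derivation without the terms that involve
  the Eisenstein series of weight 2.\<close>

definition vt :: "kuv \<Rightarrow> kuv" where
  "vt a = 6 * Xv * Du a + Xu ^ 2 / 3 * Dv a"

locale derivation =
  fixes D :: "kuv \<Rightarrow> kuv"
  assumes add: "D (a + b) = D a + D b" and mult: "D (a * b) = D a * b + a * D b"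
    and const: "D (rat_const c) = 0"
begin

lemma zero [simp]: "D 0 = 0"
  using const[of 0] by simp

lemma one [simp]: "D 1 = 0"
  using const[of 1] by simp

lemma uminus: "D (- a) = - D a"
  using add[of a "- a"] by (simp add: eq_neg_iff_add_eq_0 add.commute)

lemma diff: "D (a - b) = D a - D b"
  using add[of a "- b"] by (simp add: uminus)

lemma numeral [simp]: "D (numeral k) = 0"
  using const[of "numeral k"] by (simp add: rat_const_numeral)

lemma power: "D (a ^ k) = of_nat k * a ^ (k - 1) * D a"
proof (induction k)
  case (Suc k)
  then show ?case by (cases k) (simp_all add: mult algebra_simps)
qed simp

lemma divide_Delta_power:
  "D (a / Delta ^ k) = D a / Delta ^ k - of_nat k * (a / Delta ^ k) * (D Delta / Delta)"
proof -
  have "D a = D (a / Delta ^ k * Delta ^ k)" by simp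
  also have "\<dots> = D (a / Delta ^ k) * Delta ^ k + a / Delta ^ k * D (Delta ^ k)"
    by (rule mult)
  also have "D (Delta ^ k) = of_nat k * Delta ^ k * (D Delta / Delta)"
    unfolding power by (cases k) (simp_all add: field_simps)
  finally show ?thesis by (simp add: field_simps)
qed

end

interpretation Du: derivation Du
  by standard (simp_all add: Du_rules)

interpretation Dv: derivation Dv
  by standard (simp_all add: Dv_rules)

interpretation vt: derivation vt
  by standard (simp_all add: vt_def Du_rules Dv_rules algebra_simps)

lemma Du_Delta: "Du Delta = 3 * Xu ^ 2" and Dv_Delta: "Dv Delta = - (54 * Xv)"
  by (simp_all add: Delta_def Du.diff Dv.diff Du.mult Dv.mult Du.power Dv.power)

lemma vt_Xu [simp]: "vt Xu = 6 * Xv" and vt_Xv [simp]: "vt Xv = Xu ^ 2 / 3"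
  by (simp_all add: vt_def)

lemma vt_Delta [simp]: "vt Delta = 0"
  by (simp add: vt_def Du_Delta Dv_Delta)

lemma psi_u_eq: "psi_u = Du Delta / (12 * Delta)" and psi_v_eq: "psi_v = Dv Delta / (12 * Delta)"
  by (simp_all add: psi_u_def psi_v_def)

definition vtp :: "quv \<Rightarrow> quv" where
  "vtp p = 6 * pv * map_poly pderiv p + [:[:1/3:]:] * pu ^ 2 * pderiv p"

lemma vt_to_fract: "vt (to_fract p) = to_fract (vtp p)"
  unfolding vtp_def to_fract_add to_fract_mult to_fract_power to_fract_numeral
    rat_const_eq [symmetric] rat_const_inverse_numeral
  by (simp add: vt_def Du_rules(1) Dv_rules(1) Xu_eq Xv_eq)

lemma vt_Fract: "vt (Fract p (pDelta ^ k)) = Fract (vtp p) (pDelta ^ k)"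
  by (simp add: Fract_pDelta vt.divide_Delta_power vt_to_fract)

lemma derivation_graded:
  assumes "derivation D" and D: "\<And>p. D (to_fract p) \<in> graded ((\<lambda>w. w - d) ` wts p)"
    and a: "a \<in> graded W" and W': "\<And>w. w \<in> W \<Longrightarrow> w - d \<in> W'"
  shows "D a \<in> graded W'"
proof -
  interpret derivation D by fact
  obtain p k where p: "a = to_fract p / Delta ^ k" "\<And>w. w \<in> wts p \<Longrightarrow> w - 12 * int k \<in> W"
    using a by (elim gradedE) blast
  have inv: "1 / Delta ^ l \<in> graded {- 12 * int l}" for l
    using graded_power[OF graded_inverse_Delta, of l] by (simp add: power_one_over mult.commute)
  have "D (to_fract p) * (1 / Delta ^ k) \<in> graded W'"
    by (rule graded_mult[OF D inv]) (use p(2) W' in \<open>force simp: algebra_simps\<close>)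
  moreover have "D Delta * (1 / Delta ^ 1) \<in> graded {- d}"
  proof (rule graded_mult[OF _ inv])
    show "D Delta \<in> graded {12 - d}"
      unfolding Delta_eq by (rule graded_mono[OF _ D]) (use wts_Delta_power[of 1] in auto)
  qed auto
  then have "of_nat k * (a * (D Delta / Delta)) \<in> graded W'"
    by (intro graded_of_nat graded_mult[OF a, of _ "{- d}"]) (use W' in auto)
  ultimately show ?thesis
    using graded_diff[of "D (to_fract p) * (1 / Delta ^ k)" W' "of_nat k * (a * (D Delta / Delta))"]
    by (simp add: p(1) divide_Delta_power mult.assoc)
qed

lemma Du_graded: "a \<in> graded W \<Longrightarrow> (\<And>w. w \<in> W \<Longrightarrow> w - 4 \<in> W') \<Longrightarrow> Du a \<in> graded W'"
proof (rule derivation_graded[OF Du.derivation_axioms, where d = 4])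
  show "Du (to_fract p) \<in> graded ((\<lambda>w. w - 4) ` wts p)" for p
    unfolding Du_rules(1) by (rule graded_to_fract[OF wts_Du])
qed

lemma Dv_graded: "a \<in> graded W \<Longrightarrow> (\<And>w. w \<in> W \<Longrightarrow> w - 6 \<in> W') \<Longrightarrow> Dv a \<in> graded W'"
proof (rule derivation_graded[OF Dv.derivation_axioms, where d = 6])
  show "Dv (to_fract p) \<in> graded ((\<lambda>w. w - 6) ` wts p)" for p
    unfolding Dv_rules(1) by (rule graded_to_fract[OF wts_Dv])
qed

lemma vt_graded:
  assumes "a \<in> graded W" and "\<And>w. w \<in> W \<Longrightarrow> w + 2 \<in> W'" shows "vt a \<in> graded W'"
proof -
  have "Xv * Du a \<in> graded W'"
    by (rule graded_mult[OF graded_Xv Du_graded[OF assms(1)], of "(\<lambda>w. w - 4) ` W"])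
       (use assms(2) in \<open>auto simp: algebra_simps\<close>)
  moreover have "Xu ^ 2 * Dv a \<in> graded W'"
    by (rule graded_mult[OF graded_power[OF graded_Xu] Dv_graded[OF assms(1)], of "(\<lambda>w. w - 6) ` W"])
       (use assms(2) in \<open>auto simp: algebra_simps\<close>)
  ultimately have "6 * (Xv * Du a) + Xu ^ 2 * Dv a / 3 \<in> graded W'"
    by (intro graded_add graded_numeral graded_divide_numeral)
  then show ?thesis by (simp add: vt_def mult.assoc)
qed

section \<open>Congruences modulo Delta - 1\<close>

text \<open>The ideal of the functions on \<open>X\<close> that vanish on \<open>Z\<close>.\<close>

definition J :: "kuv set" where "J = {(Delta - 1) * c | c. c \<in> OX}"

lemma OX_mult: "a \<in> OX \<Longrightarrow> b \<in> OX \<Longrightarrow> a * b \<in> OX"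
  unfolding OX_eq by (rule graded_mult) auto

lemma OX_simps [simp, intro]: "0 \<in> OX" "Xu \<in> OX" "Xv \<in> OX" "Delta \<in> OX" "1 / Delta \<in> OX" "rat_const c \<in> OX"
  using graded_OX graded_0 graded_Xu graded_Xv graded_Delta graded_inverse_Delta graded_const by blast+

lemma OX_1 [simp, intro]: "1 \<in> OX"
  using OX_simps(6)[of 1] by simp

lemma OX_numeral [simp, intro]: "numeral k \<in> OX"
  using OX_simps(6)[of "numeral k"] by (simp add: rat_const_numeral)

lemma OX_of_nat [simp, intro]: "of_nat k \<in> OX"
  using OX_simps(6)[of "of_nat k"] by (simp add: rat_const_of_nat)

lemma OX_add: "a \<in> OX \<Longrightarrow> b \<in> OX \<Longrightarrow> a + b \<in> OX"
  and OX_diff: "a \<in> OX \<Longrightarrow> b \<in> OX \<Longrightarrow> a - b \<in> OX"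
  and OX_uminus: "a \<in> OX \<Longrightarrow> - a \<in> OX"
  and OX_divide_numeral: "a \<in> OX \<Longrightarrow> a / numeral k \<in> OX"
  unfolding OX_eq by (simp_all add: graded_add graded_diff graded_uminus graded_divide_numeral)

lemma OX_divide_Delta: "a \<in> OX \<Longrightarrow> a / Delta \<in> OX"
  using OX_mult[of a "1 / Delta"] by simp

lemma OX_power: "a \<in> OX \<Longrightarrow> a ^ k \<in> OX"
  by (induction k) (auto intro: OX_mult)

lemma OX_derivations: "a \<in> OX \<Longrightarrow> Du a \<in> OX" "a \<in> OX \<Longrightarrow> Dv a \<in> OX" "a \<in> OX \<Longrightarrow> vt a \<in> OX"
  unfolding OX_eq by (auto intro: Du_graded Dv_graded vt_graded)

lemmas OX_intros = OX_mult OX_add OX_diff OX_uminus OX_divide_numeral OX_divide_Delta OX_power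
  OX_derivations

lemma J_0 [simp]: "0 \<in> J"
  unfolding J_def by (intro CollectI exI[of _ 0]) simp

lemma J_add: assumes "a \<in> J" "b \<in> J" shows "a + b \<in> J"
proof -
  obtain c d where "a = (Delta - 1) * c" "b = (Delta - 1) * d" "c \<in> OX" "d \<in> OX"
    using assms by (auto simp: J_def)
  then have "a + b = (Delta - 1) * (c + d)" "c + d \<in> OX"
    by (simp_all add: algebra_simps OX_add)
  then show ?thesis unfolding J_def by blast
qed

lemma J_mult: assumes "a \<in> J" "b \<in> OX" shows "b * a \<in> J"
proof -
  obtain c where "a = (Delta - 1) * c" "c \<in> OX" using assms by (auto simp: J_def)
  then have "b * a = (Delta - 1) * (b * c)" "b * c \<in> OX"
    using assms by (simp_all add: mult.left_commute OX_mult)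
  then show ?thesis unfolding J_def by blast
qed

lemma J_uminus: "a \<in> J \<Longrightarrow> - a \<in> J"
  using J_mult[of a "- 1"] by (simp add: OX_uminus)

lemma J_diff: "a \<in> J \<Longrightarrow> b \<in> J \<Longrightarrow> a - b \<in> J"
  using J_add[of a "- b"] by (simp add: J_uminus)

lemma J_vt: assumes "a \<in> J" shows "vt a \<in> J"
proof -
  obtain c where "a = (Delta - 1) * c" "c \<in> OX" using assms by (auto simp: J_def)
  then have "vt a = (Delta - 1) * vt c" "vt c \<in> OX"
    by (simp_all add: vt.mult vt.diff OX_derivations)
  then show ?thesis unfolding J_def by blast
qed

lemma OX_divide_of_nat: "a \<in> OX \<Longrightarrow> a / of_nat k \<in> OX"
proof (cases "k = 0")
  case False
  assume "a \<in> OX"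
  have "rat_const (1 / of_nat k) * of_nat k = 1"
    using False by (simp add: rat_const_of_nat [symmetric] rat_const_mult [symmetric])
  moreover from this have "(of_nat k :: kuv) \<noteq> 0" by force
  ultimately have "a / of_nat k = rat_const (1 / of_nat k) * a"
    by (simp add: field_simps)
  with \<open>a \<in> OX\<close> show ?thesis by (simp add: OX_mult)
qed simp

lemma kuv_of_nat_nonzero: "(of_nat (Suc k) :: kuv) \<noteq> 0"
proof -
  have "rat_const (1 / of_nat (Suc k)) * of_nat (Suc k) = 1"
    unfolding rat_const_of_nat [symmetric] rat_const_mult [symmetric] by simp
  then show ?thesis by force
qed

lemma graded_divide_of_nat: "a \<in> graded W \<Longrightarrow> a / of_nat (Suc k) \<in> graded W"
proof -
  assume "a \<in> graded W"
  have "rat_const (1 / of_nat (Suc k)) * of_nat (Suc k) = 1"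
    unfolding rat_const_of_nat [symmetric] rat_const_mult [symmetric] by simp
  then have "a / of_nat (Suc k) = rat_const (1 / of_nat (Suc k)) * a"
    using kuv_of_nat_nonzero[of k] by (simp add: field_simps)
  with \<open>a \<in> graded W\<close> show ?thesis by (simp add: graded_scale)
qed

lemma J_divide_of_nat: "a \<in> J \<Longrightarrow> a / of_nat k \<in> J"
  using J_mult[of a "1 / of_nat k"] OX_divide_of_nat[of 1 k] by simp

lemma J_Delta_power:
  assumes "a \<in> OX" shows "a * Delta ^ k - a \<in> J" and "a / Delta ^ k - a \<in> J"
proof -
  have *: "b * Delta ^ k - b \<in> J" if "b \<in> OX" for b
  proof (induction k)
    case (Suc k)
    have "b * Delta ^ k * (Delta - 1) \<in> J"
      using that unfolding J_def by (auto simp: mult.commute intro: OX_intros)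
    then have "b * Delta ^ k * (Delta - 1) + (b * Delta ^ k - b) \<in> J"
      using Suc by (rule J_add)
    then show ?case by (simp add: algebra_simps)
  qed simp
  show "a * Delta ^ k - a \<in> J" using *[OF assms] .
  have "a / Delta ^ k \<in> OX"
    using OX_mult[OF assms OX_power[OF OX_simps(5), of k]] by (simp add: power_one_over)
  from J_uminus[OF *[OF this]] show "a / Delta ^ k - a \<in> J" by simp
qed

text \<open>Modulo \<open>\<Delta> - 1\<close> every weight may be shifted by multiples of 12, one term at a time.\<close>

lemma gr12_homogenize:
  assumes "a \<in> gr12 r" obtains b where "b \<in> gr r" "a - b \<in> J"
proof -
  obtain p k where p: "a = to_fract p / Delta ^ k" "\<And>w. w \<in> wts p \<Longrightarrow> [w - 12 * int k = r] (mod 12)"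
    using assms unfolding gr12_eq by (elim gradedE) blast
  have "\<exists>b\<in>gr r. to_fract q / Delta ^ k - b \<in> J"
    if "\<And>i j. coeff (coeff q j) i \<noteq> 0 \<Longrightarrow> [4 * int i + 6 * int j - 12 * int k = r] (mod 12)" for q
  proof (induction q rule: quv_monomial_induct)
    case zero
    show ?case by (rule bexI[of _ 0]) (simp_all add: gr_eq)
  next
    case (add x y)
    then obtain b c where bc: "b \<in> gr r" "c \<in> gr r"
      "to_fract x / Delta ^ k - b \<in> J" "to_fract y / Delta ^ k - c \<in> J" by blast
    from J_add[OF bc(3,4)] have "to_fract (x + y) / Delta ^ k - (b + c) \<in> J"
      by (simp add: add_divide_distrib algebra_simps)
    moreover have "b + c \<in> gr r" using bc by (simp add: gr_eq graded_add)
    ultimately show ?case by blast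
  next
    case (monom i j)
    define m where "m = to_fract (monom (monom (coeff (coeff q j) i) i) j)"
    have m: "m \<in> graded {4 * int i + 6 * int j}"
      unfolding m_def by (intro graded_to_fract wts_monom)
    have "12 dvd (4 * int i + 6 * int j - 12 * int k - r)"
      using that[OF monom] by (simp add: cong_iff_dvd_diff)
    then obtain e' where "4 * int i + 6 * int j - 12 * int k - r = 12 * e'" by (elim dvdE)
    then have "4 * int i + 6 * int j = r + 12 * (e' + int k)"
      by (simp add: algebra_simps)
    then obtain e where e: "4 * int i + 6 * int j = r + 12 * e" by blast
    \<comment> \<open>a term of weight \<open>r + 12 e\<close> is divided by \<open>\<Delta>\<^sup>e\<close>\<close>
    have m1: "m / Delta ^ k - m \<in> J"
      using J_Delta_power(2)[OF graded_OX[OF m]] .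
    show ?case
    proof (cases "e \<ge> 0")
      case True
      have "m * (1 / Delta) ^ nat e \<in> gr r"
        unfolding gr_eq by (rule graded_mult[OF m graded_power[OF graded_inverse_Delta]])
          (use True e in auto)
      moreover have "m / Delta ^ k - m * (1 / Delta) ^ nat e \<in> J"
        using J_diff[OF m1 J_Delta_power(2)[OF graded_OX[OF m], of "nat e"]]
        by (simp add: power_one_over)
      ultimately show ?thesis unfolding m_def by blast
    next
      case False
      have "m * Delta ^ nat (- e) \<in> gr r"
        unfolding gr_eq by (rule graded_mult[OF m graded_power[OF graded_Delta]])
          (use False e in auto)
      moreover have "m / Delta ^ k - m * Delta ^ nat (- e) \<in> J"
        using J_diff[OF m1 J_Delta_power(1)[OF graded_OX[OF m], of "nat (- e)"]] by simp
      ultimately show ?thesis unfolding m_def by blast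
    qed
  qed
  then have "\<exists>b\<in>gr r. to_fract p / Delta ^ k - b \<in> J"
    using p(2) unfolding wts_def by blast
  then show ?thesis using that p(1) by blast
qed

section \<open>The upper half plane\<close>

lemma norm_nome: "norm (nome z) = exp (- 2 * pi * Im z)"
  by (simp add: nome_def norm_exp_eq_Re)

lemma norm_nome_less_1: "Im z > 0 \<Longrightarrow> norm (nome z) < 1"
  by (simp add: norm_nome)

lemma nome_nonzero [simp]: "nome z \<noteq> 0"
  by (simp add: nome_def)

lemma nome_surj:
  assumes "q \<noteq> 0" "norm q < 1" obtains z where "Im z > 0" "nome z = q"
proof
  define z where "z = Ln q / (2 * of_real pi * \<i>)"
  show "nome z = q" using assms by (simp add: z_def nome_def)
  then have "exp (- 2 * pi * Im z) < 1" using assms norm_nome[of z] by simp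
  then show "Im z > 0" by (simp add: zero_less_mult_iff)
qed

lemma has_field_derivative_nome:
  "(nome has_field_derivative 2 * of_real pi * \<i> * nome z) (at z)"
  unfolding nome_def by (auto intro!: derivative_eq_intros)

definition moebius :: "int \<Rightarrow> int \<Rightarrow> int \<Rightarrow> int \<Rightarrow> complex \<Rightarrow> complex" where
  "moebius a b c d z = (of_int a * z + of_int b) / (of_int c * z + of_int d)"

lemma automorphy_nonzero:
  assumes "(c, d) \<noteq> (0, 0 :: int)" "Im z > 0" shows "of_int c * z + of_int d \<noteq> 0"
proof
  assume *: "of_int c * z + of_int d = 0"
  then have "Im (of_int c * z + of_int d) = 0" by simp
  then have "c = 0" using assms by simp
  with * assms show False by simp
qed

lemma det_nonzero: "a * d - b * c = (1::int) \<Longrightarrow> (c, d) \<noteq> (0, 0)"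
  by auto

lemma Im_moebius:
  assumes "a * d - b * c = 1" "Im z > 0"
  shows "Im (moebius a b c d z) = Im z / (norm (of_int c * z + of_int d))\<^sup>2"
proof -
  have "Im ((of_int a * z + of_int b) * cnj (of_int c * z + of_int d)) = of_int (a * d - b * c) * Im z"
    by (simp add: algebra_simps)
  then have "Im ((of_int a * z + of_int b) * cnj (of_int c * z + of_int d)) = Im z"
    using assms(1) by simp
  then show ?thesis
    unfolding moebius_def complex_div_cnj[of "of_int a * z + of_int b"]
    by (metis Im_divide_of_real of_real_power)
qed

lemma Im_moebius_pos:
  assumes "a * d - b * c = 1" "Im z > 0" shows "Im (moebius a b c d z) > 0"
  using assms automorphy_nonzero[OF det_nonzero] by (simp add: Im_moebius)

text \<open>Minimising \<open>\<bar>c z + d\<bar>\<close> over the nonzero lattice points maximises the imaginary part over the orbit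
  of \<open>z\<close>; after a translation the minimality, applied to the other row of the matrix, says that the
  new point lies outside the unit disc.\<close>

lemma finite_lattice_points:
  assumes "Im z > 0" shows "finite {(c, d). norm (of_int c * z + of_int d) \<le> r}"
proof -
  define K where "K = r / Im z"
  define L where "L = r + K * norm z"
  have "(c, d) \<in> {-\<lceil>K\<rceil>..\<lceil>K\<rceil>} \<times> {-\<lceil>L\<rceil>..\<lceil>L\<rceil>}" if "norm (of_int c * z + of_int d) \<le> r" for c d :: int
  proof -
    have "\<bar>of_int c * Im z\<bar> \<le> r"
      using abs_Im_le_cmod[of "of_int c * z + of_int d"] that by simp
    then have c: "\<bar>of_int c\<bar> \<le> K"
      using assms by (simp add: K_def abs_mult field_simps)
    have "norm (of_int d :: complex) \<le> norm (of_int c * z + of_int d) + norm (of_int c * z)"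
      using norm_triangle_ineq4[of "of_int c * z + of_int d" "of_int c * z"] by simp
    also have "\<dots> \<le> r + K * norm z"
      using c that by (intro add_mono) (auto simp: norm_mult mult_right_mono)
    finally have "\<bar>of_int d\<bar> \<le> L" by (simp add: L_def)
    with c show ?thesis by (auto simp: abs_le_iff) linarith+
  qed
  then have "{(c, d). norm (of_int c * z + of_int d) \<le> r} \<subseteq> {-\<lceil>K\<rceil>..\<lceil>K\<rceil>} \<times> {-\<lceil>L\<rceil>..\<lceil>L\<rceil>}"
    by blast
  then show ?thesis by (rule finite_subset) simp
qed

lemma minimal_lattice_point:
  assumes z: "Im z > 0"
  obtains c d :: int where "(c, d) \<noteq> (0, 0)"
    "\<And>c' d'. (c', d') \<noteq> (0, 0) \<Longrightarrow> norm (of_int c * z + of_int d) \<le> norm (of_int c' * z + of_int d')"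
proof -
  define N where "N = (\<lambda>(c, d). norm (of_int c * z + of_int d))"
  define A where "A = {x. N x \<le> 1} - {(0, 0)}"
  have "(0, 1) \<in> A" by (simp add: A_def N_def)
  moreover have "finite A"
    by (rule finite_subset[OF _ finite_lattice_points[OF z, of 1]]) (auto simp: A_def N_def)
  ultimately obtain x where x: "x \<in> A" "\<And>y. y \<in> A \<Longrightarrow> N x \<le> N y"
    using arg_min_if_finite[of A N] by (metis empty_iff not_le)
  have "N x \<le> N y" if "y \<noteq> (0, 0)" for y
    using x that by (cases "N y \<le> 1") (auto simp: A_def)
  moreover obtain c d where "x = (c, d)" by (cases x)
  ultimately show ?thesis using that[of c d] x(1) by (auto simp: A_def N_def)
qed

lemma reduction:
  assumes z: "Im z > 0"
  obtains a b c d :: int where "a * d - b * c = 1" "Im (moebius a b c d z) \<ge> sqrt 3 / 2"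
proof -
  obtain c d :: int where cd: "(c, d) \<noteq> (0, 0)"
    "\<And>c' d'. (c', d') \<noteq> (0, 0) \<Longrightarrow> norm (of_int c * z + of_int d) \<le> norm (of_int c' * z + of_int d')"
    using minimal_lattice_point[OF z] by blast
  \<comment> \<open>dividing by a common factor would give a shorter lattice vector\<close>
  have "coprime c d"
  proof (rule ccontr)
    assume "\<not> coprime c d"
    define g where "g = gcd c d"
    have g: "g > 1"
    proof -
      have "gcd c d > 0" using cd(1) by (simp add: gcd_pos_int)
      moreover have "gcd c d \<noteq> 1" using \<open>\<not> coprime c d\<close> by (simp add: coprime_iff_gcd_eq_1)
      ultimately show ?thesis unfolding g_def by linarith
    qed
    obtain c' d' where cd': "c = g * c'" "d = g * d'"
      by (metis dvdE g_def gcd_dvd1 gcd_dvd2)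
    have nz: "(c', d') \<noteq> (0, 0)" using cd(1) cd' by auto
    have "of_int c * z + of_int d = of_int g * (of_int c' * z + of_int d')"
      by (simp add: cd' algebra_simps)
    then have "norm (of_int c * z + of_int d) = of_int g * norm (of_int c' * z + of_int d')"
      using g by (simp add: norm_mult)
    moreover have "norm (of_int c' * z + of_int d') > 0"
      using automorphy_nonzero[OF nz z] by simp
    ultimately show False using cd(2)[OF nz] g by simp
  qed
  then obtain x y where xy: "x * c + y * d = 1"
    using bezout_int[of c d] by auto
  define w where "w = moebius y (- x) c d z"
  \<comment> \<open>the translation that moves the real part into the interval from -1/2 to 1/2\<close>
  define k where "k = - \<lfloor>Re w + 1 / 2\<rfloor>"
  define a b where "a = y + k * c" and "b = - x + k * d"
  have det: "a * d - b * c = 1" using xy by (simp add: a_def b_def algebra_simps)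
  have nz: "of_int c * z + of_int d \<noteq> 0" using automorphy_nonzero[OF cd(1) z] .
  have mob: "moebius a b c d z = w + of_int k"
    using nz by (simp add: w_def moebius_def a_def b_def field_simps)
  have "(a, b) \<noteq> (0, 0)" using det by auto
  then have "norm (of_int c * z + of_int d) \<le> norm (of_int a * z + of_int b)" by (rule cd(2))
  then have norm: "norm (moebius a b c d z) \<ge> 1"
    using nz by (simp add: moebius_def norm_divide)
  define f where "f = real_of_int \<lfloor>Re w + 1 / 2\<rfloor>"
  have "f \<le> Re w + 1 / 2" "Re w + 1 / 2 < f + 1" unfolding f_def by linarith+
  moreover have "Re (moebius a b c d z) = Re w - f" by (simp add: mob k_def f_def)
  ultimately have "\<bar>Re (moebius a b c d z)\<bar> \<le> 1 / 2" by linarith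
  then have "(Re (moebius a b c d z))\<^sup>2 \<le> (1 / 2)\<^sup>2"
    by (simp only: abs_le_square_iff [symmetric])
  moreover have "1 \<le> (Re (moebius a b c d z))\<^sup>2 + (Im (moebius a b c d z))\<^sup>2"
    using norm power_mono[OF norm, of 2] by (simp add: cmod_power2)
  ultimately have "3 / 4 \<le> (Im (moebius a b c d z))\<^sup>2" by (simp add: power2_eq_square)
  then have "sqrt (3 / 4) \<le> Im (moebius a b c d z)"
    using Im_moebius_pos[OF det z] by (intro real_le_lsqrt) auto
  then have "sqrt 3 / 2 \<le> Im (moebius a b c d z)" by (simp add: real_sqrt_divide)
  with det that show ?thesis by blast
qed

section \<open>Modular forms as power series\<close>

text \<open>Convergence in the unit disc makes these series functions on the upper half plane, holomorphic also at
  the cusp. Rationality of the coefficients is built in because the forms are to be expressed by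
  polynomials over the rationals.\<close>

definition ratfps :: "complex fps set" where
  "ratfps = {F. fps_conv_radius F \<ge> 1 \<and> (\<forall>n. fps_nth F n \<in> \<rat>)}"

abbreviation qval :: "complex fps \<Rightarrow> complex \<Rightarrow> complex" where
  "qval F z \<equiv> eval_fps F (nome z)"

lemma ratfpsD: "F \<in> ratfps \<Longrightarrow> norm q < 1 \<Longrightarrow> norm q < fps_conv_radius F"
  unfolding ratfps_def by (metis (mono_tags, lifting) ereal_less(3) less_le_trans less_ereal.simps(1) mem_Collect_eq one_ereal_def)

lemma ratfps_const: "c \<in> \<rat> \<Longrightarrow> fps_const c \<in> ratfps"
  by (auto simp: ratfps_def)

lemma ratfps_simps [simp, intro]: "0 \<in> ratfps" "1 \<in> ratfps" "fps_X \<in> ratfps" "numeral k \<in> ratfps"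
  by (auto simp: ratfps_def fps_numeral_nth)

lemma ratfps_add: "F \<in> ratfps \<Longrightarrow> G \<in> ratfps \<Longrightarrow> F + G \<in> ratfps"
  and ratfps_diff: "F \<in> ratfps \<Longrightarrow> G \<in> ratfps \<Longrightarrow> F - G \<in> ratfps"
  and ratfps_mult: "F \<in> ratfps \<Longrightarrow> G \<in> ratfps \<Longrightarrow> F * G \<in> ratfps"
  using fps_conv_radius_add[of F G] fps_conv_radius_diff[of F G] fps_conv_radius_mult[of F G]
  by (auto simp: ratfps_def fps_mult_nth min_def intro!: Rats_sum split: if_splits)

lemma ratfps_power: "F \<in> ratfps \<Longrightarrow> F ^ k \<in> ratfps"
  by (induction k) (auto intro: ratfps_mult)

lemma ratfps_deriv: "F \<in> ratfps \<Longrightarrow> fps_deriv F \<in> ratfps"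
  using fps_conv_radius_deriv[of F] by (auto simp: ratfps_def)

lemma ratfps_shift: "F \<in> ratfps \<Longrightarrow> fps_shift k F \<in> ratfps"
  by (auto simp: ratfps_def)

text \<open>The radius of convergence is obtained from the holomorphy of the inverse function, the rationality
  of the coefficients from their recursion.\<close>

lemma ratfps_inverse:
  assumes F: "F \<in> ratfps" and nz: "\<And>q. norm q < 1 \<Longrightarrow> eval_fps F q \<noteq> 0"
  shows "inverse F \<in> ratfps"
proof -
  have F0: "fps_nth F 0 \<noteq> 0" using nz[of 0] by (simp add: eval_fps_at_0)
  have "fps_conv_radius F > 0" using ratfpsD[OF F, of 0] by (simp add: zero_ereal_def)
  then have "(\<lambda>q. inverse (eval_fps F q)) has_fps_expansion inverse F"
    using F0 by (intro has_fps_expansion_inverse eval_fps_has_fps_expansion) auto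
  moreover have "(\<lambda>q. inverse (eval_fps F q)) holomorphic_on eball 0 1"
  proof (intro holomorphic_on_inverse holomorphic_on_eval_fps)
    show "eball 0 1 \<subseteq> eball 0 (fps_conv_radius F)"
      using F by (intro eball_mono) (simp add: ratfps_def)
    show "eval_fps F q \<noteq> 0" if "q \<in> eball 0 1" for q
      using that nz by (simp add: one_ereal_def)
  qed
  ultimately have "fps_conv_radius (inverse F) \<ge> 1"
    by (rule holomorphic_on_imp_fps_conv_radius_ge)
  moreover have "fps_nth (inverse F) n \<in> \<rat>" for n
  proof (induction n rule: less_induct)
    case (less n)
    show ?case
    proof (cases "n = 0")
      case True
      then show ?thesis using F F0 by (simp add: ratfps_def Rats_inverse)
    next
      case False
      have "fps_nth (F * inverse F) n = 0"
        using False F0 by (simp add: inverse_mult_eq_1')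
      then have "fps_nth F 0 * fps_nth (inverse F) n = - (\<Sum>i=1..n. fps_nth F i * fps_nth (inverse F) (n - i))"
        by (simp add: fps_mult_nth sum.atLeast_Suc_atMost eq_neg_iff_add_eq_0)
      then have "fps_nth (inverse F) n =
          - (\<Sum>i=1..n. fps_nth F i * fps_nth (inverse F) (n - i)) / fps_nth F 0"
        using F0 by (simp add: field_simps)
      also have "\<dots> \<in> \<rat>"
        using F less by (auto simp: ratfps_def intro!: Rats_divide Rats_sum)
      finally show ?thesis .
    qed
  qed
  ultimately show ?thesis by (simp add: ratfps_def)
qed

lemma qval_simps:
  assumes "Im z > 0" "F \<in> ratfps" "G \<in> ratfps"
  shows "qval (F + G) z = qval F z + qval G z" "qval (F - G) z = qval F z - qval G z"
    "qval (F * G) z = qval F z * qval G z"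
  using ratfpsD[OF assms(2) norm_nome_less_1] ratfpsD[OF assms(3) norm_nome_less_1] assms(1)
  by (simp_all add: eval_fps_add eval_fps_diff eval_fps_mult)

lemma qval_power:
  assumes "Im z > 0" "F \<in> ratfps" shows "qval (F ^ k) z = qval F z ^ k"
  using ratfpsD[OF assms(2) norm_nome_less_1] assms(1) by (simp add: eval_fps_power)

text \<open>The function \<open>nome\<close> takes every value of the unit disc except 0, which is reached by continuity.\<close>

lemma ratfps_eqI:
  assumes "F \<in> ratfps" "G \<in> ratfps" "\<And>z. Im z > 0 \<Longrightarrow> qval F z = qval G z"
  shows "F = G"
proof -
  have eq: "eval_fps F q = eval_fps G q" if "q \<noteq> 0" "norm q < 1" for q
    using nome_surj[OF that] assms(3) by metis
  have pos: "fps_conv_radius F > 0" "fps_conv_radius G > 0"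
    using ratfpsD[OF assms(1), of 0] ratfpsD[OF assms(2), of 0] by (auto simp: zero_ereal_def)
  have "continuous_on (ball 0 1) (\<lambda>q. eval_fps F q - eval_fps G q)"
    by (intro continuous_intros)
       (use assms(1,2) ratfpsD in \<open>auto simp: subset_iff\<close>)
  then have "isCont (\<lambda>q. eval_fps F q - eval_fps G q) 0"
    by (simp add: continuous_on_eq_continuous_at)
  moreover have "eventually (\<lambda>q. eval_fps F q - eval_fps G q = 0) (at 0)"
    unfolding eventually_at using eq by (intro exI[of _ 1]) auto
  then have "((\<lambda>q. eval_fps F q - eval_fps G q) \<longlongrightarrow> 0) (at 0)"
    by (rule tendsto_eventually)
  ultimately have "eval_fps F 0 - eval_fps G 0 = 0"
    using tendsto_unique[OF trivial_limit_at] unfolding isCont_def by blast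
  with eq have "eval_fps F q = eval_fps G q" if "norm q < 1" for q
    using that by (cases "q = 0") auto
  then have "eventually (\<lambda>q. eval_fps F q = eval_fps G q) (nhds 0)"
    unfolding eventually_nhds_metric by (intro exI[of _ 1]) auto
  with pos show ?thesis by (rule eval_fps_eqD)
qed

text \<open>The operator \<open>q d/dq\<close> on power series.\<close>

abbreviation theta :: "complex fps \<Rightarrow> complex fps" where
  "theta F \<equiv> fps_X * fps_deriv F"

lemma ratfps_theta: "F \<in> ratfps \<Longrightarrow> theta F \<in> ratfps"
  by (intro ratfps_mult ratfps_deriv) auto

lemma has_field_derivative_qval:
  assumes "Im z > 0" "F \<in> ratfps"
  shows "(qval F has_field_derivative 2 * of_real pi * \<i> * qval (theta F) z) (at z)"
proof -
  have r: "norm (nome z) < fps_conv_radius F"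
    by (rule ratfpsD[OF assms(2) norm_nome_less_1[OF assms(1)]])
  have "(qval F has_field_derivative eval_fps (fps_deriv F) (nome z) * (2 * of_real pi * \<i> * nome z)) (at z)"
    by (rule DERIV_chain2[OF has_field_derivative_eval_fps[OF r] has_field_derivative_nome])
  then show ?thesis
    using assms by (simp add: qval_simps ratfps_deriv mult_ac)
qed

text \<open>Modular forms for the full modular group, holomorphic at the cusp, represented by their Fourier expansion.\<close>

definition mform :: "int \<Rightarrow> complex fps \<Rightarrow> bool" where
  "mform m F \<longleftrightarrow> F \<in> ratfps \<and>
     (\<forall>a b c d :: int. a * d - b * c = 1 \<longrightarrow> (\<forall>z. Im z > 0 \<longrightarrow>
        qval F (moebius a b c d z) = (of_int c * z + of_int d) powi m * qval F z))"

lemma mform_ratfps: "mform m F \<Longrightarrow> F \<in> ratfps"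
  by (simp add: mform_def)

lemma mformD:
  "mform m F \<Longrightarrow> a * d - b * c = 1 \<Longrightarrow> Im z > 0 \<Longrightarrow>
   qval F (moebius a b c d z) = (of_int c * z + of_int d) powi m * qval F z"
  unfolding mform_def by blast

lemma mform_add: "mform m F \<Longrightarrow> mform m G \<Longrightarrow> mform m (F + G)"
  and mform_diff: "mform m F \<Longrightarrow> mform m G \<Longrightarrow> mform m (F - G)"
  by (auto simp: mform_def ratfps_add ratfps_diff qval_simps Im_moebius_pos algebra_simps)

lemma mform_mult: "mform k F \<Longrightarrow> mform m G \<Longrightarrow> mform (k + m) (F * G)"
  by (auto simp: mform_def ratfps_mult qval_simps Im_moebius_pos power_int_add
      automorphy_nonzero[OF det_nonzero])

lemma mform_0 [simp]: "mform m 0"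
  by (auto simp: mform_def)

lemma mform_const: "c \<in> \<rat> \<Longrightarrow> mform 0 (fps_const c)"
  by (auto simp: mform_def ratfps_const)

lemma mform_scale: "c \<in> \<rat> \<Longrightarrow> mform m F \<Longrightarrow> mform m (fps_const c * F)"
  using mform_mult[OF mform_const, of c m F] by simp

lemma mform_power: "mform m F \<Longrightarrow> mform (int k * m) (F ^ k)"
proof (induction k)
  case 0
  then show ?case using mform_const[of 1] by simp
next
  case (Suc k)
  then show ?case using mform_mult[OF Suc(2) Suc(1)[OF Suc(2)]] by (simp add: algebra_simps)
qed

text \<open>By reduction theory a form of weight 0 takes all its values on a compact subdisc of the unit disc,
  so that the maximum modulus principle applies.\<close>

lemma mform_weight_0:
  assumes F: "mform 0 F" shows "F = fps_const (fps_nth F 0)"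
proof -
  define r where "r = exp (- 2 * pi * (sqrt 3 / 2))"
  have r: "0 < r" "r < 1" by (simp_all add: r_def)
  have hol: "eval_fps F holomorphic_on ball 0 1"
    by (rule holomorphic_on_eval_fps) (use ratfpsD[OF mform_ratfps[OF F]] in auto)
  have "continuous_on (cball 0 r) (\<lambda>q. norm (eval_fps F q))"
    by (rule continuous_on_norm[OF holomorphic_on_imp_continuous_on[OF holomorphic_on_subset[OF hol]]])
       (use r in auto)
  then obtain \<xi> where \<xi>: "\<xi> \<in> cball 0 r" "\<And>q. q \<in> cball 0 r \<Longrightarrow> norm (eval_fps F q) \<le> norm (eval_fps F \<xi>)"
    using continuous_attains_sup[of "cball 0 r" "\<lambda>q. norm (eval_fps F q)"] r by auto
  have max: "norm (eval_fps F q) \<le> norm (eval_fps F \<xi>)" if q: "q \<in> ball 0 1" for q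
  proof (cases "q = 0")
    case False
    then obtain z where z: "Im z > 0" "nome z = q" using nome_surj q by auto
    obtain a b c d :: int where g: "a * d - b * c = 1" "Im (moebius a b c d z) \<ge> sqrt 3 / 2"
      by (rule reduction[OF z(1)])
    have "nome (moebius a b c d z) \<in> cball 0 r"
      using g(2) by (simp add: norm_nome r_def)
    moreover have "qval F (moebius a b c d z) = eval_fps F q"
      using mformD[OF F g(1) z(1)] z(2) by simp
    ultimately show ?thesis using \<xi>(2) by metis
  qed (use \<xi>(2)[of 0] r in auto)
  have "eval_fps F constant_on ball 0 1"
    by (rule maximum_modulus_principle[OF hol _ _ _ _ _ max, where U = "ball 0 1"])
       (use \<xi>(1) r in auto)
  then obtain k where "\<And>q. norm q < 1 \<Longrightarrow> eval_fps F q = k"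
    unfolding constant_on_def by auto
  moreover from this[of 0] have "k = fps_nth F 0" by (simp add: eval_fps_at_0)
  ultimately show ?thesis
    using mform_ratfps[OF F]
    by (intro ratfps_eqI ratfps_const) (auto simp: norm_nome_less_1, auto simp: ratfps_def)
qed

section \<open>Eisenstein series\<close>

subsection \<open>The partial fraction expansion of the cotangent and its derivatives\<close>

text \<open>The \<open>j\<close>-th derivative of \<open>\<pi> cot (\<pi> w)\<close>, by the reflection formula for the digamma function. In this form
  its expansion in partial fractions can be read off from the series of the polygamma functions.\<close>

definition cot_pi :: "nat \<Rightarrow> complex \<Rightarrow> complex" where
  "cot_pi j w = (- 1) ^ j * Polygamma j (1 - w) - Polygamma j w"

lemma not_Ints_rules:
  fixes w :: complex
  assumes "w \<notin> \<int>" shows "w \<notin> \<int>\<^sub>\<le>\<^sub>0" "1 - w \<notin> \<int>\<^sub>\<le>\<^sub>0" "sin (of_real pi * w) \<noteq> 0"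
proof -
  show "w \<notin> \<int>\<^sub>\<le>\<^sub>0" using assms by (auto dest: nonpos_Ints_Int)
  have "1 - w \<notin> \<int>"
  proof
    assume "1 - w \<in> \<int>"
    then have "1 - (1 - w) \<in> \<int>" by (intro Ints_diff) auto
    with assms show False by simp
  qed
  then show "1 - w \<notin> \<int>\<^sub>\<le>\<^sub>0" by (auto dest: nonpos_Ints_Int)
  show "sin (of_real pi * w) \<noteq> 0"
  proof
    assume "sin (of_real pi * w) = 0"
    then obtain k :: int where "of_real pi * w = of_real (of_int k * pi)"
      by (auto simp: sin_eq_0)
    then have "of_real pi * w = of_real pi * of_int k" by (simp add: mult.commute)
    then have "w = of_int k" by (simp only: mult_cancel_left) simp
    with assms show False by simp
  qed
qed

lemma cot_pi_0:
  assumes "w \<notin> \<int>"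
  shows "cot_pi 0 w = of_real pi * (cos (of_real pi * w) / sin (of_real pi * w))"
proof -
  note nz = not_Ints_rules[OF assms]
  define s g h where "s = (\<lambda>w::complex. sin (of_real pi * w))" and "g = (\<lambda>w. Gamma w :: complex)"
    and "h = (\<lambda>w. Gamma (1 - w) :: complex)"
  have "open (- \<int> :: complex set)" by (simp add: closed_Ints open_Compl)
  then have ev: "eventually (\<lambda>w. w \<in> - \<int>) (nhds w)"
    using assms by (intro eventually_nhds_in_open) auto
  have const: "eventually (\<lambda>w. g w * h w * s w = of_real pi) (nhds w)"
    using ev
  proof eventually_elim
    case (elim w)
    then show ?case
      using Gamma_reflection_complex[of w] not_Ints_rules(3)[of w] by (simp add: g_def h_def s_def)
  qed
  have "((\<lambda>w. g w * h w * s w) has_field_derivative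
      (g w * Digamma w * h w - g w * (h w * Digamma (1 - w))) * s w
      + g w * h w * (of_real pi * cos (of_real pi * w))) (at w)"
    unfolding g_def h_def s_def using nz
    by (auto intro!: derivative_eq_intros simp: algebra_simps)
  moreover have "((\<lambda>w. g w * h w * s w) has_field_derivative 0) (at w)"
    using DERIV_cong_ev[OF refl const refl] by simp
  ultimately have "(g w * Digamma w * h w - g w * (h w * Digamma (1 - w))) * s w
      + g w * h w * (of_real pi * cos (of_real pi * w)) = 0"
    by (rule DERIV_unique)
  then have "g w * h w * ((Digamma w - Digamma (1 - w)) * s w + of_real pi * cos (of_real pi * w)) = 0"
    by (simp add: algebra_simps)
  moreover have "g w * h w \<noteq> 0"
    using nz by (simp add: g_def h_def Gamma_eq_zero_iff)
  ultimately have "(Digamma w - Digamma (1 - w)) * s w + of_real pi * cos (of_real pi * w) = 0"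
    by simp
  then show ?thesis
    using nz by (simp add: cot_pi_def s_def field_simps)
qed

lemma has_field_derivative_cot_pi:
  assumes "w \<notin> \<int>"
  shows "(cot_pi j has_field_derivative cot_pi (Suc j) w) (at w)"
  unfolding cot_pi_def using not_Ints_rules[OF assms]
  by (auto intro!: derivative_eq_intros)

text \<open>The derivative of \<open>cot w\<close> is \<open>- (1 + cot\<^sup>2 w)\<close>, so all derivatives are polynomials in the cotangent.\<close>

fun cot_poly :: "nat \<Rightarrow> complex poly" where
  "cot_poly 0 = [:0, 1:]"
| "cot_poly (Suc j) = - ([:1, 0, 1:] * pderiv (cot_poly j))"

lemma has_field_derivative_unique_on_open:
  assumes "open S" "w \<in> S" "\<And>x. x \<in> S \<Longrightarrow> f x = g x"
    "(f has_field_derivative f') (at w)" "(g has_field_derivative g') (at w)"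
  shows "f' = (g' :: complex)"
proof -
  have "eventually (\<lambda>x. f x = g x) (nhds w)"
    using eventually_nhds_in_open[OF assms(1,2)] by eventually_elim (rule assms(3))
  from DERIV_cong_ev[OF refl this refl] assms(4) have "(g has_field_derivative f') (at w)"
    by simp
  then show ?thesis using assms(5) by (rule DERIV_unique)
qed

lemma open_Compl_Ints: "open (- \<int> :: complex set)"
  by (simp add: closed_Ints open_Compl)

lemma cot_pi_poly:
  assumes "w \<notin> \<int>"
  shows "cot_pi j w = of_real pi ^ Suc j * poly (cot_poly j) (cos (of_real pi * w) / sin (of_real pi * w))"
  using assms
proof (induction j arbitrary: w)
  case 0
  then show ?case by (simp add: cot_pi_0)
next
  case (Suc j)
  let ?C = "\<lambda>w. cos (of_real pi * w) / sin (of_real pi * w) :: complex"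
  note nz = not_Ints_rules(3)[OF Suc.prems]
  have "(- (of_real pi * s * s) - of_real pi * c * c) / (s * s) = - of_real pi * (1 + (c / s)\<^sup>2)"
    if "s \<noteq> 0" for s c :: complex
    using that by (simp add: field_simps power2_eq_square)
  note eq = this[OF nz, of "cos (of_real pi * w)"]
  have C: "(?C has_field_derivative - of_real pi * (1 + (?C w)\<^sup>2)) (at w)"
    unfolding eq [symmetric] using nz by (auto intro!: derivative_eq_intros simp: mult_ac)
  have "((\<lambda>w. of_real pi ^ Suc j * poly (cot_poly j) (?C w)) has_field_derivative
      of_real pi ^ Suc j * (poly (pderiv (cot_poly j)) (?C w) * (- of_real pi * (1 + (?C w)\<^sup>2)))) (at w)"
    by (intro DERIV_cmult DERIV_chain2[OF poly_DERIV C])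
  then have "cot_pi (Suc j) w =
      of_real pi ^ Suc j * (poly (pderiv (cot_poly j)) (?C w) * (- of_real pi * (1 + (?C w)\<^sup>2)))"
    using Suc.IH Suc.prems
    by (intro has_field_derivative_unique_on_open[OF open_Compl_Ints _ _ has_field_derivative_cot_pi]) auto
  also have "\<dots> = of_real pi ^ Suc (Suc j) * (- (poly (pderiv (cot_poly j)) (?C w) * (1 + (?C w)\<^sup>2)))"
    by simp
  also have "- (poly (pderiv (cot_poly j)) c * (1 + c\<^sup>2)) = poly (cot_poly (Suc j)) c" for c
    by (simp add: algebra_simps power2_eq_square)
  finally show ?case .
qed

definition nth_power_series :: "nat \<Rightarrow> complex fps" where
  "nth_power_series j = Abs_fps (\<lambda>n. if n = 0 then 0 else of_nat n ^ j)"

lemma theta_nth_power_series: "theta (nth_power_series j) = nth_power_series (Suc j)"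
  by (rule fps_ext) (simp add: nth_power_series_def)

lemma nth_power_series_0: "nth_power_series 0 = fps_X * inverse (1 - fps_X)"
proof -
  have "nth_power_series 0 * (1 - fps_X) = fps_X"
    by (rule fps_ext) (auto simp: nth_power_series_def algebra_simps)
  moreover have "(1 - fps_X :: complex fps) * inverse (1 - fps_X) = 1"
    by (rule inverse_mult_eq_1') simp
  ultimately show ?thesis
    by (metis mult.assoc mult.right_neutral)
qed

lemma ratfps_nth_power_series_0: "nth_power_series 0 \<in> ratfps"
proof -
  have "inverse (1 - fps_X) \<in> ratfps"
  proof (rule ratfps_inverse)
    fix q :: complex assume "norm q < 1"
    then have "eval_fps (1 - fps_X) q = 1 - q" "q \<noteq> 1"
      by (auto simp: eval_fps_diff)
    then show "eval_fps (1 - fps_X) q \<noteq> 0" by simp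
  qed (auto intro: ratfps_diff)
  then show ?thesis unfolding nth_power_series_0 by (intro ratfps_mult) auto
qed

lemma ratfps_nth_power_series: "nth_power_series j \<in> ratfps"
  by (induction j) (simp_all add: ratfps_nth_power_series_0 theta_nth_power_series [symmetric] ratfps_theta)

lemma not_Ints_upper: "Im w > 0 \<Longrightarrow> w \<notin> \<int>"
  by (auto elim!: Ints_cases)

lemma cot_pi_0_qval:
  assumes w: "Im w > 0"
  shows "cot_pi 0 w = - of_real pi * \<i> - 2 * of_real pi * \<i> * qval (nth_power_series 0) w"
proof -
  define e where "e = exp (\<i> * of_real pi * w)"
  have e: "e \<noteq> 0" "exp (- (\<i> * of_real pi * w)) = 1 / e" and q: "nome w = e ^ 2"
    by (simp_all add: e_def exp_minus divide_inverse nome_def exp_of_nat_mult [symmetric] mult_ac)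
  have ne: "1 - e ^ 2 \<noteq> 0"
    using norm_nome_less_1[OF w] unfolding q by (metis eq_iff_diff_eq_0 less_irrefl norm_one)
  have "qval (nth_power_series 0) w * qval (1 - fps_X) w = qval (nth_power_series 0 * (1 - fps_X)) w"
    using w by (intro qval_simps(3) [symmetric] ratfps_nth_power_series ratfps_diff) auto
  also have "nth_power_series 0 * (1 - fps_X) = fps_X"
    by (rule fps_ext) (auto simp: nth_power_series_def algebra_simps)
  finally have "qval (nth_power_series 0) w * (1 - e ^ 2) = e ^ 2"
    by (simp add: eval_fps_diff q)
  then have S: "qval (nth_power_series 0) w = e ^ 2 / (1 - e ^ 2)"
    using ne by (simp add: field_simps)
  have "cos (of_real pi * w) = (e + 1 / e) / 2" "sin (of_real pi * w) = (e - 1 / e) / (2 * \<i>)"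
    using e(2) by (simp_all add: cos_exp_eq sin_exp_eq e_def mult_ac)
  moreover have "(x / 2) / (y / (2 * \<i>)) = \<i> * x / y" for x y :: complex
    by (cases "y = 0") (simp_all add: field_simps)
  ultimately have "cos (of_real pi * w) / sin (of_real pi * w) = \<i> * (e + 1 / e) / (e - 1 / e)"
    by (simp only:)
  also have "\<dots> = \<i> * (e ^ 2 + 1) / (e ^ 2 - 1)"
    using e(1) ne by (simp add: field_simps power2_eq_square)
  also have "\<dots> = - \<i> - 2 * \<i> * (e ^ 2 / (1 - e ^ 2))"
    using ne by (simp add: divide_simps) (simp add: algebra_simps)
  finally have "cot_pi 0 w = of_real pi * (- \<i> - 2 * \<i> * (e ^ 2 / (1 - e ^ 2)))"
    using cot_pi_0[OF not_Ints_upper[OF w]] by simp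
  then show ?thesis unfolding S by (simp add: algebra_simps)
qed

lemma open_upper: "open {z. Im z > 0}"
  by (simp add: open_halfspace_Im_gt)

text \<open>The expansion of the cotangent in powers of \<open>q\<close> is differentiated termwise. Compared with the partial
  fractions in \<open>infsum_int_inverse_power\<close> it becomes Lipschitz's summation formula.\<close>

lemma cot_pi_Suc_qval:
  assumes w: "Im w > 0"
  shows "cot_pi (Suc j) w = - ((2 * of_real pi * \<i>) ^ Suc (Suc j)) * qval (nth_power_series (Suc j)) w"
  using w
proof (induction j arbitrary: w)
  case 0
  have "((\<lambda>w. - of_real pi * \<i> - 2 * of_real pi * \<i> * qval (nth_power_series 0) w) has_field_derivative
      0 - 2 * of_real pi * \<i> * (2 * of_real pi * \<i> * qval (theta (nth_power_series 0)) w)) (at w)"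
    by (intro DERIV_diff DERIV_cmult DERIV_const has_field_derivative_qval 0 ratfps_nth_power_series)
  then have "cot_pi (Suc 0) w = 0 - 2 * of_real pi * \<i> * (2 * of_real pi * \<i> * qval (theta (nth_power_series 0)) w)"
    using cot_pi_0_qval 0
    by (intro has_field_derivative_unique_on_open[OF open_upper _ _
          has_field_derivative_cot_pi[OF not_Ints_upper]]) auto
  then show ?case by (simp add: theta_nth_power_series mult_ac)
next
  case (Suc j)
  have "((\<lambda>w. - ((2 * of_real pi * \<i>) ^ Suc (Suc j)) * qval (nth_power_series (Suc j)) w) has_field_derivative
      - ((2 * of_real pi * \<i>) ^ Suc (Suc j)) * (2 * of_real pi * \<i> * qval (theta (nth_power_series (Suc j))) w)) (at w)"
    by (intro DERIV_cmult has_field_derivative_qval Suc.prems ratfps_nth_power_series)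
  then have "cot_pi (Suc (Suc j)) w =
      - ((2 * of_real pi * \<i>) ^ Suc (Suc j)) * (2 * of_real pi * \<i> * qval (theta (nth_power_series (Suc j))) w)"
    using Suc.prems
    by (intro has_field_derivative_unique_on_open[OF open_upper _ Suc.IH
          has_field_derivative_cot_pi[OF not_Ints_upper]]) auto
  then show ?case by (simp add: theta_nth_power_series mult_ac)
qed

subsection \<open>Sums over the integers\<close>

lemma bij_betw_neg_int: "bij_betw (\<lambda>n. - int n - 1) UNIV {..<0}"
  by (rule bij_betwI[of _ _ _ "\<lambda>i. nat (- i - 1)"]) auto

lemma bij_betw_nonneg_int: "bij_betw int UNIV {0..}"
  by (rule bij_betwI[of _ _ _ nat]) auto

lemma summable_on_int_iff:
  fixes f :: "int \<Rightarrow> 'a :: real_normed_vector"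
  assumes "(\<lambda>n. f (int n)) summable_on UNIV" "(\<lambda>n. f (- int n - 1)) summable_on UNIV"
  shows "f summable_on UNIV"
    and "infsum f UNIV = infsum (\<lambda>n. f (int n)) UNIV + infsum (\<lambda>n. f (- int n - 1)) UNIV"
proof -
  have U: "UNIV = {0..} \<union> {..<0::int}" by auto
  have s: "f summable_on {0..}" "f summable_on {..<0}"
    using assms summable_on_reindex_bij_betw[OF bij_betw_nonneg_int, of f]
      summable_on_reindex_bij_betw[OF bij_betw_neg_int, of f] by auto
  show "f summable_on UNIV"
    unfolding U by (rule summable_on_Un_disjoint[OF s]) auto
  show "infsum f UNIV = infsum (\<lambda>n. f (int n)) UNIV + infsum (\<lambda>n. f (- int n - 1)) UNIV"
  proof -
    have "{0..} \<inter> {..<0::int} = {}" by auto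
    from infsum_Un_disjoint[OF s this] have "infsum f UNIV = infsum f {0..} + infsum f {..<0}"
      by (simp only: U)
    then show ?thesis
      using infsum_reindex_bij_betw[OF bij_betw_nonneg_int, of f]
        infsum_reindex_bij_betw[OF bij_betw_neg_int, of f] by simp
  qed
qed

lemma summable_on_int_square: "(\<lambda>d::int. 1 / (1 + real_of_int d ^ 2)) summable_on UNIV"
proof -
  have s: "summable (\<lambda>n::nat. 1 / (1 + real n ^ 2))"
  proof (rule summable_comparison_test'[where N = 1])
    show "summable (\<lambda>n. inverse (real n ^ 2))" by (rule inverse_power_summable) simp
    show "norm (1 / (1 + real n ^ 2)) \<le> inverse (real n ^ 2)" if "n \<ge> 1" for n
      using that by (simp add: divide_inverse le_imp_inverse_le)
  qed
  have "real_of_int (- int n - 1) = - real (Suc n)" for n by simp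
  then have eq: "(\<lambda>n. 1 / (1 + real_of_int (- int n - 1) ^ 2)) = (\<lambda>n. 1 / (1 + real (Suc n) ^ 2))"
    by (simp only: power2_minus)
  have "summable (\<lambda>n::nat. 1 / (1 + real (Suc n) ^ 2))"
    using summable_Suc_iff[of "\<lambda>n. 1 / (1 + real n ^ 2)"] s by simp
  then have "(\<lambda>n. 1 / (1 + real_of_int (- int n - 1) ^ 2)) summable_on UNIV"
    unfolding eq by (subst summable_on_UNIV_nonneg_real_iff) auto
  moreover have "(\<lambda>n. 1 / (1 + real_of_int (int n) ^ 2)) summable_on UNIV"
    using s by (subst summable_on_UNIV_nonneg_real_iff) auto
  ultimately show ?thesis by (intro summable_on_int_iff(1))
qed

text \<open>The nonnegative and the negative integers contribute the series of the polygamma function at \<open>w\<close> and at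
  \<open>1 - w\<close>; the exponent being even, the signs agree.\<close>

lemma infsum_int_inverse_power:
  fixes w :: complex
  assumes w: "w \<notin> \<int>" and j: "odd j" and s: "(\<lambda>d::int. 1 / (w + of_int d) ^ Suc j) summable_on UNIV"
  shows "infsum (\<lambda>d::int. 1 / (w + of_int d) ^ Suc j) UNIV = - cot_pi j w / fact j"
proof -
  define f where "f = (\<lambda>d::int. 1 / (w + of_int d) ^ Suc j)"
  have j0: "j > 0" using j by (cases j) auto
  have s1: "(\<lambda>n. f (int n)) summable_on UNIV" "(\<lambda>n. f (- int n - 1)) summable_on UNIV"
    using summable_on_subset_banach[OF s [folded f_def], of "{0..}"]
      summable_on_subset_banach[OF s [folded f_def], of "{..<0}"]
      summable_on_reindex_bij_betw[OF bij_betw_nonneg_int, of f]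
      summable_on_reindex_bij_betw[OF bij_betw_neg_int, of f] by auto
  have "w \<noteq> 0" "1 - w \<noteq> 0" using w by (auto simp: eq_iff_diff_eq_0 [symmetric])
  have "(\<lambda>n. f (int n)) sums ((-1) ^ Suc j * Polygamma j w / fact j)"
    using Polygamma_LIMSEQ[OF \<open>w \<noteq> 0\<close> j0] by (simp add: f_def field_simps)
  then have 1: "infsum (\<lambda>n. f (int n)) UNIV = (-1) ^ Suc j * Polygamma j w / fact j"
    using has_sum_imp_sums[OF has_sum_infsum[OF s1(1)]] sums_unique2 by blast
  have f2: "f (- int n - 1) = inverse ((1 - w + of_nat n) ^ Suc j)" for n
  proof -
    have "w + of_int (- int n - 1) = - (1 - w + of_nat n)" by simp
    then have "(w + of_int (- int n - 1)) ^ Suc j = (1 - w + of_nat n) ^ Suc j"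
      using j power_minus_even[of "Suc j" "1 - w + of_nat n"] by (simp only: even_Suc not_False_eq_True)
    then show ?thesis by (simp only: f_def divide_inverse mult_1_left)
  qed
  have "(\<lambda>n. f (- int n - 1)) sums ((-1) ^ Suc j * Polygamma j (1 - w) / fact j)"
    unfolding f2 by (rule Polygamma_LIMSEQ[OF \<open>1 - w \<noteq> 0\<close> j0])
  then have 2: "infsum (\<lambda>n. f (- int n - 1)) UNIV = (-1) ^ Suc j * Polygamma j (1 - w) / fact j"
    using has_sum_imp_sums[OF has_sum_infsum[OF s1(2)]] sums_unique2 by blast
  have "infsum f UNIV = (-1) ^ Suc j * Polygamma j w / fact j + (-1) ^ Suc j * Polygamma j (1 - w) / fact j"
    using summable_on_int_iff(2)[OF s1] 1 2 by simp
  also have "\<dots> = - cot_pi j w / fact j"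
    using j by (simp add: cot_pi_def add_divide_distrib diff_divide_distrib)
  finally show ?thesis by (simp add: f_def)
qed

subsection \<open>Lattice sums\<close>

text \<open>The term of the origin is 0 for \<open>k > 0\<close>, by the convention \<open>1 / 0 = 0\<close>.\<close>

definition lattice_sum :: "nat \<Rightarrow> complex \<Rightarrow> complex" where
  "lattice_sum k z = (\<Sum>\<^sub>\<infinity>(c, d). 1 / (of_int c * z + of_int d :: complex) ^ k)"

lemma bij_betw_det_1:
  fixes a b c d :: int
  assumes det: "a * d - b * c = 1"
  shows "bij_betw (\<lambda>(m, n). (m * a + n * c, m * b + n * d)) UNIV UNIV"
proof (rule bij_betwI[of _ _ _ "\<lambda>(m, n). (m * d - n * c, n * a - m * b)"])
  have "((m * d - n * c) * a + (n * a - m * b) * c, (m * d - n * c) * b + (n * a - m * b) * d) =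
      ((a * d - b * c) * m, (a * d - b * c) * n)" for m n
    by (simp add: algebra_simps)
  then show "(\<lambda>(m, n). (m * a + n * c, m * b + n * d)) ((\<lambda>(m, n). (m * d - n * c, n * a - m * b)) x) = x" for x
    using det by (cases x) simp
  have "((m * a + n * c) * d - (m * b + n * d) * c, (m * b + n * d) * a - (m * a + n * c) * b) =
      ((a * d - b * c) * m, (a * d - b * c) * n)" for m n
    by (simp add: algebra_simps)
  then show "(\<lambda>(m, n). (m * d - n * c, n * a - m * b)) ((\<lambda>(m, n). (m * a + n * c, m * b + n * d)) x) = x" for x
    using det by (cases x) simp
qed auto

text \<open>A unimodular matrix permutes the lattice points, and every term acquires the same factor.\<close>

lemma lattice_sum_moebius:
  assumes det: "a * d - b * c = 1" and z: "Im z > 0"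
  shows "lattice_sum k (moebius a b c d z) = (of_int c * z + of_int d) ^ k * lattice_sum k z"
proof -
  define w where "w = of_int c * z + of_int d"
  have w: "w \<noteq> 0" unfolding w_def by (rule automorphy_nonzero[OF det_nonzero[OF det] z])
  define f where "f = (\<lambda>(c, d). 1 / (of_int c * z + of_int d :: complex) ^ k)"
  have trm: "1 / (of_int m * moebius a b c d z + of_int n) ^ k =
      w ^ k * f ((\<lambda>(m, n). (m * a + n * c, m * b + n * d)) (m, n))" for m n
  proof -
    have "of_int m * moebius a b c d z + of_int n =
        (of_int (m * a + n * c) * z + of_int (m * b + n * d)) / w"
    proof -
      have "of_int m * (x / w) + of_int n = (of_int m * x + of_int n * w) / w" for x
        using w by (simp add: field_simps)
      then have "of_int m * moebius a b c d z + of_int n =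
          (of_int m * (of_int a * z + of_int b) + of_int n * w) / w"
        by (simp only: moebius_def w_def)
      also have "of_int m * (of_int a * z + of_int b) + of_int n * w =
          of_int (m * a + n * c) * z + of_int (m * b + n * d)"
        by (simp add: w_def algebra_simps)
      finally show ?thesis .
    qed
    then show ?thesis by (simp add: f_def power_divide)
  qed
  have "lattice_sum k (moebius a b c d z) =
      (\<Sum>\<^sub>\<infinity>x. w ^ k * f ((\<lambda>(m, n). (m * a + n * c, m * b + n * d)) x))"
    unfolding lattice_sum_def by (intro infsum_cong) (auto simp: trm simp del: of_int_add of_int_mult)
  also have "\<dots> = w ^ k * (\<Sum>\<^sub>\<infinity>x. f ((\<lambda>(m, n). (m * a + n * c, m * b + n * d)) x))"
    by (rule infsum_cmult_right')
  also have "(\<Sum>\<^sub>\<infinity>x. f ((\<lambda>(m, n). (m * a + n * c, m * b + n * d)) x)) = (\<Sum>\<^sub>\<infinity>x. f x)"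
    by (rule infsum_reindex_bij_betw[OF bij_betw_det_1[OF det]])
  finally show ?thesis by (simp add: w_def f_def lattice_sum_def)
qed

text \<open>The sum of squares is comparable with \<open>\<bar>c z + d\<bar>\<^sup>2\<close>, since \<open>c\<close> is controlled by the imaginary part of
  \<open>c z + d\<close>, and then \<open>d\<close> by the triangle inequality.\<close>

lemma lattice_point_bound:
  assumes z: "Im z > 0"
  obtains K where "K > 0"
    "\<And>c d. real_of_int c ^ 2 + real_of_int d ^ 2 \<le> K * (norm (of_int c * z + of_int d)) ^ 2"
proof
  define M where "M = 1 + norm z / Im z"
  define K where "K = 1 / Im z ^ 2 + M ^ 2"
  show "K > 0" using z by (auto simp: K_def intro: add_pos_nonneg)
  fix c d :: int
  define x where "x = norm (of_int c * z + of_int d)"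
  have "\<bar>of_int c * Im z\<bar> \<le> x"
    using abs_Im_le_cmod[of "of_int c * z + of_int d"] by (simp add: x_def)
  then have c: "\<bar>of_int c\<bar> \<le> x / Im z"
    using z by (simp add: abs_mult field_simps)
  have "norm (of_int d :: complex) \<le> x + norm (of_int c * z)"
    unfolding x_def using norm_triangle_ineq4[of "of_int c * z + of_int d" "of_int c * z"] by simp
  also have "\<dots> \<le> x + x / Im z * norm z"
    using mult_right_mono[OF c, of "norm z"] by (simp add: norm_mult)
  finally have d: "\<bar>of_int d\<bar> \<le> M * x"
    by (simp add: M_def algebra_simps)
  have "real_of_int c ^ 2 \<le> (x / Im z) ^ 2" "real_of_int d ^ 2 \<le> (M * x) ^ 2"
    using power_mono[OF c, of 2] power_mono[OF d, of 2] by simp_all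
  then show "real_of_int c ^ 2 + real_of_int d ^ 2 \<le> K * (norm (of_int c * z + of_int d)) ^ 2"
    unfolding K_def x_def [symmetric] by (simp add: power_divide power_mult_distrib algebra_simps)
qed

lemma summable_on_product_nonneg:
  fixes g :: "'a \<Rightarrow> real" and h :: "'b \<Rightarrow> real"
  assumes "g summable_on A" "h summable_on B" "\<And>x. g x \<ge> 0" "\<And>y. h y \<ge> 0"
  shows "(\<lambda>(x, y). g x * h y) summable_on A \<times> B"
proof -
  have "(\<lambda>p. norm ((\<lambda>(x, y). g x * h y) p)) summable_on Sigma A (\<lambda>_. B)"
    unfolding Infinite_Sum.abs_summable_on_Sigma_iff
    using assms by (auto simp: infsum_cmult_right' abs_mult infsum_nonneg
        intro!: summable_on_cmult_right summable_on_cmult_left)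
  then show ?thesis by (rule abs_summable_summable)
qed

lemma summable_on_lattice_majorant:
  "(\<lambda>(c, d). 1 / ((1 + real_of_int c ^ 2) * (1 + real_of_int d ^ 2))) summable_on UNIV"
proof -
  have "(\<lambda>(c::int, d::int). 1 / (1 + real_of_int c ^ 2) * (1 / (1 + real_of_int d ^ 2))) summable_on UNIV \<times> UNIV"
    by (intro summable_on_product_nonneg summable_on_int_square) auto
  then show ?thesis by simp
qed

text \<open>With \<open>s = c\<^sup>2 + d\<^sup>2 \<ge> 1\<close> one has \<open>(1 + c\<^sup>2) (1 + d\<^sup>2) \<le> 3 s\<^sup>2\<close>, which gives a majorant that is a product of
  two summable families in one variable.\<close>

lemma summable_on_lattice:
  assumes z: "Im z > 0" and l: "l \<ge> 2"
  shows "(\<lambda>(c, d). 1 / (of_int c * z + of_int d :: complex) ^ (2 * l)) summable_on UNIV"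
proof -
  obtain K where K: "K > 0"
    "\<And>c d. real_of_int c ^ 2 + real_of_int d ^ 2 \<le> K * (norm (of_int c * z + of_int d)) ^ 2"
    using lattice_point_bound[OF z] by blast
  have bound: "norm (1 / (of_int c * z + of_int d :: complex) ^ (2 * l))
      \<le> 3 * K ^ l * (1 / ((1 + real_of_int c ^ 2) * (1 + real_of_int d ^ 2)))" for c d
  proof (cases "(c, d) = (0, 0)")
    case True
    then show ?thesis using l K(1) by (cases l) auto
  next
    case False
    define s where "s = real_of_int c ^ 2 + real_of_int d ^ 2"
    define x where "x = (norm (of_int c * z + of_int d)) ^ 2"
    have "c ^ 2 + d ^ 2 \<noteq> 0" "c ^ 2 + d ^ 2 \<ge> 0" using False by (auto simp: sum_power2_eq_zero_iff)
    then have "c ^ 2 + d ^ 2 \<ge> 1" by linarith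
    then have s1: "s \<ge> 1" unfolding s_def by (metis of_int_1_le_iff of_int_add of_int_power)
    have sx: "s \<le> K * x" using K(2)[of c d] by (simp add: s_def x_def)
    have x: "x > 0" using automorphy_nonzero[OF False z] by (simp add: x_def)
    have "(1 + real_of_int c ^ 2) * (1 + real_of_int d ^ 2) = 1 + s + real_of_int c ^ 2 * real_of_int d ^ 2"
      by (simp add: s_def algebra_simps)
    also have "real_of_int c ^ 2 * real_of_int d ^ 2 \<le> s * s"
      by (intro mult_mono) (auto simp: s_def)
    also have "1 + s + s * s \<le> 3 * s ^ 2"
    proof -
      have "s * 1 \<le> s * s" by (rule mult_left_mono) (use s1 in auto)
      with s1 show ?thesis unfolding power2_eq_square by linarith
    qed
    also have "s ^ 2 \<le> s ^ l" using s1 l by (rule power_increasing[rotated])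
    also have "s ^ l \<le> (K * x) ^ l" using sx s1 by (intro power_mono) auto
    finally have "(1 + real_of_int c ^ 2) * (1 + real_of_int d ^ 2) \<le> 3 * (K * x) ^ l" by simp
    then have "1 / (3 * (K * x) ^ l) \<le> 1 / ((1 + real_of_int c ^ 2) * (1 + real_of_int d ^ 2))"
      by (intro divide_left_mono mult_pos_pos) (use K(1) x in \<open>auto intro: add_pos_nonneg\<close>)
    then have "3 * K ^ l * (1 / (3 * (K * x) ^ l))
        \<le> 3 * K ^ l * (1 / ((1 + real_of_int c ^ 2) * (1 + real_of_int d ^ 2)))"
      using K(1) by (intro mult_left_mono) auto
    moreover have "3 * K ^ l * (1 / (3 * (K * x) ^ l)) = 1 / x ^ l"
      using K(1) x by (simp add: power_mult_distrib)
    moreover have "norm (1 / (of_int c * z + of_int d :: complex) ^ (2 * l)) = 1 / x ^ l"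
      by (simp add: x_def norm_divide norm_power power_mult)
    ultimately show ?thesis by simp
  qed
  have "(\<lambda>x. 3 * K ^ l * (case x of (c, d) \<Rightarrow> 1 / ((1 + real_of_int c ^ 2) * (1 + real_of_int d ^ 2)))) summable_on UNIV"
    by (intro summable_on_cmult_right summable_on_lattice_majorant)
  then have "(\<lambda>x. norm (case x of (c, d) \<Rightarrow> 1 / (of_int c * z + of_int d :: complex) ^ (2 * l))) summable_on UNIV"
    by (rule Infinite_Sum.abs_summable_on_comparison_test') (use bound in auto)
  then show ?thesis by (rule abs_summable_summable)
qed

subsection \<open>Divisor sums\<close>

definition divisor_series :: "nat \<Rightarrow> complex fps" where
  "divisor_series j = Abs_fps (\<lambda>n. if n = 0 then 0 else of_nat (\<Sum>d | d dvd n. d ^ j))"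

text \<open>In the absolutely convergent double series the terms with \<open>c n = N\<close> are collected; \<open>n\<close> then runs over the
  divisors of \<open>N\<close>.\<close>

lemma lambert_has_sum:
  fixes q :: complex
  assumes q: "norm q < 1"
  shows "(\<lambda>(c, n). of_nat n ^ j * q ^ (c * n)) summable_on ({1..} \<times> {1..})"
    and "((\<lambda>N. of_nat (\<Sum>d | d dvd N. d ^ j) * q ^ N) has_sum
           (\<Sum>\<^sub>\<infinity>(c, n)\<in>{1..} \<times> {1..}. of_nat n ^ j * q ^ (c * n))) {1..}"
proof -
  define r where "r = norm q"
  have r: "0 \<le> r" "r < 1" using q by (auto simp: r_def)
  have "summable (\<lambda>n. norm (fps_nth (nth_power_series j) n * complex_of_real r ^ n))"
    by (intro norm_summable_fps ratfpsD[OF ratfps_nth_power_series]) (use r in auto)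
  then have "(\<lambda>n. norm (fps_nth (nth_power_series j) n * complex_of_real r ^ n)) summable_on UNIV"
    by (intro norm_summable_imp_summable_on) simp
  then have "(\<lambda>n. norm (fps_nth (nth_power_series j) n * complex_of_real r ^ n)) summable_on {1..}"
    by (rule summable_on_subset_banach) auto
  then have s2: "(\<lambda>n. real n ^ j * r ^ n) summable_on {1..}"
    by (rule summable_on_cong[THEN iffD1, rotated]) (use r in \<open>auto simp: nth_power_series_def norm_mult norm_power\<close>)
  have s1: "(\<lambda>c. r ^ (c - 1)) summable_on {1::nat..}"
  proof -
    have "bij_betw Suc UNIV {1..}" by (rule bij_betwI[of _ _ _ "\<lambda>n. n - 1"]) auto
    moreover have "(\<lambda>c. r ^ (Suc c - 1)) summable_on UNIV"
      using r by (intro norm_summable_imp_summable_on) (simp add: norm_power)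
    ultimately show ?thesis
      using summable_on_reindex_bij_betw[of Suc UNIV "{1..}" "\<lambda>c. r ^ (c - 1)"] by blast
  qed
  have maj: "(\<lambda>(c, n). r ^ (c - 1) * (real n ^ j * r ^ n)) summable_on {1..} \<times> {1..}"
    by (intro summable_on_product_nonneg s1 s2) (use r in auto)
  have bound: "norm (of_nat n ^ j * q ^ (c * n)) \<le> r ^ (c - 1) * (real n ^ j * r ^ n)"
    if "c \<ge> 1" "n \<ge> 1" for c n
  proof -
    have "c - 1 + n \<le> c * n" using that by (cases c; cases n) auto
    then have "r ^ (c * n) \<le> r ^ (c - 1 + n)" using r by (intro power_decreasing) auto
    then show ?thesis
      by (simp add: norm_mult norm_power r_def power_add mult_left_mono mult.left_commute)
  qed
  show s: "(\<lambda>(c, n). of_nat n ^ j * q ^ (c * n)) summable_on ({1..} \<times> {1..})"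
    by (rule abs_summable_summable, rule Infinite_Sum.abs_summable_on_comparison_test'[OF maj]) (use bound in auto)
  have bij: "bij_betw (\<lambda>(N, d). (N div d, d)) (Sigma {1..} (\<lambda>N. {d. d dvd N})) ({1..} \<times> {1::nat..})"
    by (rule bij_betwI[of _ _ _ "\<lambda>(c, n). (c * n, n)"])
       (auto simp: Suc_le_eq dvd_pos_nat div_greater_zero_iff dvd_imp_le)
  have "((\<lambda>(c, n). of_nat n ^ j * q ^ (c * n)) has_sum
      (\<Sum>\<^sub>\<infinity>(c, n)\<in>{1..} \<times> {1..}. of_nat n ^ j * q ^ (c * n))) ({1..} \<times> {1..})"
    by (rule has_sum_infsum[OF s])
  then have "((\<lambda>x. (\<lambda>(c, n). of_nat n ^ j * q ^ (c * n)) ((\<lambda>(N, d). (N div d, d)) x)) has_sum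
      (\<Sum>\<^sub>\<infinity>(c, n)\<in>{1..} \<times> {1..}. of_nat n ^ j * q ^ (c * n))) (Sigma {1..} (\<lambda>N. {d. d dvd N}))"
    by (rule has_sum_reindex_bij_betw[OF bij, THEN iffD2])
  then show "((\<lambda>N. of_nat (\<Sum>d | d dvd N. d ^ j) * q ^ N) has_sum
           (\<Sum>\<^sub>\<infinity>(c, n)\<in>{1..} \<times> {1..}. of_nat n ^ j * q ^ (c * n))) {1..}"
  proof (rule has_sum_Sigma')
    fix N :: nat assume "N \<in> {1..}"
    then have "finite {d. d dvd N}" by simp
    then have "((\<lambda>d. of_nat d ^ j * q ^ N) has_sum (\<Sum>d | d dvd N. of_nat d ^ j * q ^ N)) {d. d dvd N}"
      by (rule has_sum_finite)
    moreover have "(\<Sum>d | d dvd N. of_nat d ^ j * q ^ N) = of_nat (\<Sum>d | d dvd N. d ^ j) * q ^ N"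
      by (simp add: sum_distrib_right)
    ultimately show "((\<lambda>d. case case (N, d) of (N, d) \<Rightarrow> (N div d, d) of (c, n) \<Rightarrow> of_nat n ^ j * q ^ (c * n))
        has_sum of_nat (\<Sum>d | d dvd N. d ^ j) * q ^ N) {d. d dvd N}"
      by (subst has_sum_cong[where g = "\<lambda>d. of_nat d ^ j * q ^ N"]) auto
  qed
qed

lemma divisor_series_sums:
  fixes q :: complex
  assumes q: "norm q < 1"
  shows "(\<lambda>N. fps_nth (divisor_series j) N * q ^ N) sums
         (\<Sum>\<^sub>\<infinity>(c, n)\<in>{1..} \<times> {1..}. of_nat n ^ j * q ^ (c * n))"
proof -
  have "((\<lambda>N. fps_nth (divisor_series j) N * q ^ N) has_sum
         (\<Sum>\<^sub>\<infinity>(c, n)\<in>{1..} \<times> {1..}. of_nat n ^ j * q ^ (c * n))) UNIV"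
    using lambert_has_sum(2)[OF q, of j]
    by (rule has_sum_cong_neutral[THEN iffD1, rotated 3]) (auto simp: divisor_series_def)
  then show ?thesis by (rule has_sum_imp_sums)
qed

lemma ratfps_divisor_series: "divisor_series j \<in> ratfps"
proof -
  have "fps_conv_radius (divisor_series j) \<ge> 1"
    unfolding fps_conv_radius_def
  proof (rule conv_radius_geI_ex')
    fix r :: real assume r: "0 < r" "ereal r < 1"
    then have "norm (complex_of_real r) < 1" by (simp add: one_ereal_def)
    from sums_summable[OF divisor_series_sums[OF this]]
    show "summable (\<lambda>n. fps_nth (divisor_series j) n * complex_of_real r ^ n)" .
  qed
  then show ?thesis by (auto simp: ratfps_def divisor_series_def)
qed

lemma nome_mult: "nome (of_nat c * z) = nome z ^ c"
  by (simp add: nome_def exp_of_nat_mult [symmetric] mult_ac)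

lemma qval_divisor_series:
  assumes z: "Im z > 0"
  shows "qval (divisor_series j) z = (\<Sum>\<^sub>\<infinity>c\<in>{1..}. qval (nth_power_series j) (of_nat c * z))"
    and "(\<lambda>c. qval (nth_power_series j) (of_nat c * z)) summable_on {1..}"
proof -
  note q = norm_nome_less_1[OF z]
  define f where "f = (\<lambda>c n. of_nat n ^ j * nome z ^ (c * n))"
  note s = lambert_has_sum(1)[OF q, of j, folded f_def]
  have row: "infsum (f c) {1..} = qval (nth_power_series j) (of_nat c * z)" if c: "c \<ge> 1" for c
  proof -
    have "norm (nome (of_nat c * z)) < 1"
      using c z by (intro norm_nome_less_1) auto
    note r = ratfpsD[OF ratfps_nth_power_series this, of j]
    have "((\<lambda>n. fps_nth (nth_power_series j) n * nome (of_nat c * z) ^ n) has_sum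
        qval (nth_power_series j) (of_nat c * z)) UNIV"
      by (intro norm_summable_imp_has_sum norm_summable_fps sums_eval_fps r)
    then have "(f c has_sum qval (nth_power_series j) (of_nat c * z)) {1..}"
      by (rule has_sum_cong_neutral[THEN iffD1, rotated 3])
         (auto simp: nth_power_series_def f_def nome_mult power_mult [symmetric])
    then show ?thesis by (rule infsumI)
  qed
  have "qval (divisor_series j) z = (\<Sum>\<^sub>\<infinity>(c, n)\<in>{1..} \<times> {1..}. f c n)"
    using sums_eval_fps[OF ratfpsD[OF ratfps_divisor_series q]] divisor_series_sums[OF q]
      sums_unique2 unfolding f_def by blast
  also have "\<dots> = (\<Sum>\<^sub>\<infinity>c\<in>{1..}. infsum (f c) {1..})"
    using infsum_Sigma'_banach[OF s] by simp
  also have "\<dots> = (\<Sum>\<^sub>\<infinity>c\<in>{1..}. qval (nth_power_series j) (of_nat c * z))"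
    by (rule infsum_cong) (rule row, simp)
  finally show "qval (divisor_series j) z = (\<Sum>\<^sub>\<infinity>c\<in>{1..}. qval (nth_power_series j) (of_nat c * z))" .
  have "(\<lambda>c. infsum (f c) {1..}) summable_on {1..}"
    by (rule summable_on_Sigma_banach[OF s])
  then show "(\<lambda>c. qval (nth_power_series j) (of_nat c * z)) summable_on {1..}"
    by (rule summable_on_cong[THEN iffD1, rotated]) (simp add: row del: One_nat_def)
qed

subsection \<open>The Fourier expansion\<close>

text \<open>The term at 0 vanishes for \<open>k > 0\<close>, so for even \<open>k\<close> this is twice the value of the zeta function.\<close>

definition int_zeta :: "nat \<Rightarrow> complex" where
  "int_zeta k = (\<Sum>\<^sub>\<infinity>d::int. 1 / of_int d ^ k)"

text \<open>The row \<open>c = 0\<close> gives the constant term. The rows \<open>c\<close> and \<open>- c\<close> agree, and for \<open>c > 0\<close> Lipschitz's formula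
  turns the row into a power series in \<open>q\<^sup>c\<close>.\<close>

lemma lattice_sum_expansion:
  assumes z: "Im z > 0" and l: "l \<ge> 2"
  shows "lattice_sum (2 * l) z = int_zeta (2 * l)
    + 2 * ((2 * of_real pi * \<i>) ^ (2 * l) / fact (2 * l - 1)) * qval (divisor_series (2 * l - 1)) z"
proof -
  define k j where "k = 2 * l" and "j = 2 * l - 1"
  have j: "odd j" "Suc j = k" "j = Suc (j - 1)" using l by (auto simp: j_def k_def)
  define C where "C = (2 * of_real pi * \<i>) ^ k / fact j"
  define f where "f = (\<lambda>c d. 1 / (of_int c * z + of_int d :: complex) ^ k)"
  have s: "(\<lambda>(c, d). f c d) summable_on UNIV \<times> UNIV"
    using summable_on_lattice[OF z l] by (simp add: f_def k_def)
  have srow: "f c summable_on UNIV" for c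
  proof -
    have "(\<lambda>(c, d). f c d) summable_on (Pair c ` UNIV)"
      using s by (rule summable_on_subset_banach) auto
    then show ?thesis
      by (subst (asm) summable_on_reindex) (auto simp: inj_on_def o_def)
  qed
  define row where "row c = infsum (f c) UNIV" for c
  have srows: "row summable_on UNIV"
    unfolding row_def by (rule summable_on_Sigma_banach[OF s])
  have pos: "row (int c) = C * qval (nth_power_series j) (of_nat c * z)" if "c \<ge> 1" for c
  proof -
    have Im: "Im (of_nat c * z) > 0" using that z by simp
    have "f (int c) = (\<lambda>d. 1 / (of_nat c * z + of_int d) ^ Suc j)"
      by (simp add: f_def j(2))
    moreover from this have "row (int c) = - cot_pi j (of_nat c * z) / fact j"
      unfolding row_def using srow[of "int c"]
      by (simp only:) (rule infsum_int_inverse_power[OF not_Ints_upper[OF Im] j(1)])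
    moreover have "cot_pi j (of_nat c * z) = - ((2 * of_real pi * \<i>) ^ Suc j) * qval (nth_power_series j) (of_nat c * z)"
      using cot_pi_Suc_qval[OF Im, of "j - 1"] unfolding j(3) [symmetric] .
    ultimately show ?thesis by (simp add: C_def j(2) [symmetric])
  qed
  have neg: "row (- c) = row c" for c
  proof -
    have "f (- c) (- d) = f c d" for d
    proof -
      have "of_int (- c) * z + of_int (- d) = - (of_int c * z + of_int d)" by simp
      then show ?thesis
        unfolding f_def k_def using power_minus_even[of "2 * l" "of_int c * z + of_int d"] by simp
    qed
    moreover have "bij_betw uminus UNIV (UNIV :: int set)"
      by (rule bij_betwI[of _ _ _ uminus]) auto
    ultimately show ?thesis
      unfolding row_def using infsum_reindex_bij_betw[of uminus UNIV UNIV "f (- c)"] by simp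
  qed
  have bij: "bij_betw int {1..} {1..}" "bij_betw (\<lambda>n. - int n) {1..} {..-1}"
    by (rule bij_betwI[of _ _ _ nat], auto) (rule bij_betwI[of _ _ _ "\<lambda>i. nat (- i)"], auto)
  define S where "S = C * qval (divisor_series j) z"
  have "((\<lambda>c. C * qval (nth_power_series j) (of_nat c * z)) has_sum S) {1..}"
    unfolding S_def qval_divisor_series(1)[OF z]
    by (intro has_sum_cmult_right has_sum_infsum qval_divisor_series(2)[OF z])
  then have S: "((\<lambda>c. row (int c)) has_sum S) {1..}"
    by (rule has_sum_cong[THEN iffD2, rotated]) (simp add: pos del: One_nat_def)
  then have "(row has_sum S) {1..}"
    using has_sum_reindex_bij_betw[OF bij(1)] by blast
  moreover have "((\<lambda>c. row (- int c)) has_sum S) {1..}"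
    using S by (simp add: neg)
  then have "(row has_sum S) {..-1}"
    using has_sum_reindex_bij_betw[OF bij(2)] by blast
  moreover have "(row has_sum row 0) {0}" by (rule has_sum_finiteI) auto
  ultimately have "(row has_sum (row 0 + (S + S))) ({0} \<union> ({1..} \<union> {..-1}))"
    by (intro has_sum_Un_disjoint) auto
  also have "{0} \<union> ({1..} \<union> {..-1}) = (UNIV :: int set)" by auto
  finally have "infsum row UNIV = row 0 + 2 * S" by (simp add: infsumI)
  moreover have "lattice_sum k z = infsum row UNIV"
    unfolding lattice_sum_def row_def using infsum_Sigma'_banach[OF s] by (simp add: f_def)
  moreover have "row 0 = int_zeta k" by (simp add: row_def f_def int_zeta_def)
  ultimately show ?thesis by (simp add: S_def C_def k_def j_def)
qed

text \<open>The sum over the half-integers is a value of the derivatives of the cotangent at \<open>1/2\<close>, where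
  the cotangent itself vanishes; splitting the integers by parity gives the values of the zeta function.\<close>

lemma int_zeta_half:
  assumes l: "l \<ge> 2"
  shows "(2 ^ (2 * l) - 1) * int_zeta (2 * l) =
    - (of_real pi ^ (2 * l)) * poly (cot_poly (2 * l - 1)) 0 / fact (2 * l - 1)"
proof -
  define j where "j = 2 * l - 1"
  have j: "odd j" "Suc j = 2 * l" using l by (auto simp: j_def)
  define f where "f = (\<lambda>d::int. 1 / (of_int d :: complex) ^ (2 * l))"
  define h where "h = (\<lambda>d::int. 1 / (1 / 2 + of_int d :: complex) ^ Suc j)"
  have half: "(1 / 2 :: complex) \<notin> \<int>"
  proof
    assume "(1 / 2 :: complex) \<in> \<int>"
    then obtain k :: int where "(1 / 2 :: complex) = of_int k" by (elim Ints_cases)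
    then have "complex_of_int (2 * k) = of_int 1" by (simp add: field_simps)
    then have "2 * k = 1" by (simp only: of_int_eq_iff)
    then show False by presburger
  qed
  have hs: "h summable_on UNIV"
  proof (rule abs_summable_summable, rule Infinite_Sum.abs_summable_on_comparison_test')
    show "(\<lambda>d::int. 8 ^ l * (1 / (1 + real_of_int d ^ 2))) summable_on UNIV"
      by (intro summable_on_cmult_right summable_on_int_square)
    fix d :: int
    define x where "x = (1 / 2 + real_of_int d) ^ 2"
    \<comment> \<open>the product is \<open>8 (1/2 + d)\<^sup>2 - (1 + d\<^sup>2)\<close>\<close>
    have "0 \<le> (7 * d + 1) * (d + 1)"
      by (cases "d \<ge> 0") (auto intro: mult_nonneg_nonneg mult_nonpos_nonpos)
    then have "0 \<le> real_of_int ((7 * d + 1) * (d + 1))" by (simp only: of_int_0_le_iff)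
    then have x: "1 + real_of_int d ^ 2 \<le> 8 * x"
      by (simp add: x_def power2_eq_square algebra_simps)
    have "1 \<le> 1 + real_of_int d ^ 2" by simp
    then have "(1 + real_of_int d ^ 2) ^ 1 \<le> (1 + real_of_int d ^ 2) ^ l"
      using l by (intro power_increasing) auto
    also have "\<dots> \<le> (8 * x) ^ l" using x by (intro power_mono) auto
    finally have "1 + real_of_int d ^ 2 \<le> 8 ^ l * x ^ l" by (simp add: power_mult_distrib)
    moreover have "x > 0"
    proof -
      have "8 * x > 0" using x by (rule less_le_trans[rotated]) (auto intro: add_pos_nonneg)
      then show ?thesis by simp
    qed
    moreover have "0 < 1 + real_of_int d ^ 2" by (auto intro: add_pos_nonneg)
    ultimately have "1 / x ^ l \<le> 8 ^ l * (1 / (1 + real_of_int d ^ 2))"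
      by (simp add: field_simps)
    moreover have "norm (h d) = 1 / x ^ l"
    proof -
      have "1 / 2 + of_int d = complex_of_real (1 / 2 + real_of_int d)" by simp
      then have "norm (1 / 2 + of_int d :: complex) ^ (2 * l) = x ^ l"
        unfolding x_def by (simp only: norm_of_real power_mult power2_abs)
      then show ?thesis by (simp add: h_def j norm_divide norm_power del: power_Suc)
    qed
    ultimately show "norm (h d) \<le> 8 ^ l * (1 / (1 + real_of_int d ^ 2))" by simp
  qed
  have fs: "f summable_on UNIV"
  proof (rule abs_summable_summable, rule Infinite_Sum.abs_summable_on_comparison_test')
    show "(\<lambda>d::int. 2 * (1 / (1 + real_of_int d ^ 2))) summable_on UNIV"
      by (intro summable_on_cmult_right summable_on_int_square)
    fix d :: int
    show "norm (f d) \<le> 2 * (1 / (1 + real_of_int d ^ 2))"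
    proof (cases "d = 0")
      case False
      then have "1 \<le> \<bar>d\<bar>" by simp
      then have "1 \<le> d ^ 2" using power_mono[of 1 "\<bar>d\<bar>" 2] by simp
      then have 1: "1 \<le> real_of_int d ^ 2" by (metis of_int_1_le_iff of_int_power)
      then have "(real_of_int d ^ 2) ^ 1 \<le> (real_of_int d ^ 2) ^ l"
        using l by (intro power_increasing) auto
      then have "1 + real_of_int d ^ 2 \<le> 2 * (real_of_int d ^ 2) ^ l" using 1 by simp
      moreover have "norm (f d) = 1 / (real_of_int d ^ 2) ^ l"
        by (simp add: f_def norm_divide norm_power power_mult)
      moreover have "0 < 1 + real_of_int d ^ 2" by (auto intro: add_pos_nonneg)
      moreover have "0 < (real_of_int d ^ 2) ^ l"
        by (rule zero_less_power) (use 1 in linarith)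
      ultimately show ?thesis by (simp add: field_simps)
    qed (use l in \<open>auto simp: f_def power_0_left\<close>)
  qed
  have bij: "bij_betw (\<lambda>d. 2 * d) UNIV {d::int. even d}" "bij_betw (\<lambda>d. 2 * d + 1) UNIV {d::int. odd d}"
    by (rule bij_betwI[of _ _ _ "\<lambda>d. d div 2"], auto)+
  have "infsum f UNIV = infsum f ({d. even d} \<union> {d. odd d})"
    by (rule arg_cong[of _ _ "infsum f"]) auto
  also have "\<dots> = infsum f {d. even d} + infsum f {d. odd d}"
    by (intro infsum_Un_disjoint summable_on_subset_banach[OF fs]) auto
  also have "infsum f {d. even d} = infsum (\<lambda>d. f (2 * d)) UNIV"
    by (rule infsum_reindex_bij_betw[OF bij(1), symmetric])
  also have "\<dots> = infsum (\<lambda>d. 1 / 2 ^ (2 * l) * f d) UNIV"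
    by (intro infsum_cong) (simp add: f_def power_mult_distrib)
  also have "\<dots> = 1 / 2 ^ (2 * l) * infsum f UNIV"
    by (rule infsum_cmult_right')
  also have "infsum f {d. odd d} = infsum (\<lambda>d. f (2 * d + 1)) UNIV"
    by (rule infsum_reindex_bij_betw[OF bij(2), symmetric])
  also have "\<dots> = infsum (\<lambda>d. 1 / 2 ^ (2 * l) * h d) UNIV"
  proof (rule infsum_cong)
    fix d :: int
    have "(of_int (2 * d + 1) :: complex) = 2 * (1 / 2 + of_int d)" by simp
    then show "f (2 * d + 1) = 1 / 2 ^ (2 * l) * h d"
      unfolding f_def h_def j by (simp only: power_mult_distrib) simp
  qed
  also have "\<dots> = 1 / 2 ^ (2 * l) * infsum h UNIV"
    by (rule infsum_cmult_right')
  also have "infsum h UNIV = - cot_pi j (1 / 2) / fact j"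
    using infsum_int_inverse_power[OF half j(1)] hs unfolding h_def by simp
  also have "cot_pi j (1 / 2) = of_real pi ^ Suc j * poly (cot_poly j) 0"
  proof -
    have "cos (of_real pi * (1 / 2)) = (0 :: complex)"
      using cos_of_real_pi_half by simp
    then show ?thesis using cot_pi_poly[OF half, of j] by simp
  qed
  finally have "2 ^ (2 * l) * infsum f UNIV = infsum f UNIV - of_real pi ^ Suc j * poly (cot_poly j) 0 / fact j"
    by (simp add: field_simps del: power_Suc)
  moreover have "int_zeta (2 * l) = infsum f UNIV" by (simp add: int_zeta_def f_def)
  ultimately show ?thesis
    unfolding j_def [symmetric] j(2) by (simp add: left_diff_distrib)
qed

section \<open>The graded ring of modular forms\<close>

lemma mform_of_lattice_sum:
  assumes "F \<in> ratfps" and "\<And>z. Im z > 0 \<Longrightarrow> qval F z = \<kappa> * lattice_sum k z"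
  shows "mform (int k) F"
  unfolding mform_def using assms by (auto simp: lattice_sum_moebius Im_moebius_pos)

text \<open>The Fourier expansions of \<open>20 G\<^sub>4\<close> and \<open>(7/3) G\<^sub>6\<close>, which are substituted for \<open>u\<close> and \<open>v\<close>; they are
  \<open>E\<^sub>4 / 12\<close> and \<open>- E\<^sub>6 / 216\<close> in terms of the series with constant term 1.\<close>

definition fU :: "complex fps" where
  "fU = fps_const (1 / 12) + 20 * divisor_series 3"

definition fV :: "complex fps" where
  "fV = fps_const (- 1 / 216) + fps_const (7 / 3) * divisor_series 5"

definition fDelta :: "complex fps" where
  "fDelta = fU ^ 3 - 27 * fV ^ 2"

lemma ratfps_fU: "fU \<in> ratfps" and ratfps_fV: "fV \<in> ratfps"
  unfolding fU_def fV_def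
  by (intro ratfps_add ratfps_mult ratfps_const ratfps_divisor_series ratfps_simps Rats_divide Rats_1 Rats_number_of Rats_minus_iff[THEN iffD2])+

lemma qval_fU: "Im z > 0 \<Longrightarrow> qval fU z = 1 / 12 + 20 * qval (divisor_series 3) z"
  unfolding fU_def by (simp add: qval_simps ratfps_const ratfps_mult ratfps_divisor_series)

lemma qval_fV: "Im z > 0 \<Longrightarrow> qval fV z = - 1 / 216 + 7 / 3 * qval (divisor_series 5) z"
proof -
  assume z: "Im z > 0"
  have "(- 1 / 216 :: complex) \<in> \<rat>" "(7 / 3 :: complex) \<in> \<rat>" by auto
  then show ?thesis
    unfolding fV_def using z by (simp add: qval_simps ratfps_const ratfps_mult ratfps_divisor_series)
qed

lemma cot_poly_3: "poly (cot_poly 3) 0 = - 2" and cot_poly_5: "poly (cot_poly 5) 0 = - 16"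
  by (simp_all add: numeral_eq_Suc pderiv_pCons pderiv_minus pderiv_smult pderiv_add)

text \<open>Both series are proportional to lattice sums. The constant terms match by the values of the zeta function
  at 4 and at 6.\<close>

lemma mform_fU: "mform 4 fU"
proof -
  have z4: "int_zeta 4 = of_real pi ^ 4 / 45"
    using int_zeta_half[of 2] by (simp add: cot_poly_3 fact_numeral field_simps)
  have "qval fU z = 15 / (4 * of_real pi ^ 4) * lattice_sum 4 z" if "Im z > 0" for z
    using lattice_sum_expansion[OF that, of 2] that
    by (simp add: qval_fU z4 fact_numeral power_mult_distrib field_simps)
  from mform_of_lattice_sum[OF ratfps_fU this] show ?thesis by simp
qed

lemma mform_fV: "mform 6 fV"
proof -
  have z6: "int_zeta 6 = of_real pi ^ 6 * 2 / 945"
    using int_zeta_half[of 3] by (simp add: cot_poly_5 fact_numeral field_simps)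
  have i6: "\<i> ^ 6 = - 1" by (simp add: eval_nat_numeral)
  have "qval fV z = - 35 / (16 * of_real pi ^ 6) * lattice_sum 6 z" if "Im z > 0" for z
    using lattice_sum_expansion[OF that, of 3] that
    by (simp add: qval_fV z6 i6 fact_numeral power_mult_distrib field_simps)
  from mform_of_lattice_sum[OF ratfps_fV this] show ?thesis by simp
qed

lemma mform_numeral: "mform m F \<Longrightarrow> mform m (numeral k * F)"
  using mform_scale[of "numeral k" m F] by (simp add: numeral_fps_const)

lemma mform_fDelta: "mform 12 fDelta"
  unfolding fDelta_def
  using mform_power[OF mform_fU, of 3] mform_power[OF mform_fV, of 2]
  by (intro mform_diff mform_numeral) simp_all

lemma ratfps_fDelta: "fDelta \<in> ratfps"
  by (rule mform_ratfps[OF mform_fDelta])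

lemma fU_0: "fps_nth fU 0 = 1 / 12" and fV_0: "fps_nth fV 0 = - 1 / 216"
  and fU_1: "fps_nth fU 1 = 20" and fV_1: "fps_nth fV 1 = 7 / 3"
proof -
  have d: "{d::nat. d dvd Suc 0} = {1}" by auto
  show "fps_nth fU 0 = 1 / 12" "fps_nth fV 0 = - 1 / 216" "fps_nth fU 1 = 20" "fps_nth fV 1 = 7 / 3"
    by (simp_all add: fU_def fV_def divisor_series_def d numeral_fps_const)
qed

lemma fDelta_0: "fps_nth fDelta 0 = 0" and fDelta_1: "fps_nth fDelta 1 = 1"
  by (simp_all add: fDelta_def power3_eq_cube power2_eq_square fps_mult_nth fU_0 fV_0
      fU_1 [unfolded One_nat_def] fV_1 [unfolded One_nat_def] fps_numeral_nth)

subsection \<open>The discriminant has no zeros\<close>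

text \<open>The Taylor polynomial shows that the cosine is positive at \<open>1.55\<close>, so that \<open>1.55 < \<pi>/2\<close>.\<close>

lemma pi_gt_31: "pi > 3.1"
proof -
  obtain t where t: "cos (1.55 :: real) = (\<Sum>m<6. cos_coeff m * 1.55 ^ m) + cos (t + 1 / 2 * real 6 * pi) / fact 6 * 1.55 ^ 6"
    using Maclaurin_cos_expansion[of "1.55" 6] by auto
  have "\<bar>cos (t + 1 / 2 * real 6 * pi)\<bar> \<le> 1" by simp
  then have "cos (t + 1 / 2 * real 6 * pi) \<ge> - 1" by linarith
  then have "cos (t + 1 / 2 * real 6 * pi) / fact 6 * 1.55 ^ 6 \<ge> - 1 / fact 6 * 1.55 ^ 6"
    by (intro mult_right_mono divide_right_mono) auto
  moreover have "(\<Sum>m<6. cos_coeff m * (1.55::real) ^ m) - 1 / fact 6 * 1.55 ^ 6 > 0"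
  proof -
    have "{..<6} = {0, 1, 2, 3, 4, 5 :: nat}" by auto
    moreover have "cos_coeff 2 = - 1 / 2" "cos_coeff 4 = 1 / 24"
      "cos_coeff 1 = 0" "cos_coeff 3 = 0" "cos_coeff 5 = 0"
      by (simp_all add: cos_coeff_def fact_numeral)
    ultimately show ?thesis by (simp add: fact_numeral eval_nat_numeral)
  qed
  ultimately have pos: "cos (1.55 :: real) > 0" using t by simp
  show ?thesis
  proof (rule ccontr)
    assume "\<not> pi > 3.1"
    then have "cos (1.55 :: real) \<le> cos (pi / 2)"
      using pi_ge_two by (intro cos_monotone_0_pi_le) auto
    with pos show False by simp
  qed
qed

lemma nome_small:
  assumes "Im z \<ge> sqrt 3 / 2" shows "norm (nome z) \<le> 1 / 210"
proof -
  have "(1.732 :: real) \<le> sqrt 3" by (rule real_le_rsqrt) (simp add: power2_eq_square)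
  then have "3.1 * 1.732 \<le> pi * sqrt 3" using pi_gt_31 by (intro mult_mono) auto
  also have "pi * sqrt 3 \<le> 2 * pi * Im z" using assms by simp
  finally have "(5.3692 :: real) \<le> 2 * pi * Im z" by simp
  then have "norm (nome z) \<le> exp (- 5.3692)" by (simp add: norm_nome)
  also have "(210 :: real) \<le> exp 5.3692"
  proof -
    define x :: real where "x = 0.335575"
    obtain t where t: "exp x = (\<Sum>m<4. x ^ m / fact m) + exp t / fact 4 * x ^ 4"
      using Maclaurin_exp_le[of x 4] by blast
    have "(1.398 :: real) \<le> 1 + x + x ^ 2 / 2 + x ^ 3 / 6"
      by (simp add: x_def eval_nat_numeral)
    also have "\<dots> = (\<Sum>m<4. x ^ m / fact m)"
      by (simp add: numeral_eq_Suc)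
    also have "\<dots> \<le> exp x" unfolding t by simp
    finally have "(1.398 :: real) ^ 16 \<le> exp x ^ 16" by (intro power_mono) auto
    also have "exp x ^ 16 = exp (16 * x)" using exp_of_nat_mult[of 16 x] by simp
    also have "16 * x = 5.3692" by (simp add: x_def)
    finally show ?thesis by (simp add: eval_nat_numeral)
  qed
  then have "exp (- 5.3692) \<le> (1 / 210 :: real)" by (simp add: exp_minus divide_simps)
  finally show ?thesis .
qed

lemma divisor_sum_le: "(\<Sum>d | d dvd n. d ^ j) \<le> n ^ Suc j" if "n > 0" for n j :: nat
proof -
  have "(\<Sum>d | d dvd n. d ^ j) \<le> (\<Sum>d\<in>{1..n}. n ^ j)"
    using that by (intro order.trans[OF sum_mono2[of "{1..n}"] sum_mono] power_mono)
      (auto dest: dvd_imp_le dvd_pos_nat simp: Suc_le_eq intro: Nat.gr0I)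
  then show ?thesis by simp
qed

text \<open>A series \<open>q + \<dots>\<close> whose later coefficients are at most \<open>c K\<^sup>n\<^sup>-\<^sup>2\<close> differs little from \<open>q\<close>.\<close>

lemma qval_near_nome:
  assumes z: "Im z > 0" and F: "F \<in> ratfps" "fps_nth F 0 = 0" "fps_nth F 1 = 1"
    and bound: "\<And>n. norm (fps_nth F (n + 2)) \<le> c * K ^ n" and c: "c \<ge> 0" "K \<ge> 0" and K: "K * norm (nome z) < 1"
  obtains A where "qval F z = nome z * (1 + A)"
    "norm A \<le> c * norm (nome z) / (1 - K * norm (nome z))"
proof
  define q where "q = nome z"
  define A where "A = q * eval_fps (fps_shift 2 F) q"
  have q: "norm q < 1" unfolding q_def by (rule norm_nome_less_1[OF z])
  have "F = fps_X * (1 + fps_X * fps_shift 2 F)"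
  proof (rule fps_ext)
    fix n show "fps_nth F n = fps_nth (fps_X * (1 + fps_X * fps_shift 2 F)) n"
      using F by (cases n; cases "n - 1") (auto simp: algebra_simps numeral_2_eq_2)
  qed
  then have "qval F z = qval (fps_X * (1 + fps_X * fps_shift 2 F)) z" by simp
  also have "\<dots> = nome z * (1 + A)"
    using F z by (simp add: qval_simps ratfps_mult ratfps_add ratfps_shift A_def q_def)
  finally show "qval F z = nome z * (1 + A)" .
  have sums: "(\<lambda>n. fps_nth (fps_shift 2 F) n * q ^ n) sums eval_fps (fps_shift 2 F) q"
    by (rule sums_eval_fps[OF ratfpsD[OF ratfps_shift[OF F(1)] q]])
  have geo: "(\<lambda>n. c * (K * norm q) ^ n) sums (c * (1 / (1 - K * norm q)))"
    using K c by (intro sums_mult geometric_sums) (auto simp: q_def)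
  have le: "norm (fps_nth (fps_shift 2 F) n * q ^ n) \<le> c * (K * norm q) ^ n" for n
    using mult_right_mono[OF bound[of n], of "norm q ^ n"]
    by (simp add: norm_mult norm_power power_mult_distrib mult.assoc)
  have "norm (eval_fps (fps_shift 2 F) q) \<le> c * (1 / (1 - K * norm q))"
    unfolding sums_unique[OF sums] sums_unique[OF geo]
    by (rule norm_suminf_le[OF le]) (use geo in \<open>simp add: sums_iff\<close>)
  then have "norm q * norm (eval_fps (fps_shift 2 F) q) \<le> norm q * (c * (1 / (1 - K * norm q)))"
    by (intro mult_left_mono) auto
  then show "norm A \<le> c * norm (nome z) / (1 - K * norm (nome z))"
    by (simp add: A_def norm_mult q_def mult.commute)
qed

lemma divisor_series_1: "fps_nth (divisor_series j) 1 = 1"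
proof -
  have "{d::nat. d dvd Suc 0} = {1}" by auto
  then show ?thesis by (simp add: divisor_series_def)
qed

text \<open>The coefficient at \<open>2\<close> is \<open>1 + 2\<^sup>j\<close>. The later ones are at most \<open>N\<^sup>j\<^sup>+\<^sup>1\<close>, which from \<open>N = 3\<close> on grows by a factor of
  at most \<open>(4/3)\<^sup>j\<^sup>+\<^sup>1\<close> in each step.\<close>

lemma divisor_series_bound:
  assumes c: "1 + 2 ^ j \<le> c" "3 ^ Suc j \<le> c * K" and K: "(4 :: nat) ^ Suc j \<le> 3 ^ Suc j * K"
  shows "norm (fps_nth (divisor_series j) (n + 2)) \<le> of_nat (c * K ^ n)"
proof -
  have "(\<Sum>d | d dvd n + 2. d ^ j) \<le> c * K ^ n"
  proof (cases n)
    case 0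
    have "{d::nat. d dvd 2} = {1, 2}" using prime_nat_iff[of 2] two_is_prime_nat by auto
    then show ?thesis using 0 c(1) by (simp add: numeral_2_eq_2 [symmetric])
  next
    case (Suc k)
    have "(k + 3) ^ Suc j \<le> 3 ^ Suc j * K ^ k"
    proof (induction k)
      case (Suc k)
      have "3 * (Suc k + 3) \<le> 4 * (k + 3)" by simp
      then have "(3 * (Suc k + 3)) ^ Suc j \<le> (4 * (k + 3)) ^ Suc j" by (rule power_mono) simp
      then have "3 ^ Suc j * (Suc k + 3) ^ Suc j \<le> 4 ^ Suc j * (k + 3) ^ Suc j"
        by (simp only: power_mult_distrib)
      also have "\<dots> \<le> (3 ^ Suc j * K) * (3 ^ Suc j * K ^ k)"
        by (intro mult_mono K Suc.IH) auto
      also have "\<dots> = 3 ^ Suc j * (3 ^ Suc j * K ^ Suc k)" by (simp add: mult_ac)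
      finally show ?case by (simp only: mult_le_cancel1) simp
    qed simp
    also have "3 ^ Suc j * K ^ k \<le> c * K * K ^ k" by (intro mult_right_mono c) auto
    finally have "(k + 3) ^ Suc j \<le> c * K ^ n" by (simp add: Suc mult_ac)
    moreover have "(\<Sum>d | d dvd n + 2. d ^ j) \<le> (n + 2) ^ Suc j" by (rule divisor_sum_le) simp
    moreover have "n + 2 = k + 3" using Suc by simp
    ultimately show ?thesis by (simp only:)
  qed
  then have "real (\<Sum>d | d dvd n + 2. d ^ j) \<le> real (c * K ^ n)" by (simp only: of_nat_le_iff)
  moreover have "norm (fps_nth (divisor_series j) (n + 2)) = real (\<Sum>d | d dvd n + 2. d ^ j)"
    unfolding divisor_series_def by (simp only: fps_nth_Abs_fps) (simp only: norm_of_nat add_2_eq_Suc' nat.simps if_False)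
  ultimately show ?thesis by simp
qed

text \<open>On the reduced region \<open>\<bar>q\<bar> \<le> 1/210\<close>, and there the discriminant is \<open>q (1 + E)\<close> with \<open>\<bar>E\<bar> < 1\<close>. The pairs \<open>9, 9\<close> and
  \<open>33, 23\<close> are the least constants to which \<open>divisor_series_bound\<close> applies in the two cases.\<close>

lemma qval_fDelta_nonzero_reduced:
  assumes "Im z \<ge> sqrt 3 / 2" shows "qval fDelta z \<noteq> 0"
proof
  assume zero: "qval fDelta z = 0"
  have z: "Im z > 0" using assms by (rule less_le_trans[rotated]) simp
  define q r where "q = nome z" and "r = norm (nome z)"
  have r: "r \<le> 1 / 210" "0 \<le> r" using nome_small[OF assms] by (auto simp: r_def)
  obtain A where A: "qval (divisor_series 3) z = q * (1 + A)" "norm A \<le> 9 * r / (1 - 9 * r)"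
    using qval_near_nome[OF z ratfps_divisor_series _ divisor_series_1, of 3 9 9]
      divisor_series_bound[of 3 9 9] r unfolding q_def r_def
    by (auto simp: divisor_series_def)
  obtain B where B: "qval (divisor_series 5) z = q * (1 + B)" "norm B \<le> 33 * r / (1 - 23 * r)"
    using qval_near_nome[OF z ratfps_divisor_series _ divisor_series_1, of 5 33 23]
      divisor_series_bound[of 5 33 23] r unfolding q_def r_def
    by (auto simp: divisor_series_def)
  have "9 * r / (1 - 9 * r) \<le> 0.045" "33 * r / (1 - 23 * r) \<le> 0.177"
    using r by (simp_all add: divide_le_eq)
  with A(2) B(2) have AB: "norm A \<le> 0.045" "norm B \<le> 0.177" by linarith+
  define E where "E = 5 / 12 * A + 7 / 12 * B + q * (- 47 + 200 * A + 100 * A ^ 2 - 294 * B - 147 * B ^ 2)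
      + 8000 * q ^ 2 * (1 + A) ^ 3"
  have "qval fDelta z = qval fU z ^ 3 - 27 * qval fV z ^ 2"
    unfolding fDelta_def using z
    by (simp add: qval_simps qval_power ratfps_fU ratfps_fV ratfps_power ratfps_mult)
  also have "\<dots> = q * (1 + E)"
    unfolding qval_fU[OF z] qval_fV[OF z] A(1) B(1) E_def
    by (simp add: field_simps power2_eq_square power3_eq_cube)
  finally have "E = - 1"
    using zero by (simp add: q_def add_eq_0_iff)
  then have "norm E = 1" by simp
  have "norm (5 / 12 * A) \<le> 5 / 12 * 0.045" "norm (7 / 12 * B) \<le> 7 / 12 * 0.177"
    using AB by (simp_all add: norm_mult norm_divide)
  moreover have "norm (q * (- 47 + 200 * A + 100 * A ^ 2 - 294 * B - 147 * B ^ 2)) \<le> 1 / 210 * 113"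
  proof -
    have A2: "norm (A ^ 2) \<le> 0.045 ^ 2" and B2: "norm (B ^ 2) \<le> 0.177 ^ 2"
      using AB by (auto simp: norm_power intro!: power_mono)
    have "norm (- 47 + 200 * A + 100 * A ^ 2 - 294 * B - 147 * B ^ 2)
        \<le> norm (- 47 :: complex) + norm (200 * A) + norm (100 * A ^ 2) + norm (294 * B) + norm (147 * B ^ 2)"
      by (intro norm_triangle_le norm_triangle_le_diff add_mono order_refl)
    also have "\<dots> = 47 + 200 * norm A + 100 * norm (A ^ 2) + 294 * norm B + 147 * norm (B ^ 2)"
      by (simp add: norm_mult)
    also have "\<dots> \<le> 47 + 200 * 0.045 + 100 * 0.045 ^ 2 + 294 * 0.177 + 147 * 0.177 ^ 2"
      by (intro add_mono mult_left_mono AB A2 B2) auto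
    also have "\<dots> \<le> (113 :: real)" by (simp add: power2_eq_square)
    finally show ?thesis
      using r unfolding norm_mult by (intro mult_mono) (auto simp: q_def r_def)
  qed
  moreover have "norm (8000 * q ^ 2 * (1 + A) ^ 3) \<le> 8000 * (1 / 210) ^ 2 * 1.045 ^ 3"
  proof -
    have "norm (1 + A) \<le> 1.045" using norm_triangle_ineq[of 1 A] AB by simp
    then have "norm ((1 + A) ^ 3) \<le> 1.045 ^ 3" unfolding norm_power by (intro power_mono) auto
    moreover have "norm (q ^ 2) \<le> (1 / 210) ^ 2"
      unfolding norm_power using r by (intro power_mono) (auto simp: q_def r_def)
    ultimately show ?thesis
      unfolding norm_mult by (intro mult_mono) auto
  qed
  moreover have "norm E \<le> norm (5 / 12 * A) + norm (7 / 12 * B)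
      + norm (q * (- 47 + 200 * A + 100 * A ^ 2 - 294 * B - 147 * B ^ 2)) + norm (8000 * q ^ 2 * (1 + A) ^ 3)"
    unfolding E_def by (intro norm_triangle_le add_mono order_refl)
  moreover have "5 / 12 * 0.045 + 7 / 12 * 0.177 + 1 / 210 * 113 + 8000 * (1 / 210) ^ 2 * 1.045 ^ 3 < (1 :: real)"
    by (simp add: power2_eq_square power3_eq_cube)
  ultimately show False using \<open>norm E = 1\<close> by linarith
qed

lemma qval_fDelta_nonzero:
  assumes z: "Im z > 0" shows "qval fDelta z \<noteq> 0"
proof -
  obtain a b c d :: int where g: "a * d - b * c = 1" "Im (moebius a b c d z) \<ge> sqrt 3 / 2"
    by (rule reduction[OF z])
  then have "qval fDelta (moebius a b c d z) \<noteq> 0" by (intro qval_fDelta_nonzero_reduced)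
  then show ?thesis using mformD[OF mform_fDelta g(1) z] by auto
qed

lemma fDelta_nonzero [simp]: "fDelta \<noteq> 0"
  using fDelta_1 by auto

subsection \<open>Division by the discriminant\<close>

text \<open>The discriminant divided by \<open>q\<close> has no zeros in the whole unit disc, so it is invertible.\<close>

definition fDelta1 :: "complex fps" where "fDelta1 = fps_shift 1 fDelta"

lemma fDelta_eq: "fDelta = fps_X * fDelta1"
proof (rule fps_ext)
  fix n show "fps_nth fDelta n = fps_nth (fps_X * fDelta1) n"
    by (cases n) (simp_all add: fDelta1_def fDelta_0)
qed

lemma ratfps_fDelta1: "fDelta1 \<in> ratfps"
  unfolding fDelta1_def by (intro ratfps_shift ratfps_fDelta)

lemma ratfps_inverse_fDelta1: "inverse fDelta1 \<in> ratfps"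
proof (rule ratfps_inverse[OF ratfps_fDelta1])
  fix q :: complex assume q: "norm q < 1"
  show "eval_fps fDelta1 q \<noteq> 0"
  proof (cases "q = 0")
    case True
    then show ?thesis using fDelta_1 by (simp add: eval_fps_at_0 fDelta1_def)
  next
    case False
    then obtain z where z: "Im z > 0" "nome z = q" using nome_surj q by blast
    have "qval fDelta z = nome z * qval fDelta1 z"
      unfolding fDelta_eq using qval_simps(3)[OF z(1), of fps_X fDelta1] ratfps_fDelta1 by simp
    with qval_fDelta_nonzero[OF z(1)] z(2) show ?thesis by auto
  qed
qed

lemma fDelta1_inverse: "fDelta1 * inverse fDelta1 = 1"
  by (rule inverse_mult_eq_1') (use fDelta_1 in \<open>simp add: fDelta1_def\<close>)

lemma mform_divide_fDelta:
  assumes F: "mform m F" and F0: "fps_nth F 0 = 0"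
  obtains G where "mform (m - 12) G" "F = fDelta * G"
proof
  \<comment> \<open>the quotient of \<open>F / q\<close> by \<open>\<Delta> / q\<close>\<close>
  define G where "G = fps_shift 1 F * inverse fDelta1"
  have "F = fps_X * fps_shift 1 F"
  proof (rule fps_ext)
    fix n show "fps_nth F n = fps_nth (fps_X * fps_shift 1 F) n"
      by (cases n) (simp_all add: F0)
  qed
  moreover have "fDelta * G = fps_X * fps_shift 1 F * (fDelta1 * inverse fDelta1)"
    by (simp add: fDelta_eq G_def mult_ac)
  ultimately show eq: "F = fDelta * G" by (simp add: fDelta1_inverse)
  have G: "G \<in> ratfps"
    unfolding G_def by (intro ratfps_mult ratfps_shift ratfps_inverse_fDelta1 mform_ratfps[OF F])
  show "mform (m - 12) G"
    unfolding mform_def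
  proof (intro conjI allI impI G)
    fix a b c d :: int and z assume det: "a * d - b * c = 1" and z: "Im z > 0"
    define w where "w = of_int c * z + of_int d"
    have w: "w \<noteq> 0" unfolding w_def by (rule automorphy_nonzero[OF det_nonzero[OF det] z])
    note z' = Im_moebius_pos[OF det z]
    have "qval fDelta (moebius a b c d z) * qval G (moebius a b c d z) = w powi m * (qval fDelta z * qval G z)"
      using mformD[OF F det z] z z' by (simp add: eq qval_simps ratfps_fDelta G w_def)
    moreover have "qval fDelta (moebius a b c d z) = w powi 12 * qval fDelta z"
      using mformD[OF mform_fDelta det z] by (simp add: w_def)
    moreover have "w powi m = w powi 12 * w powi (m - 12)"
      using w power_int_add[of w 12 "m - 12"] by simp
    ultimately have "(w powi 12 * qval fDelta z) * qval G (moebius a b c d z)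
        = (w powi 12 * qval fDelta z) * (w powi (m - 12) * qval G z)"
      by (simp add: mult_ac)
    then show "qval G (moebius a b c d z) = w powi (m - 12) * qval G z"
      using qval_fDelta_nonzero[OF z] w by (simp only: mult_cancel_left) auto
  qed
qed

text \<open>For \<open>m < 0\<close> the product \<open>F\<^sup>1\<^sup>2 \<Delta>\<^sup>-\<^sup>m\<close> has weight 0 and vanishes at the cusp; it is constant, hence zero.\<close>

lemma mform_negative:
  assumes F: "mform m F" and m: "m < 0" shows "F = 0"
proof -
  have "mform (int 12 * m + int (nat (- m)) * 12) (F ^ 12 * fDelta ^ nat (- m))"
    by (intro mform_mult mform_power F mform_fDelta)
  then have "mform 0 (F ^ 12 * fDelta ^ nat (- m))" using m by simp
  from mform_weight_0[OF this] have "F ^ 12 * fDelta ^ nat (- m) = 0"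
    using m by (simp add: fps_power_zeroth fDelta_0 power_0_left)
  then show ?thesis by simp
qed

text \<open>The quotient by the discriminant has negative weight.\<close>

lemma mform_small_cusp: "mform m F \<Longrightarrow> fps_nth F 0 = 0 \<Longrightarrow> m < 12 \<Longrightarrow> F = 0"
  by (metis mform_divide_fDelta mform_negative diff_less_0_iff_less mult_zero_right)

lemma mform_odd:
  assumes F: "mform m F" and m: "odd m" shows "F = 0"
proof (rule ratfps_eqI[OF mform_ratfps[OF F]])
  fix z :: complex assume z: "Im z > 0"
  have "qval F (moebius (- 1) 0 0 (- 1) z) = (- 1) powi m * qval F z"
    using mformD[OF F, of "- 1" "- 1" 0 0 z] z by simp
  moreover have "moebius (- 1) 0 0 (- 1) z = z" by (simp add: moebius_def)
  ultimately show "qval F z = qval 0 z" using m by simp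
qed auto

lemma fps_nth_0_Rats: "mform m F \<Longrightarrow> fps_nth F 0 \<in> \<rat>"
  by (simp add: mform_def ratfps_def)

text \<open>In weights 4 and 6 the square and the cube of \<open>F\<close> are multiples of \<open>fU\<close> and \<open>fV\<close>, with constants given by the
  constant term \<open>c\<close> of \<open>F\<close>. From \<open>(F\<^sup>2)\<^sup>3 = (F\<^sup>3)\<^sup>2\<close> it follows that \<open>c\<^sup>6\<close> times the discriminant is zero.\<close>

lemma mform_weight_2:
  assumes F: "mform 2 F" shows "F = 0"
proof -
  define c where "c = fps_nth F 0"
  have c: "c \<in> \<rat>" unfolding c_def by (rule fps_nth_0_Rats[OF F])
  have "F ^ 2 - fps_const (12 * c ^ 2) * fU = 0"
  proof (rule mform_small_cusp)
    show "mform 4 (F ^ 2 - fps_const (12 * c ^ 2) * fU)"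
      using mform_power[OF F, of 2] c by (intro mform_diff mform_scale mform_fU) auto
    show "fps_nth (F ^ 2 - fps_const (12 * c ^ 2) * fU) 0 = 0"
      by (simp add: fps_power_zeroth fU_0 c_def)
  qed simp
  moreover have "F ^ 3 - fps_const (- 216 * c ^ 3) * fV = 0"
  proof (rule mform_small_cusp)
    show "mform 6 (F ^ 3 - fps_const (- 216 * c ^ 3) * fV)"
      using mform_power[OF F, of 3] c by (intro mform_diff mform_scale mform_fV) auto
    show "fps_nth (F ^ 3 - fps_const (- 216 * c ^ 3) * fV) 0 = 0"
      by (simp add: fps_power_zeroth fV_0 c_def)
  qed simp
  ultimately have "F ^ 2 = fps_const (12 * c ^ 2) * fU" "F ^ 3 = fps_const (- 216 * c ^ 3) * fV" by simp_all
  then have eq: "(fps_const (12 * c ^ 2) * fU) ^ 3 = (fps_const (- 216 * c ^ 3) * fV) ^ 2"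
    by (metis power_mult mult.commute)
  have "fps_const (1728 * c ^ 6) * fDelta = (fps_const (12 * c ^ 2) * fU) ^ 3 - (fps_const (- 216 * c ^ 3) * fV) ^ 2"
    by (simp add: fDelta_def power_mult_distrib fps_const_power power_mult [symmetric] right_diff_distrib
        numeral_fps_const fps_const_mult [symmetric] mult.assoc del: fps_const_mult)
  then have "fps_const (1728 * c ^ 6) * fDelta = 0" unfolding eq by simp
  then have "c = 0" by simp
  then have "F ^ 2 = 0" using \<open>F ^ 2 = fps_const (12 * c ^ 2) * fU\<close> by simp
  then show ?thesis by simp
qed

subsection \<open>Ramanujan's differential equations\<close>

text \<open>The logarithmic derivative of the discriminant plays the role of the Eisenstein series of weight 2.\<close>

definition fE :: "complex fps" where "fE = fps_deriv fDelta * inverse fDelta1"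

lemma theta_fDelta: "theta fDelta = fE * fDelta"
proof -
  have "fE * fDelta = theta fDelta * (fDelta1 * inverse fDelta1)"
    by (simp add: fE_def fDelta_eq mult_ac)
  then show ?thesis by (simp add: fDelta1_inverse)
qed

lemma ratfps_fE: "fE \<in> ratfps"
  unfolding fE_def by (intro ratfps_mult ratfps_deriv ratfps_fDelta ratfps_inverse_fDelta1)

lemma fE_0: "fps_nth fE 0 = 1"
  using fDelta_1 by (simp add: fE_def fDelta1_def)

lemma has_field_derivative_moebius:
  assumes "a * d - b * c = 1" "Im z > 0"
  shows "(moebius a b c d has_field_derivative 1 / (of_int c * z + of_int d)\<^sup>2) (at z)"
proof -
  define w where "w = of_int c * z + of_int d"
  have w: "w \<noteq> 0" unfolding w_def by (rule automorphy_nonzero[OF det_nonzero[OF assms(1)] assms(2)])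
  have "(moebius a b c d has_field_derivative
      (of_int a * (of_int c * z + of_int d) - (of_int a * z + of_int b) * of_int c) / (w * w)) (at z)"
    unfolding moebius_def w_def using w
    by (auto intro!: derivative_eq_intros simp: w_def)
  also have "of_int a * (of_int c * z + of_int d) - (of_int a * z + of_int b) * of_int c
      = (of_int (a * d - b * c) :: complex)"
    by (simp add: algebra_simps)
  finally show ?thesis using assms(1) by (simp add: w_def power2_eq_square)
qed

text \<open>The derivative of the transformation law of \<open>F\<close>.\<close>

lemma qval_theta_moebius:
  assumes F: "mform m F" and det: "a * d - b * c = 1" and z: "Im z > 0"
  shows "qval (theta F) (moebius a b c d z) = (of_int c * z + of_int d) powi (m + 2) * qval (theta F) z
    + of_int m * of_int c / (2 * of_real pi * \<i>) * (of_int c * z + of_int d) powi (m + 1) * qval F z"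
proof -
  define w where "w = of_int c * z + of_int d"
  define P where "P = 2 * of_real pi * \<i>"
  have P: "P \<noteq> 0" by (simp add: P_def)
  have w: "w \<noteq> 0" unfolding w_def by (rule automorphy_nonzero[OF det_nonzero[OF det] z])
  note z' = Im_moebius_pos[OF det z] and R = mform_ratfps[OF F]
  have 1: "((\<lambda>z. qval F (moebius a b c d z)) has_field_derivative
      P * qval (theta F) (moebius a b c d z) * (1 / w\<^sup>2)) (at z)"
    unfolding P_def w_def
    by (rule DERIV_chain2[OF has_field_derivative_qval[OF z' R] has_field_derivative_moebius[OF det z]])
  have 2: "((\<lambda>z. (of_int c * z + of_int d) powi m * qval F z) has_field_derivative
      of_int m * w powi (m - 1) * of_int c * qval F z + w powi m * (P * qval (theta F) z)) (at z)"
  proof -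
    have "((\<lambda>z. (of_int c * z + of_int d) powi m) has_field_derivative of_int m * w powi (m - 1) * of_int c) (at z)"
      unfolding w_def using w by (auto intro!: derivative_eq_intros simp: w_def)
    from DERIV_mult[OF this has_field_derivative_qval[OF z R]] show ?thesis
      by (simp add: P_def w_def mult_ac)
  qed
  have "P * qval (theta F) (moebius a b c d z) * (1 / w\<^sup>2) =
      of_int m * w powi (m - 1) * of_int c * qval F z + w powi m * (P * qval (theta F) z)"
    by (rule has_field_derivative_unique_on_open[OF open_upper _ _ 1 2])
       (use z mformD[OF F det] in auto)
  then have "qval (theta F) (moebius a b c d z) =
      (of_int m * w powi (m - 1) * of_int c * qval F z + w powi m * (P * qval (theta F) z)) * w\<^sup>2 / P"
    using w P by (simp add: field_simps)
  also have "\<dots> = (w powi m * w\<^sup>2) * qval (theta F) z + of_int m * of_int c / P * (w powi (m - 1) * w\<^sup>2) * qval F z"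
    using P by (simp add: field_simps)
  also have "w powi m * w\<^sup>2 = w powi (m + 2)" using w by (simp add: power_int_add)
  also have "w powi (m - 1) * w\<^sup>2 = w powi (m + 1)"
    using w power_int_add[of w "m - 1" 2] by (simp add: add.commute)
  finally show ?thesis by (simp add: w_def P_def)
qed

text \<open>The logarithmic derivative of the transformation law of the discriminant.\<close>

lemma qval_fE_moebius:
  assumes det: "a * d - b * c = 1" and z: "Im z > 0"
  shows "qval fE (moebius a b c d z) = (of_int c * z + of_int d)\<^sup>2 * qval fE z
    + 12 * of_int c / (2 * of_real pi * \<i>) * (of_int c * z + of_int d)"
proof -
  define w where "w = of_int c * z + of_int d"
  have w: "w \<noteq> 0" unfolding w_def by (rule automorphy_nonzero[OF det_nonzero[OF det] z])
  note z' = Im_moebius_pos[OF det z]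
  have th: "qval (theta fDelta) x = qval fE x * qval fDelta x" if "Im x > 0" for x
    unfolding theta_fDelta using that by (simp add: qval_simps ratfps_fE ratfps_fDelta)
  have D: "qval fDelta (moebius a b c d z) = w ^ 12 * qval fDelta z"
    using mformD[OF mform_fDelta det z] by (simp add: w_def)
  have "qval fE (moebius a b c d z) * (w ^ 12 * qval fDelta z) =
      w powi 14 * (qval fE z * qval fDelta z) + 12 * of_int c / (2 * of_real pi * \<i>) * w powi 13 * qval fDelta z"
    using qval_theta_moebius[OF mform_fDelta det z] unfolding th[OF z'] th[OF z] D by (simp add: w_def)
  also have "\<dots> = (w\<^sup>2 * qval fE z + 12 * of_int c / (2 * of_real pi * \<i>) * w) * (w ^ 12 * qval fDelta z)"
    by (simp add: algebra_simps eval_nat_numeral)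
  finally show ?thesis
    using w qval_fDelta_nonzero[OF z] by (simp add: w_def)
qed

text \<open>The derivation of Serre: the terms that keep \<open>theta F\<close> and \<open>fE * F\<close> from being modular are proportional.\<close>

lemma mform_serre:
  assumes F: "mform m F"
  shows "mform (m + 2) (theta F - fps_const (of_int m / 12) * (fE * F))"
proof -
  have R: "F \<in> ratfps" "theta F \<in> ratfps" "fE * F \<in> ratfps" "fps_const (of_int m / 12) * (fE * F) \<in> ratfps"
    using mform_ratfps[OF F] by (auto intro!: ratfps_theta ratfps_mult ratfps_fE ratfps_const)
  have c: "fps_const (of_int m / 12 :: complex) \<in> ratfps" by (intro ratfps_const) auto
  have val: "qval (theta F - fps_const (of_int m / 12) * (fE * F)) x =
      qval (theta F) x - of_int m / 12 * (qval fE x * qval F x)" if "Im x > 0" for x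
    using that R c by (simp add: qval_simps ratfps_fE)
  show ?thesis
    unfolding mform_def
  proof (intro conjI allI impI)
    show "theta F - fps_const (of_int m / 12) * (fE * F) \<in> ratfps" using R by (intro ratfps_diff)
    fix a b c d :: int and z assume det: "a * d - b * c = 1" and z: "Im z > 0"
    define w where "w = of_int c * z + of_int d"
    have w: "w \<noteq> 0" unfolding w_def by (rule automorphy_nonzero[OF det_nonzero[OF det] z])
    have p: "w powi (m + 2) = w powi m * w\<^sup>2" "w powi (m + 1) = w powi m * w"
      using w by (simp_all add: power_int_add)
    show "qval (theta F - fps_const (of_int m / 12) * (fE * F)) (moebius a b c d z)
        = (of_int c * z + of_int d) powi (m + 2) * qval (theta F - fps_const (of_int m / 12) * (fE * F)) z"
      unfolding val[OF z] val[OF Im_moebius_pos[OF det z]] qval_theta_moebius[OF F det z]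
        qval_fE_moebius[OF det z] mformD[OF F det z] w_def [symmetric] p
      by (simp add: algebra_simps)
  qed
qed

text \<open>The two sides of each of Ramanujan's equations have the same constant term and differ by a modular form
  of weight less than 12, so they agree.\<close>

theorem ramanujan_fU: "theta fU = fps_const (1 / 3) * (fE * fU) + 6 * fV"
proof -
  have "theta fU - fps_const (of_int 4 / 12) * (fE * fU) - 6 * fV = 0"
  proof (rule mform_small_cusp)
    have "mform 6 (theta fU - fps_const (of_int 4 / 12) * (fE * fU))"
      using mform_serre[OF mform_fU] by simp
    then show "mform 6 (theta fU - fps_const (of_int 4 / 12) * (fE * fU) - 6 * fV)"
      by (rule mform_diff[OF _ mform_numeral[OF mform_fV]])
  qed (simp_all add: fU_0 fV_0 fE_0)
  then show ?thesis by (simp add: algebra_simps)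
qed

theorem ramanujan_fV: "theta fV = fps_const (1 / 2) * (fE * fV) + fps_const (1 / 3) * fU ^ 2"
proof -
  have "theta fV - fps_const (of_int 6 / 12) * (fE * fV) - fps_const (1 / 3) * fU ^ 2 = 0"
  proof (rule mform_small_cusp)
    show "mform 8 (theta fV - fps_const (of_int 6 / 12) * (fE * fV) - fps_const (1 / 3) * fU ^ 2)"
    proof (rule mform_diff)
      show "mform 8 (theta fV - fps_const (of_int 6 / 12) * (fE * fV))"
        using mform_serre[OF mform_fV] by simp
      show "mform 8 (fps_const (1 / 3) * fU ^ 2)"
        using mform_power[OF mform_fU, of 2] by (intro mform_scale) auto
    qed
  qed (simp_all add: fU_0 fV_0 fE_0 fps_power_zeroth power2_eq_square)
  then show ?thesis by (simp add: algebra_simps)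
qed

text \<open>That \<open>theta fE - fE\<^sup>2 / 12\<close> is modular follows by differentiating the transformation law of \<open>fE\<close>.\<close>

theorem ramanujan_fE: "theta fE = fps_const (1 / 12) * fE ^ 2 - fU"
proof -
  have c: "fps_const (1 / 12 :: complex) \<in> ratfps" by (intro ratfps_const) auto
  have R: "theta fE \<in> ratfps" "fE ^ 2 \<in> ratfps" "fps_const (1 / 12) * fE ^ 2 \<in> ratfps"
    by (auto intro!: ratfps_theta ratfps_mult ratfps_power ratfps_fE c)
  have val: "qval (theta fE - fps_const (1 / 12) * fE ^ 2) x = qval (theta fE) x - 1 / 12 * (qval fE x)\<^sup>2"
    if "Im x > 0" for x
    using that R c by (simp add: qval_simps qval_power ratfps_fE)
  have "mform 4 (theta fE - fps_const (1 / 12) * fE ^ 2)"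
    unfolding mform_def
  proof (intro conjI allI impI)
    show "theta fE - fps_const (1 / 12) * fE ^ 2 \<in> ratfps" using R by (intro ratfps_diff)
    fix a b c d :: int and z assume det: "a * d - b * c = 1" and z: "Im z > 0"
    define w where "w = of_int c * z + of_int d"
    define P where "P = 2 * of_real pi * \<i>"
    have P: "P \<noteq> 0" by (simp add: P_def)
    have w: "w \<noteq> 0" unfolding w_def by (rule automorphy_nonzero[OF det_nonzero[OF det] z])
    note z' = Im_moebius_pos[OF det z]
    have 1: "((\<lambda>z. qval fE (moebius a b c d z)) has_field_derivative
        P * qval (theta fE) (moebius a b c d z) * (1 / w\<^sup>2)) (at z)"
      unfolding P_def w_def
      by (rule DERIV_chain2[OF has_field_derivative_qval[OF z' ratfps_fE] has_field_derivative_moebius[OF det z]])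
    have 2: "((\<lambda>z. (of_int c * z + of_int d)\<^sup>2 * qval fE z + 12 * of_int c / P * (of_int c * z + of_int d))
        has_field_derivative
        2 * w * of_int c * qval fE z + w\<^sup>2 * (P * qval (theta fE) z) + 12 * of_int c / P * of_int c) (at z)"
    proof -
      have dw: "((\<lambda>z. of_int c * z + of_int d) has_field_derivative of_int c) (at z)"
        by (auto intro!: derivative_eq_intros)
      have dw2: "((\<lambda>z. (of_int c * z + of_int d)\<^sup>2) has_field_derivative 2 * w * of_int c) (at z)"
        unfolding w_def by (auto intro!: derivative_eq_intros)
      from DERIV_add[OF DERIV_mult[OF dw2 has_field_derivative_qval[OF z ratfps_fE]]
          DERIV_cmult[OF dw, of "12 * of_int c / P"]]
      show ?thesis unfolding P_def [symmetric] by (simp add: w_def mult_ac)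
    qed
    have "P * qval (theta fE) (moebius a b c d z) * (1 / w\<^sup>2) =
        2 * w * of_int c * qval fE z + w\<^sup>2 * (P * qval (theta fE) z) + 12 * of_int c / P * of_int c"
      by (rule has_field_derivative_unique_on_open[OF open_upper _ _ 1 2])
         (use z qval_fE_moebius[OF det] in \<open>auto simp: P_def\<close>)
    then have "qval (theta fE) (moebius a b c d z) =
        (2 * w * of_int c * qval fE z + w\<^sup>2 * (P * qval (theta fE) z) + 12 * of_int c / P * of_int c) * w\<^sup>2 / P"
      using w P by (simp add: field_simps)
    note T = this
    have y: "qval fE (moebius a b c d z) = w\<^sup>2 * qval fE z + 12 * of_int c / P * w"
      using qval_fE_moebius[OF det z] by (simp add: w_def P_def)
    have "qval (theta fE) (moebius a b c d z) - 1 / 12 * (qval fE (moebius a b c d z))\<^sup>2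
        = w ^ 4 * (qval (theta fE) z - 1 / 12 * (qval fE z)\<^sup>2)"
      unfolding T y using P by (simp add: field_simps eval_nat_numeral)
    then show "qval (theta fE - fps_const (1 / 12) * fE ^ 2) (moebius a b c d z)
        = (of_int c * z + of_int d) powi 4 * qval (theta fE - fps_const (1 / 12) * fE ^ 2) z"
      unfolding val[OF z] val[OF z'] by (simp add: w_def)
  qed
  then have "theta fE - fps_const (1 / 12) * fE ^ 2 + fU = 0"
    by (intro mform_small_cusp[OF mform_add[OF _ mform_fU]])
       (simp_all add: fU_0 fE_0 fps_power_zeroth)
  then show ?thesis by (simp add: algebra_simps eq_neg_iff_add_eq_0)
qed

section \<open>Polynomials in the Eisenstein series\<close>

lemma poly_map_poly_hom:
  fixes g :: "'a::comm_ring_1 \<Rightarrow> 'b::comm_ring_1"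
  assumes add: "\<And>a b. g (a + b) = g a + g b" and mult: "\<And>a b. g (a * b) = g a * g b" and zero: "g 0 = 0"
  shows "poly (map_poly g (p + q)) x = poly (map_poly g p) x + poly (map_poly g q) x"
    and "poly (map_poly g (p * q)) x = poly (map_poly g p) x * poly (map_poly g q) x"
proof -
  have A: "map_poly g (p + q) = map_poly g p + map_poly g q" for p q
    by (rule poly_eqI) (simp add: coeff_map_poly zero add)
  show "poly (map_poly g (p + q)) x = poly (map_poly g p) x + poly (map_poly g q) x"
    by (simp add: A)
  have S: "map_poly g (Polynomial.smult a q) = Polynomial.smult (g a) (map_poly g q)" for a q
    by (rule poly_eqI) (simp add: coeff_map_poly zero mult)
  have C: "map_poly g (pCons a q) = pCons (g a) (map_poly g q)" for a q
    by (rule poly_eqI) (simp add: coeff_map_poly zero coeff_pCons split: nat.splits)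
  show "poly (map_poly g (p * q)) x = poly (map_poly g p) x * poly (map_poly g q) x"
  proof (induction p)
    case (pCons a p)
    then show ?case by (simp add: A S C zero algebra_simps)
  qed simp
qed

text \<open>Evaluation of elements of \<open>\<rat>[u,v]\<close> in a commutative ring. The cases of interest are complex numbers and
  power series, with \<open>\<phi>\<close> the inclusion of the rationals.\<close>

definition hom_eval :: "(rat \<Rightarrow> 'a::comm_ring_1) \<Rightarrow> 'a \<Rightarrow> 'a \<Rightarrow> quv \<Rightarrow> 'a" where
  "hom_eval \<phi> x y p = poly (map_poly (\<lambda>a. poly (map_poly \<phi> a) x) p) y"

locale rat_hom =
  fixes \<phi> :: "rat \<Rightarrow> 'a::comm_ring_1"
  assumes hom_add: "\<phi> (a + b) = \<phi> a + \<phi> b" and hom_mult: "\<phi> (a * b) = \<phi> a * \<phi> b"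
    and hom_0 [simp]: "\<phi> 0 = 0" and hom_1 [simp]: "\<phi> 1 = 1"
begin

lemma hom_eval_const: "hom_eval \<phi> x y [:[:c:]:] = \<phi> c"
  and hom_eval_pu: "hom_eval \<phi> x y pu = x" and hom_eval_pv: "hom_eval \<phi> x y pv = y"
proof -
  have [simp]: "map_poly \<phi> 1 = 1" by (simp add: one_pCons map_poly_pCons)
  show "hom_eval \<phi> x y [:[:c:]:] = \<phi> c" "hom_eval \<phi> x y pu = x" "hom_eval \<phi> x y pv = y"
    by (simp_all add: hom_eval_def map_poly_pCons pu_def pv_def)
qed

lemma hom_eval_add: "hom_eval \<phi> x y (p + q) = hom_eval \<phi> x y p + hom_eval \<phi> x y q"
  and hom_eval_mult: "hom_eval \<phi> x y (p * q) = hom_eval \<phi> x y p * hom_eval \<phi> x y q"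
  unfolding hom_eval_def
  by (rule poly_map_poly_hom; simp add: poly_map_poly_hom hom_add hom_mult)+

lemma hom_eval_0 [simp]: "hom_eval \<phi> x y 0 = 0" and hom_eval_1 [simp]: "hom_eval \<phi> x y 1 = 1"
  using hom_eval_const[of x y 0] hom_eval_const[of x y 1] by (simp_all add: one_pCons)

lemma hom_eval_uminus: "hom_eval \<phi> x y (- p) = - hom_eval \<phi> x y p"
  using hom_eval_add[of x y p "- p"] by (simp add: eq_neg_iff_add_eq_0 add.commute)

lemma hom_eval_diff: "hom_eval \<phi> x y (p - q) = hom_eval \<phi> x y p - hom_eval \<phi> x y q"
  using hom_eval_add[of x y p "- q"] by (simp add: hom_eval_uminus)

lemma hom_eval_power: "hom_eval \<phi> x y (p ^ k) = hom_eval \<phi> x y p ^ k"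
  by (induction k) (simp_all add: hom_eval_mult)

lemma hom_eval_numeral: "hom_eval \<phi> x y (numeral k) = numeral k"
proof -
  have "hom_eval \<phi> x y (of_nat n) = of_nat n" for n
    by (induction n) (simp_all add: hom_eval_add)
  from this[of "numeral k"] show ?thesis by simp
qed

lemma hom_eval_monom: "hom_eval \<phi> x y (monom (monom c i) j) = \<phi> c * x ^ i * y ^ j"
  unfolding monom_monom_eq by (simp only: hom_eval_mult hom_eval_power hom_eval_const hom_eval_pu hom_eval_pv)

lemma hom_eval_pDelta: "hom_eval \<phi> x y pDelta = x ^ 3 - 27 * y ^ 2"
  unfolding pDelta_def
  by (simp only: hom_eval_diff hom_eval_mult hom_eval_power hom_eval_pu hom_eval_pv hom_eval_numeral)

end

interpretation complex_eval: rat_hom "of_rat :: rat \<Rightarrow> complex"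
  by standard (simp_all add: of_rat_add of_rat_mult)

interpretation series_eval: rat_hom "\<lambda>c. fps_const (of_rat c :: complex)"
  by standard (simp_all add: of_rat_add of_rat_mult)

lemma eval_uv_eq: "eval_uv p x y = hom_eval of_rat x y p"
  by (simp add: eval_uv_def hom_eval_def)

abbreviation peval :: "quv \<Rightarrow> complex fps" where
  "peval \<equiv> hom_eval (\<lambda>c. fps_const (of_rat c)) fU fV"

lemma peval_pDelta: "peval pDelta = fDelta"
  by (simp add: series_eval.hom_eval_pDelta fDelta_def)

lemma ratfps_peval: "peval p \<in> ratfps"
proof (induction p rule: quv_monomial_induct)
  case (monom i j)
  show ?case
    unfolding series_eval.hom_eval_monom by (intro ratfps_mult ratfps_const ratfps_power ratfps_fU ratfps_fV) simp
qed (simp_all add: series_eval.hom_eval_add ratfps_add)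

lemma qval_peval:
  assumes z: "Im z > 0" shows "qval (peval p) z = eval_uv p (qval fU z) (qval fV z)"
  unfolding eval_uv_eq
proof (induction p rule: quv_monomial_induct)
  case (add a b)
  then show ?case using z by (simp add: series_eval.hom_eval_add complex_eval.hom_eval_add qval_simps ratfps_peval)
next
  case (monom i j)
  have "fps_const (of_rat c :: complex) \<in> ratfps" for c by (intro ratfps_const) simp
  then show ?case
    unfolding series_eval.hom_eval_monom complex_eval.hom_eval_monom using z
    by (simp add: qval_simps qval_power ratfps_mult ratfps_power ratfps_fU ratfps_fV)
qed simp

lemma wtsI: "coeff (coeff p j) i \<noteq> 0 \<Longrightarrow> 4 * int i + 6 * int j \<in> wts p"
  unfolding wts_def by blast

lemma mform_peval:
  assumes "wts p \<subseteq> {m}" shows "mform m (peval p)"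
proof -
  have w: "4 * int i + 6 * int j = m" if "coeff (coeff p j) i \<noteq> 0" for i j
    using wtsI[OF that] assms by auto
  show ?thesis
  proof (induction p rule: quv_monomial_induct)
    case (monom i j)
    have "mform (int i * 4 + int j * 6) (fps_const (of_rat (coeff (coeff p j) i)) * (fU ^ i * fV ^ j))"
      by (intro mform_scale mform_mult mform_power mform_fU mform_fV) simp
    then show ?case using w[OF monom] by (simp add: series_eval.hom_eval_monom mult_ac)
  qed (simp_all add: series_eval.hom_eval_add mform_add)
qed

lemma even_weight: "even m \<Longrightarrow> m \<ge> 0 \<Longrightarrow> m \<noteq> 2 \<Longrightarrow> \<exists>i j. m = 4 * int i + 6 * int j"
proof -
  assume m: "even m" "m \<ge> 0" "m \<noteq> 2"
  show ?thesis
  proof (cases "4 dvd m")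
    case True
    then obtain k where "m = 4 * k" by blast
    with m show ?thesis by (intro exI[of "\<lambda>i. \<exists>j. m = 4 * int i + 6 * int j" "nat k"] exI[of _ 0]) auto
  next
    case False
    then have "4 dvd m - 6" using m(1) by presburger
    then obtain k where "m - 6 = 4 * k" by blast
    moreover from this have "k \<ge> 0" using m by presburger
    ultimately have "m = 4 * int (nat k) + 6 * int 1" by auto
    then show ?thesis by blast
  qed
qed

text \<open>Subtracting a monomial in the generators removes the constant term; dividing by the
  discriminant then lowers the weight by 12.\<close>

theorem mform_eq_peval:
  assumes "mform m F" shows "\<exists>p. wts p \<subseteq> {m} \<and> peval p = F"
  using assms
proof (induction "nat m" arbitrary: m F rule: less_induct)
  case less
  show ?case
  proof (cases "odd m \<or> m < 0 \<or> m = 2")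
    case True
    then have "F = 0" using mform_odd mform_negative mform_weight_2 less.prems by blast
    then show ?thesis by (intro exI[of _ 0]) simp
  next
    case False
    then obtain i j where ij: "m = 4 * int i + 6 * int j" using even_weight by force
    define M where "M = fU ^ i * fV ^ j"
    have M: "mform m M"
      unfolding M_def ij using mform_mult[OF mform_power[OF mform_fU, of i] mform_power[OF mform_fV, of j]]
      by (simp add: mult.commute)
    have M0: "fps_nth M 0 \<noteq> 0" by (simp add: M_def fps_power_zeroth fU_0 fV_0)
    have "fps_nth F 0 / fps_nth M 0 \<in> \<rat>"
      using fps_nth_0_Rats[OF less.prems] fps_nth_0_Rats[OF M] by (rule Rats_divide)
    then obtain r where r: "fps_nth F 0 / fps_nth M 0 = of_rat r" by (elim Rats_cases)
    have "mform m (F - fps_const (of_rat r) * M)"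
      by (intro mform_diff less.prems mform_scale M) simp
    moreover have "fps_nth (F - fps_const (of_rat r) * M) 0 = 0"
      using r M0 by (simp add: field_simps)
    ultimately obtain G where G: "mform (m - 12) G" "F - fps_const (of_rat r) * M = fDelta * G"
      by (rule mform_divide_fDelta)
    have "\<exists>p. wts p \<subseteq> {m - 12} \<and> peval p = G"
    proof (cases "m < 12")
      case True
      then have "G = 0" using mform_negative[OF G(1)] by simp
      then show ?thesis by (intro exI[of _ 0]) simp
    next
      case False
      then show ?thesis using less.hyps[of "m - 12" G] G(1) by auto
    qed
    then obtain p where p: "wts p \<subseteq> {m - 12}" "peval p = G" by blast
    define q where "q = monom (monom r i) j + pDelta * p"
    have "wts (pDelta * p) \<subseteq> {m}"
      using wts_Delta_power[of 1] by (intro wts_mult_subset[OF _ p(1)]) auto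
    then have "wts q \<subseteq> {m}"
      unfolding q_def using wts_add wts_monom[of r i j] ij by blast
    moreover have "peval q = fps_const (of_rat r) * M + fDelta * G"
      by (simp add: q_def series_eval.hom_eval_add series_eval.hom_eval_monom series_eval.hom_eval_mult peval_pDelta p(2) M_def mult.assoc)
    then have "peval q = F" using G(2) by (simp add: algebra_simps)
    ultimately show ?thesis by blast
  qed
qed

lemma vtp_add: "vtp (p + q) = vtp p + vtp q"
  unfolding vtp_def map_poly_pderiv_add pderiv_add by (simp only: distrib_left add_ac)

lemma vtp_mult: "vtp (p * q) = vtp p * q + p * vtp q"
  unfolding vtp_def map_poly_pderiv_mult pderiv_mult' by (simp only: distrib_left distrib_right mult_ac add_ac)

lemma vtp_const: "vtp [:[:c:]:] = 0"
  by (simp add: vtp_def map_poly_pCons pderiv_pCons)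

lemma vtp_pu: "vtp pu = 6 * pv" and vtp_pv: "vtp pv = [:[:1/3:]:] * pu ^ 2"
proof -
  have [simp]: "map_poly pderiv (1 :: quv) = 0" by (simp add: one_pCons map_poly_pCons)
  have "map_poly pderiv pu = 1" "pderiv pu = 0" "map_poly pderiv pv = 0" "pderiv pv = 1"
    by (simp_all add: pu_def pv_def map_poly_pCons pderiv_pCons pderiv_1 one_pCons [symmetric])
  then show "vtp pu = 6 * pv" "vtp pv = [:[:1/3:]:] * pu ^ 2"
    unfolding vtp_def by (simp_all only: mult_zero_right mult_1_right add_0_left add_0_right)
qed

text \<open>The discrepancy between \<open>q d/dq\<close> and \<open>vt\<close> is a derivation, and Ramanujan's equations say that it
  multiplies the generators by their weight, up to the factor \<open>E / 12\<close>.\<close>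

lemma theta_peval:
  assumes "wts p \<subseteq> {m}"
  shows "theta (peval p) = peval (vtp p) + fps_const (of_int m / 12) * (fE * peval p)"
proof -
  define \<delta> where "\<delta> p = theta (peval p) - peval (vtp p)" for p
  have mult: "\<delta> (p * q) = \<delta> p * peval q + peval p * \<delta> q" for p q
    by (simp add: \<delta>_def series_eval.hom_eval_mult vtp_mult series_eval.hom_eval_add algebra_simps)
  have const: "\<delta> [:[:c:]:] = 0" for c
    by (simp only: \<delta>_def vtp_const series_eval.hom_eval_const series_eval.hom_eval_0) simp
  have u: "\<delta> pu = fps_const (1 / 3) * (fE * fU)"
    unfolding \<delta>_def vtp_pu series_eval.hom_eval_mult series_eval.hom_eval_numeral series_eval.hom_eval_pu series_eval.hom_eval_pv
    by (simp only: ramanujan_fU) simp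
  have "fps_const (of_rat (1 / 3)) = fps_const (1 / 3 :: complex)" by (simp add: of_rat_divide)
  then have v: "\<delta> pv = fps_const (1 / 2) * (fE * fV)"
    unfolding \<delta>_def vtp_pv series_eval.hom_eval_mult series_eval.hom_eval_power series_eval.hom_eval_const series_eval.hom_eval_pu series_eval.hom_eval_pv
    by (simp only: ramanujan_fV) simp
  have pow: "\<delta> (x ^ k) = fps_const (of_nat k * c) * (fE * peval (x ^ k))"
    if "\<delta> x = fps_const c * (fE * peval x)" for x c k
  proof (induction k)
    case 0
    then show ?case using const[of 1] by (simp add: one_pCons)
  next
    case (Suc k)
    have "fps_const (of_nat (Suc k) * c) = fps_const c + fps_const (of_nat k * c)"
      by (simp add: algebra_simps)
    then show ?case
      unfolding power_Suc mult series_eval.hom_eval_mult that Suc by (simp only: algebra_simps)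
  qed
  have on_monom: "\<delta> (monom (monom c i) j) =
      fps_const (of_int (4 * int i + 6 * int j) / 12) * (fE * peval (monom (monom c i) j))" for c i j
  proof -
    have 1: "\<delta> (pu ^ i) = fps_const (of_nat i * (1 / 3)) * (fE * peval (pu ^ i))"
      by (rule pow) (simp add: u series_eval.hom_eval_pu)
    have 2: "\<delta> (pv ^ j) = fps_const (of_nat j * (1 / 2)) * (fE * peval (pv ^ j))"
      by (rule pow) (simp add: v series_eval.hom_eval_pv)
    have "fps_const (of_int (4 * int i + 6 * int j) / 12 :: complex)
        = fps_const (of_nat i * (1 / 3)) + fps_const (of_nat j * (1 / 2))"
      by (simp add: field_simps)
    then show ?thesis
      unfolding monom_monom_eq mult const 1 2 series_eval.hom_eval_mult
      by (simp only: algebra_simps) (simp add: mult_ac)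
  qed
  have w: "4 * int i + 6 * int j = m" if "coeff (coeff p j) i \<noteq> 0" for i j
    using wtsI[OF that] assms by auto
  have "\<delta> p = fps_const (of_int m / 12) * (fE * peval p)"
  proof (induction p rule: quv_monomial_induct)
    case zero
    show ?case using const[of 0] by simp
  next
    case (add a b)
    then show ?case by (simp add: \<delta>_def series_eval.hom_eval_add vtp_add algebra_simps)
  next
    case (monom i j)
    then show ?case using on_monom[of "coeff (coeff p j) i" i j] unfolding w[OF monom] by simp
  qed
  then show ?thesis by (simp add: \<delta>_def algebra_simps)
qed

lemma euler_identity:
  assumes "wts p \<subseteq> {m}"
  shows "4 * pu * map_poly pderiv p + 6 * pv * pderiv p = of_int m * p"
proof -
  define \<epsilon> where "\<epsilon> p = 4 * pu * map_poly pderiv p + 6 * pv * pderiv p" for p :: quv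
  have mult: "\<epsilon> (p * q) = \<epsilon> p * q + p * \<epsilon> q" for p q
    unfolding \<epsilon>_def map_poly_pderiv_mult pderiv_mult' by (simp only: distrib_left distrib_right mult_ac add_ac)
  have plus: "\<epsilon> (p + q) = \<epsilon> p + \<epsilon> q" for p q
    unfolding \<epsilon>_def map_poly_pderiv_add pderiv_add by (simp only: distrib_left add_ac)
  have [simp]: "map_poly pderiv (1 :: quv) = 0" by (simp add: one_pCons map_poly_pCons)
  have const: "\<epsilon> [:[:c:]:] = 0" for c
    by (simp add: \<epsilon>_def map_poly_pCons pderiv_pCons)
  have "map_poly pderiv pu = 1" "pderiv pu = 0" "map_poly pderiv pv = 0" "pderiv pv = 1"
    by (simp_all add: pu_def pv_def map_poly_pCons pderiv_pCons pderiv_1 one_pCons [symmetric])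
  then have u: "\<epsilon> pu = of_nat 4 * pu" and v: "\<epsilon> pv = of_nat 6 * pv"
    unfolding \<epsilon>_def by (simp_all only: mult_zero_right mult_1_right add_0_left add_0_right of_nat_numeral)
  have pow: "\<epsilon> (x ^ k) = of_nat (k * c) * x ^ k" if "\<epsilon> x = of_nat c * x" for x c k
  proof (induction k)
    case 0
    then show ?case using const[of 1] by (simp add: one_pCons)
  next
    case (Suc k)
    then show ?case unfolding power_Suc mult that Suc by (simp add: algebra_simps)
  qed
  have on_monom: "\<epsilon> (monom (monom c i) j) = of_nat (i * 4 + j * 6) * monom (monom c i) j" for c i j
    unfolding monom_monom_eq mult const pow[OF u] pow[OF v] of_nat_add
    by (simp only: algebra_simps mult_zero_left mult_zero_right add_0_left)
  have w: "int (i * 4 + j * 6) = m" if "coeff (coeff p j) i \<noteq> 0" for i j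
    using wtsI[OF that] assms by auto
  have "\<epsilon> p = of_int m * p"
  proof (induction p rule: quv_monomial_induct)
    case zero
    show ?case using const[of 0] by simp
  next
    case (add a b)
    then show ?case by (simp only: plus distrib_left)
  next
    case (monom i j)
    then show ?case
      unfolding on_monom w[OF monom, symmetric] of_int_of_nat_eq by simp
  qed
  then show ?thesis by (simp add: \<epsilon>_def)
qed

lemma wts_empty: "wts p = {} \<Longrightarrow> p = 0"
  by (intro poly_eqI) (auto simp: wts_def)

lemma wts_nonneg: "w \<in> wts p \<Longrightarrow> w \<ge> 0"
  by (auto simp: wts_def)

text \<open>Cramer's rule; \<open>c\<close> stands for one third.\<close>

lemma weighted_system:
  fixes U V x y c :: "'a::comm_ring_1"
  assumes c: "3 * c = 1" and 1: "6 * V * x + c * U ^ 2 * y = 0" and 2: "4 * U * x + 6 * V * y = 0"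
  shows "4 * ((U ^ 3 - 27 * V ^ 2) * x) = 0" "4 * ((U ^ 3 - 27 * V ^ 2) * y) = 0"
proof -
  have "4 * ((U ^ 3 - 27 * V ^ 2) * x) = U ^ 2 * (4 * U * x + 6 * V * y)
      - 18 * V * (6 * V * x + c * U ^ 2 * y) - 6 * V * U ^ 2 * y * (1 - 3 * c)"
    by (simp add: algebra_simps power2_eq_square power3_eq_cube)
  then show "4 * ((U ^ 3 - 27 * V ^ 2) * x) = 0" unfolding c 1 2 by simp
  have "4 * ((U ^ 3 - 27 * V ^ 2) * y) = 12 * U * (6 * V * x + c * U ^ 2 * y)
      - 18 * V * (4 * U * x + 6 * V * y) + 4 * U ^ 3 * y * (1 - 3 * c)"
    by (simp add: algebra_simps power2_eq_square power3_eq_cube)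
  then show "4 * ((U ^ 3 - 27 * V ^ 2) * y) = 0" unfolding c 1 2 by simp
qed

text \<open>A relation of minimal weight would, by the two derivations, give relations for both partial
  derivatives, the determinant of the linear system being a multiple of the discriminant.\<close>

theorem peval_injective:
  assumes "wts p \<subseteq> {m}" "peval p = 0" shows "p = 0"
  using assms
proof (induction "nat m" arbitrary: m p rule: less_induct)
  case less
  note p = less.prems
  define x y where "x = map_poly pderiv p" and "y = pderiv p"
  have wx: "wts x \<subseteq> {m - 4}" and wy: "wts y \<subseteq> {m - 6}"
    using wts_Du[of p] wts_Dv[of p] p(1) by (auto simp: x_def y_def)
  have 1: "6 * fV * peval x + fps_const (1 / 3) * fU ^ 2 * peval y = 0"
  proof -
    have "peval (vtp p) = 0" using theta_peval[OF p(1)] p(2) by simp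
    moreover have "fps_const (of_rat (1 / 3)) = fps_const (1 / 3 :: complex)" by (simp add: of_rat_divide)
    ultimately show ?thesis
      unfolding vtp_def x_def [symmetric] y_def [symmetric] series_eval.hom_eval_add series_eval.hom_eval_mult series_eval.hom_eval_power
        series_eval.hom_eval_numeral series_eval.hom_eval_pu series_eval.hom_eval_pv series_eval.hom_eval_const by simp
  qed
  have 2: "4 * fU * peval x + 6 * fV * peval y = 0"
  proof -
    have "peval (4 * pu * x + 6 * pv * y) = peval (of_int m * p)"
      unfolding x_def y_def euler_identity[OF p(1)] ..
    also have "\<dots> = 0" by (simp only: series_eval.hom_eval_mult p(2) mult_zero_right)
    finally show ?thesis
      by (simp only: series_eval.hom_eval_add series_eval.hom_eval_mult series_eval.hom_eval_numeral series_eval.hom_eval_pu series_eval.hom_eval_pv)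
  qed
  have "3 * fps_const (1 / 3 :: complex) = 1" by (simp add: numeral_fps_const)
  from weighted_system[OF this 1 2] have det: "fDelta * peval x = 0" "fDelta * peval y = 0"
    by (simp_all add: fDelta_def)
  have zero: "q = 0" if q: "wts q \<subseteq> {m - int k}" "peval q = 0" "k > 0" for q k
  proof (cases "m - int k \<ge> 0")
    case True
    then show ?thesis using less.hyps[of "m - int k" q] q by auto
  next
    case False
    then have "wts q = {}" using q(1) wts_nonneg[of _ q] by fastforce
    then show ?thesis by (rule wts_empty)
  qed
  have "x = 0" "y = 0"
    using zero[of x 4] zero[of y 6] wx wy det by auto
  then have "pderiv p = 0" "map_poly pderiv p = 0" by (simp_all add: x_def y_def)
  then obtain a where a: "p = [:a:]" by (metis pderiv_iszero)
  then have "pderiv a = 0" using \<open>map_poly pderiv p = 0\<close> by (simp add: map_poly_pCons split: if_splits)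
  then obtain c where "a = [:c:]" by (metis pderiv_iszero)
  with a p(2) have "fps_const (of_rat c :: complex) = 0" by (simp add: series_eval.hom_eval_const)
  then show ?case using a \<open>a = [:c:]\<close> by simp
qed

section \<open>Weakly holomorphic modular forms and the coordinate ring\<close>

lemma qval_fU_eisenstein:
  assumes z: "Im z > 0"
  shows "qval fU z = 20 * eisenstein 2 z" and "qval fV z = 7 / 3 * eisenstein 3 z"
proof -
  have B: "bernoulli_number 1 = - 1 / 2" "bernoulli_number 2 = 1 / 6" "bernoulli_number 3 = 0"
    "bernoulli_number 4 = - 1 / 30" "bernoulli_number 5 = 0" "bernoulli_number 6 = 1 / 42"
    by (simp_all add: eval_nat_numeral atMost_Suc)
  have S: "(\<Sum>m. of_nat (\<Sum>d | d dvd Suc m. d ^ j) * nome z ^ Suc m) = qval (divisor_series j) z" for j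
  proof -
    have "(\<lambda>n. fps_nth (divisor_series j) n * nome z ^ n) sums qval (divisor_series j) z"
      by (intro sums_eval_fps ratfpsD[OF ratfps_divisor_series norm_nome_less_1[OF z]])
    then have "(\<lambda>n. fps_nth (divisor_series j) (Suc n) * nome z ^ Suc n) sums
        (qval (divisor_series j) z - fps_nth (divisor_series j) 0 * nome z ^ 0)"
      by (subst sums_Suc_iff) simp
    then show ?thesis by (simp add: divisor_series_def sums_iff del: power_Suc)
  qed
  have "eisenstein 2 z = 1 / 240 + qval (divisor_series 3) z"
    using S[of 3] by (simp add: eisenstein_def B(4) of_rat_divide of_rat_minus)
  then show "qval fU z = 20 * eisenstein 2 z" by (simp add: qval_fU[OF z])
  have "eisenstein 3 z = - 1 / 504 + qval (divisor_series 5) z"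
    using S[of 5] by (simp add: eisenstein_def B(6) of_rat_divide of_rat_minus)
  then show "qval fV z = 7 / 3 * eisenstein 3 z" by (simp add: qval_fV[OF z])
qed

text \<open>The value of the relation \<open>substitution\<close> at an element of \<open>OX\<close>, unique by \<open>quotient_form_cong\<close> below.\<close>

definition form_of :: "kuv \<Rightarrow> complex \<Rightarrow> complex" where
  "form_of a = (THE f. substitution a f)"

definition quotient_form :: "quv \<Rightarrow> nat \<Rightarrow> complex \<Rightarrow> complex" where
  "quotient_form p k = (\<lambda>z. if Im z > 0 then qval (peval p) z / qval fDelta z ^ k else 0)"

lemma substitution_iff:
  "substitution a f \<longleftrightarrow> (\<exists>p k. a = to_fract p / Delta ^ k \<and> f = quotient_form p k)"
proof -
  have "(\<lambda>z. if Im z > 0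
               then eval_uv p (20 * eisenstein 2 z) (7/3 * eisenstein 3 z) /
                    eval_uv pDelta (20 * eisenstein 2 z) (7/3 * eisenstein 3 z) ^ k
               else 0) = quotient_form p k" for p k
    unfolding quotient_form_def peval_pDelta [symmetric]
    by (rule ext) (simp add: qval_peval qval_fU_eisenstein)
  then show ?thesis by (simp only: substitution_def Fract_pDelta)
qed

lemma quotient_form_cong:
  assumes "to_fract p / Delta ^ k = to_fract p' / Delta ^ k'" shows "quotient_form p k = quotient_form p' k'"
proof
  fix z
  have "to_fract p * Delta ^ k' = to_fract p' * Delta ^ k"
    using assms by (simp add: field_simps)
  then have "p * pDelta ^ k' = p' * pDelta ^ k"
    unfolding Delta_eq to_fract_power [symmetric] to_fract_mult [symmetric] by (simp only: to_fract_eq_iff)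
  then have "peval p * fDelta ^ k' = peval p' * fDelta ^ k"
    by (metis series_eval.hom_eval_mult series_eval.hom_eval_power peval_pDelta)
  then have *: "qval (peval p * fDelta ^ k') z = qval (peval p' * fDelta ^ k) z" by simp
  show "quotient_form p k z = quotient_form p' k' z"
  proof (cases "Im z > 0")
    case True
    then have "qval (peval p) z * qval fDelta z ^ k' = qval (peval p') z * qval fDelta z ^ k"
      using * by (simp add: qval_simps qval_power ratfps_peval ratfps_fDelta ratfps_power)
    then show ?thesis
      using True qval_fDelta_nonzero[of z] by (simp add: quotient_form_def field_simps)
  qed (simp add: quotient_form_def)
qed

lemma form_of_eq: "form_of (to_fract p / Delta ^ k) = quotient_form p k"
  unfolding form_of_def substitution_iff
proof (rule the_equality)
  fix f assume "\<exists>pa ka. to_fract p / Delta ^ k = to_fract pa / Delta ^ ka \<and> f = quotient_form pa ka"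
  then show "f = quotient_form p k" using quotient_form_cong by metis
qed blast

lemma substitution_form_of: "substitution a f \<longleftrightarrow> a \<in> OX \<and> f = form_of a"
  unfolding substitution_iff OX_eq graded_def using form_of_eq by auto

lemma form_of_outside: "a \<in> OX \<Longrightarrow> Im z \<le> 0 \<Longrightarrow> form_of a z = 0"
  unfolding OX_eq graded_def by (auto simp: form_of_eq quotient_form_def)

lemma form_of_add: "a \<in> OX \<Longrightarrow> b \<in> OX \<Longrightarrow> form_of (a + b) z = form_of a z + form_of b z"
  and form_of_mult: "a \<in> OX \<Longrightarrow> b \<in> OX \<Longrightarrow> form_of (a * b) z = form_of a z * form_of b z"
proof -
  assume "a \<in> OX" "b \<in> OX"
  then obtain p k q l where ab: "a = to_fract p / Delta ^ k" "b = to_fract q / Delta ^ l"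
    unfolding OX_eq graded_def by blast
  have 1: "form_of a z = quotient_form p k z" "form_of b z = quotient_form q l z"
    by (simp_all add: ab form_of_eq)
  have "a + b = to_fract (p * pDelta ^ l + q * pDelta ^ k) / Delta ^ (k + l)"
    by (simp add: ab Delta_eq to_fract_power field_simps power_add)
  then have "form_of (a + b) z = quotient_form (p * pDelta ^ l + q * pDelta ^ k) (k + l) z"
    by (simp only: form_of_eq)
  then show "form_of (a + b) z = form_of a z + form_of b z"
    using qval_fDelta_nonzero[of z]
    by (simp add: 1 quotient_form_def series_eval.hom_eval_add series_eval.hom_eval_mult series_eval.hom_eval_power
        peval_pDelta qval_simps qval_power ratfps_peval ratfps_fDelta ratfps_power ratfps_mult field_simps power_add)
  have "a * b = to_fract (p * q) / Delta ^ (k + l)"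
    by (simp add: ab power_add)
  then have "form_of (a * b) z = quotient_form (p * q) (k + l) z"
    by (simp only: form_of_eq)
  then show "form_of (a * b) z = form_of a z * form_of b z"
    by (simp add: 1 quotient_form_def series_eval.hom_eval_mult qval_simps ratfps_peval power_add)
qed

lemma form_of_const: "Im z > 0 \<Longrightarrow> form_of (rat_const c) z = of_rat c"
  using form_of_eq[of "[:[:c:]:]" 0] by (simp add: rat_const_eq quotient_form_def series_eval.hom_eval_const)

lemma form_of_scale: "a \<in> OX \<Longrightarrow> form_of (rat_const c * a) z = of_rat c * form_of a z"
  by (cases "Im z > 0") (auto simp: form_of_mult form_of_const form_of_outside OX_mult)

lemma form_of_0 [simp]: "form_of 0 z = 0"
  using form_of_scale[of 0 0 z] by simp

lemma form_of_of_nat: "a \<in> OX \<Longrightarrow> form_of (of_nat k * a) z = of_nat k * form_of a z"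
  using form_of_scale[of a "of_nat k"] by (simp add: rat_const_of_nat)

lemma form_of_uminus: "a \<in> OX \<Longrightarrow> form_of (- a) z = - form_of a z"
  using form_of_scale[of a "- 1"] by (simp add: rat_const_minus of_rat_minus)

lemma form_of_Xu: "Im z > 0 \<Longrightarrow> form_of Xu z = qval fU z"
  using form_of_eq[of pu 0] by (simp add: Xu_eq quotient_form_def series_eval.hom_eval_pu)

lemma gr_OX: "a \<in> gr m \<Longrightarrow> a \<in> OX"
  unfolding gr_eq by (rule graded_OX)

lemma gr_obtain:
  assumes "a \<in> gr m" obtains p k where "a = to_fract p / Delta ^ k" "wts p \<subseteq> {m + 12 * int k}"
  using assms unfolding gr_eq by (elim gradedE) (auto simp: algebra_simps intro!: that)

text \<open>The numerator is homogeneous, so that \<open>peval_injective\<close> applies to it.\<close>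

lemma form_of_eq_0D:
  assumes "a \<in> gr m" "\<And>z. Im z > 0 \<Longrightarrow> form_of a z = 0" shows "a = 0"
proof -
  obtain p k where p: "a = to_fract p / Delta ^ k" "wts p \<subseteq> {m + 12 * int k}"
    by (rule gr_obtain[OF assms(1)])
  have "peval p = 0"
  proof (rule ratfps_eqI)
    fix z :: complex assume z: "Im z > 0"
    then show "qval (peval p) z = qval 0 z"
      using assms(2)[OF z] qval_fDelta_nonzero[OF z] by (simp add: p(1) form_of_eq quotient_form_def)
  qed (simp_all add: ratfps_peval)
  from peval_injective[OF p(2) this] show ?thesis using p(1) by simp
qed

lemma form_of_inj: "a \<in> gr m \<Longrightarrow> b \<in> gr m \<Longrightarrow> form_of a = form_of b \<Longrightarrow> a = b"
proof -
  assume ab: "a \<in> gr m" "b \<in> gr m" "form_of a = form_of b"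
  then have "a - b \<in> gr m" by (simp add: gr_eq graded_diff)
  moreover have "form_of (a - b) z = 0" for z
    using form_of_add[of a "- b" z] form_of_uminus[of b z] ab by (simp add: gr_OX OX_uminus)
  ultimately have "a - b = 0" using form_of_eq_0D by blast
  then show "a = b" by simp
qed

lemma hom_eval_scaling:
  fixes t x y :: complex
  assumes p: "wts p \<subseteq> {r}" and t: "t \<noteq> 0"
  shows "hom_eval of_rat (t ^ 4 * x) (t ^ 6 * y) p = t powi r * hom_eval of_rat x y p"
proof (induction p rule: quv_monomial_induct)
  case (monom i j)
  have r: "r = int (4 * i + 6 * j)"
    using subsetD[OF p wtsI[OF monom]] by simp
  have "t powi r = (t ^ 4) ^ i * (t ^ 6) ^ j"
    unfolding r power_int_of_nat power_add power_mult ..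
  then show ?case
    by (simp only: complex_eval.hom_eval_monom power_mult_distrib mult_ac)
next
  case (add a b)
  then show ?case by (simp only: complex_eval.hom_eval_add distrib_left)
qed simp

text \<open>A homogeneous function that vanishes on \<open>Z\<close> vanishes wherever \<open>\<Delta>\<close> does not, because every such point
  can be scaled into \<open>Z\<close>. It is enough to test the points whose coordinates are values of the Eisenstein
  series, by \<open>peval_injective\<close>.\<close>

theorem gr_J_zero:
  assumes a: "a \<in> gr r" "a \<in> J" shows "a = 0"
proof -
  obtain p k where p: "a = to_fract p / Delta ^ k" "wts p \<subseteq> {r + 12 * int k}"
    by (rule gr_obtain[OF a(1)])
  obtain c where "a = (Delta - 1) * c" "c \<in> OX" using a(2) by (auto simp: J_def)
  then obtain q l where q: "a = (Delta - 1) * (to_fract q / Delta ^ l)"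
    unfolding OX_eq graded_def by blast
  have "to_fract p * Delta ^ l = (Delta - 1) * to_fract q * Delta ^ k"
    using p(1) q by (simp add: field_simps)
  then have "to_fract (p * pDelta ^ l) = to_fract ((pDelta - 1) * q * pDelta ^ k)"
    by (simp add: Delta_eq to_fract_power)
  then have eq: "p * pDelta ^ l = (pDelta - 1) * q * pDelta ^ k" by (simp only: to_fract_eq_iff)
  have "peval p = 0"
  proof (rule ratfps_eqI)
    fix z :: complex assume z: "Im z > 0"
    \<comment> \<open>scaling by \<open>t\<close> with \<open>t\<^sup>1\<^sup>2 = 1 / \<delta>\<close> moves the point \<open>(x, y)\<close> to a point of \<open>Z\<close>\<close>
    define x y where "x = qval fU z" and "y = qval fV z"
    define \<delta> where "\<delta> = x ^ 3 - 27 * y ^ 2"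
    have \<delta>: "\<delta> = qval fDelta z"
      using qval_peval[OF z, of pDelta] by (simp add: peval_pDelta eval_uv_eq complex_eval.hom_eval_pDelta \<delta>_def x_def y_def)
    define t where "t = exp (- Ln \<delta> / 12)"
    have "t ^ 12 = exp (- Ln \<delta>)" by (simp add: t_def exp_of_nat_mult [symmetric])
    then have t: "t ^ 12 * \<delta> = 1" "t \<noteq> 0"
      using qval_fDelta_nonzero[OF z] by (simp_all add: \<delta> exp_minus t_def)
    have D: "hom_eval of_rat (t ^ 4 * x) (t ^ 6 * y) pDelta = 1"
    proof -
      have "hom_eval of_rat (t ^ 4 * x) (t ^ 6 * y) pDelta = t ^ 12 * \<delta>"
        by (simp add: complex_eval.hom_eval_pDelta \<delta>_def power_mult_distrib power_mult [symmetric] algebra_simps)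
      then show ?thesis using t by simp
    qed
    have "hom_eval of_rat (t ^ 4 * x) (t ^ 6 * y) p = t powi (r + 12 * int k) * hom_eval of_rat x y p"
      by (rule hom_eval_scaling[OF p(2) t(2)])
    moreover have "hom_eval of_rat (t ^ 4 * x) (t ^ 6 * y) p = 0"
      using arg_cong[OF eq, of "hom_eval of_rat (t ^ 4 * x) (t ^ 6 * y)"]
      by (simp add: complex_eval.hom_eval_mult complex_eval.hom_eval_power complex_eval.hom_eval_diff D)
    ultimately have "hom_eval of_rat x y p = 0" using t(2) by simp
    then show "qval (peval p) z = qval 0 z"
      using qval_peval[OF z, of p] by (simp add: eval_uv_eq x_def y_def)
  qed (simp_all add: ratfps_peval)
  from peval_injective[OF p(2) this] show ?thesis using p(1) by simp
qed

subsection \<open>The identification of the graded pieces\<close>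

lemma power_int_weight:
  fixes w :: complex assumes "w \<noteq> 0" shows "w powi (m + 12 * int k) = w powi m * (w ^ 12) ^ k"
proof -
  have "w powi (m + int (12 * k)) = w powi m * w ^ (12 * k)"
    using assms by (subst power_int_add) (simp_all only: power_int_of_nat not_False_eq_True simp_thms)
  then show ?thesis by (simp add: power_mult)
qed

lemma holomorphic_on_qval: "F \<in> ratfps \<Longrightarrow> qval F holomorphic_on {z. Im z > 0}"
  using has_field_derivative_qval by (auto simp: holomorphic_on_open[OF open_upper])

text \<open>Modularity and holomorphy are inherited from numerator and denominator; the discriminant being \<open>q\<close> times an
  invertible series, the pole at the cusp has order at most \<open>k\<close>.\<close>

lemma form_of_wh:
  assumes "a \<in> gr m" shows "form_of a \<in> wh_modular_forms m"
proof -
  obtain p k where p: "a = to_fract p / Delta ^ k" "wts p \<subseteq> {m + 12 * int k}"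
    by (rule gr_obtain[OF assms])
  define F where "F = peval p * inverse fDelta1 ^ k"
  have F: "F \<in> ratfps"
    unfolding F_def by (intro ratfps_mult ratfps_power ratfps_peval ratfps_inverse_fDelta1)
  have val: "form_of a z = qval (peval p) z / qval fDelta z ^ k" if "Im z > 0" for z
    using that by (simp add: p(1) form_of_eq quotient_form_def)
  have exp: "form_of a z = nome z powi (- int k) * qval F z" if z: "Im z > 0" for z
  proof -
    have "qval fDelta z = nome z * qval fDelta1 z"
      unfolding fDelta_eq using z by (simp add: qval_simps ratfps_fDelta1)
    moreover have "qval fDelta1 z * qval (inverse fDelta1) z = 1"
      using qval_simps(3)[OF z ratfps_fDelta1 ratfps_inverse_fDelta1] by (simp add: fDelta1_inverse)
    then have "qval (inverse fDelta1) z = 1 / qval fDelta1 z"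
      by (metis eq_divide_imp mult.commute mult_zero_left zero_neq_one)
    ultimately show ?thesis
      unfolding val[OF z] F_def using z
      by (simp add: qval_simps qval_power ratfps_peval ratfps_power ratfps_inverse_fDelta1
          power_int_minus power_divide power_mult_distrib field_simps)
  qed
  have "\<forall>n. \<exists>r. fps_nth F n = of_rat r"
    using F by (auto simp: ratfps_def elim: Rats_cases)
  then obtain r where r: "\<And>n. fps_nth F n = of_rat (r n)" by metis
  have sums: "(\<lambda>j::nat. of_rat (r (nat (int j - int k + int k))) * nome z powi (int j - int k)) sums form_of a z"
    if z: "Im z > 0" for z
  proof -
    have "(\<lambda>j. nome z powi (- int k) * (fps_nth F j * nome z ^ j)) sums (nome z powi (- int k) * qval F z)"
      by (intro sums_mult sums_eval_fps ratfpsD[OF F norm_nome_less_1[OF z]])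
    moreover have "nome z powi (- int k) * (fps_nth F j * nome z ^ j) =
        of_rat (r (nat (int j - int k + int k))) * nome z powi (int j - int k)" for j
      using power_int_add[of "nome z" "- int k" "int j"] by (simp add: r mult_ac)
    ultimately show ?thesis by (simp add: exp[OF z])
  qed
  have "(\<lambda>z. qval (peval p) z / qval fDelta z ^ k) holomorphic_on {z. Im z > 0}"
    by (intro holomorphic_on_divide holomorphic_on_power holomorphic_on_qval ratfps_peval ratfps_fDelta)
       (use qval_fDelta_nonzero in auto)
  then have hol: "form_of a holomorphic_on {z. Im z > 0}"
    by (rule holomorphic_transform) (simp add: val)
  have mod: "form_of a ((of_int a' * z + of_int b') / (of_int c' * z + of_int d')) =
      (of_int c' * z + of_int d') powi m * form_of a z"
    if det: "a' * d' - b' * c' = 1" and z: "Im z > 0" for a' b' c' d' :: int and z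
  proof -
    define w where "w = of_int c' * z + of_int d'"
    have w: "w \<noteq> 0" unfolding w_def by (rule automorphy_nonzero[OF det_nonzero[OF det] z])
    have "w powi (m + 12 * int k) = w powi m * (w ^ 12) ^ k"
      by (rule power_int_weight[OF w])
    moreover have "qval fDelta (moebius a' b' c' d' z) = w ^ 12 * qval fDelta z"
      using mformD[OF mform_fDelta det z] by (simp add: w_def)
    ultimately show ?thesis
      using mformD[OF mform_peval[OF p(2)] det z] w
      unfolding moebius_def [symmetric] val[OF z] val[OF Im_moebius_pos[OF det z]]
      by (simp add: w_def [symmetric] power_mult_distrib)
  qed
  show ?thesis
    unfolding wh_modular_forms_def
    using form_of_outside[OF gr_OX[OF assms]] hol mod sums
    by (intro CollectI conjI allI impI exI[of _ "int k"] exI[of _ "\<lambda>i. r (nat (i + int k))"]) auto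
qed

text \<open>A power of the discriminant removes the pole at the cusp. The product is a polynomial in the Eisenstein
  series by \<open>mform_eq_peval\<close>.\<close>

lemma wh_eq_form_of:
  assumes f: "f \<in> wh_modular_forms m" shows "\<exists>a\<in>gr m. form_of a = f"
proof -
  have out: "\<And>z. Im z \<le> 0 \<Longrightarrow> f z = 0"
    and mod: "\<And>a b c d z. a * d - b * c = 1 \<Longrightarrow> Im z > 0 \<Longrightarrow>
      f (moebius a b c d z) = (of_int c * z + of_int d) powi m * f z"
    using f unfolding wh_modular_forms_def moebius_def by auto
  obtain N :: int and r :: "int \<Rightarrow> rat" where
    r: "\<And>z. Im z > 0 \<Longrightarrow> (\<lambda>k::nat. of_rat (r (int k - N)) * nome z powi (int k - N)) sums f z"
    using f unfolding wh_modular_forms_def by blast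
  define G :: "complex fps" where "G = Abs_fps (\<lambda>k. of_rat (r (int k - N)))"
  have Gsums: "(\<lambda>k. fps_nth G k * nome z ^ k) sums (nome z powi N * f z)" if z: "Im z > 0" for z
  proof -
    have "(\<lambda>k. nome z powi N * (of_rat (r (int k - N)) * nome z powi (int k - N))) sums (nome z powi N * f z)"
      by (intro sums_mult r z)
    moreover have "nome z powi N * (of_rat (r (int k - N)) * nome z powi (int k - N)) = fps_nth G k * nome z ^ k" for k
      using power_int_add[of "nome z" N "int k - N"] by (simp add: G_def mult_ac)
    ultimately show ?thesis by simp
  qed
  have G: "G \<in> ratfps"
  proof -
    have "fps_conv_radius G \<ge> 1"
      unfolding fps_conv_radius_def
    proof (rule conv_radius_geI_ex')
      fix s :: real assume s: "0 < s" "ereal s < 1"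
      then have "complex_of_real s \<noteq> 0" "norm (complex_of_real s) < 1" by (auto simp: one_ereal_def)
      then obtain z where "Im z > 0" "nome z = of_real s" by (rule nome_surj)
      then show "summable (\<lambda>n. fps_nth G n * complex_of_real s ^ n)"
        using sums_summable[OF Gsums, of z] by simp
    qed
    then show ?thesis by (simp add: ratfps_def G_def)
  qed
  have Gval: "qval G z = nome z powi N * f z" if z: "Im z > 0" for z
    using sums_unique2[OF sums_eval_fps[OF ratfpsD[OF G norm_nome_less_1[OF z]]] Gsums[OF z]] .
  define F where "F = fps_X ^ nat (- N) * G"
  have F: "F \<in> ratfps" unfolding F_def by (intro ratfps_mult ratfps_power G) auto
  have Fval: "qval F z = nome z ^ nat N * f z" if z: "Im z > 0" for z
  proof -
    have "qval F z = nome z ^ nat (- N) * (nome z powi N * f z)"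
      unfolding F_def using z by (simp add: qval_simps qval_power G ratfps_power Gval)
    also have "\<dots> = nome z ^ nat N * f z"
      by (cases "N \<ge> 0") (simp_all add: power_int_def field_simps)
    finally show ?thesis .
  qed
  define k where "k = nat N"
  define H where "H = F * fDelta1 ^ k"
  have H: "H \<in> ratfps" unfolding H_def by (intro ratfps_mult ratfps_power F ratfps_fDelta1)
  have Hval: "qval H z = f z * qval fDelta z ^ k" if z: "Im z > 0" for z
  proof -
    have "qval fDelta z = nome z * qval fDelta1 z"
      unfolding fDelta_eq using z by (simp add: qval_simps ratfps_fDelta1)
    then show ?thesis
      unfolding H_def using z
      by (simp add: qval_simps qval_power F Fval ratfps_power ratfps_fDelta1 k_def power_mult_distrib mult_ac)
  qed
  have "mform (m + 12 * int k) H"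
    unfolding mform_def
  proof (intro conjI allI impI H)
    fix a b c d :: int and z assume det: "a * d - b * c = 1" and z: "Im z > 0"
    define w where "w = of_int c * z + of_int d"
    have w: "w \<noteq> 0" unfolding w_def by (rule automorphy_nonzero[OF det_nonzero[OF det] z])
    have "w powi (m + 12 * int k) = w powi m * (w ^ 12) ^ k"
      by (rule power_int_weight[OF w])
    moreover have "qval fDelta (moebius a b c d z) = w ^ 12 * qval fDelta z"
      using mformD[OF mform_fDelta det z] by (simp add: w_def)
    ultimately show "qval H (moebius a b c d z) = (of_int c * z + of_int d) powi (m + 12 * int k) * qval H z"
      unfolding Hval[OF z] Hval[OF Im_moebius_pos[OF det z]] mod[OF det z]
      by (simp add: w_def [symmetric] power_mult_distrib)
  qed
  then obtain p where p: "wts p \<subseteq> {m + 12 * int k}" "peval p = H"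
    using mform_eq_peval by blast
  have "to_fract p / Delta ^ k \<in> gr m"
    unfolding gr_eq by (rule gradedI) (use p(1) in auto)
  moreover have "form_of (to_fract p / Delta ^ k) = f"
  proof
    fix z show "form_of (to_fract p / Delta ^ k) z = f z"
      using qval_fDelta_nonzero[of z] out[of z]
      by (auto simp: form_of_eq quotient_form_def p(2) Hval)
  qed
  ultimately show ?thesis by blast
qed

lemma gr_of_form_form_of: "a \<in> gr m \<Longrightarrow> gr_of_form m (form_of a) = a"
  unfolding gr_of_form_def
  by (rule the_equality) (auto simp: substitution_form_of gr_OX dest: form_of_inj)

lemma gr_of_form:
  assumes "f \<in> wh_modular_forms m"
  shows "gr_of_form m f \<in> gr m" and "form_of (gr_of_form m f) = f"
  using wh_eq_form_of[OF assms] gr_of_form_form_of by auto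

text \<open>The numerator is covered by \<open>theta_peval\<close>. The logarithmic derivative of the denominator \<open>\<Delta>\<^sup>k\<close> is \<open>k E\<close>, in
  accordance with its weight \<open>12 k\<close>.\<close>

lemma form_of_derivative:
  assumes a: "a \<in> gr m" and z: "Im z > 0"
  shows "(form_of a has_field_derivative
      2 * of_real pi * \<i> * (form_of (vt a) z + of_int m / 12 * qval fE z * form_of a z)) (at z)"
proof -
  obtain p k where p: "a = to_fract p / Delta ^ k" "wts p \<subseteq> {m + 12 * int k}"
    by (rule gr_obtain[OF a])
  define P where "P = 2 * of_real pi * \<i>"
  define D E where "D = qval fDelta z" and "E = qval fE z"
  have D: "D \<noteq> 0" unfolding D_def by (rule qval_fDelta_nonzero[OF z])
  have c: "fps_const (of_int (m + 12 * int k) / 12 :: complex) \<in> ratfps" by (intro ratfps_const) auto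
  have dp: "(qval (peval p) has_field_derivative
      P * (qval (peval (vtp p)) z + of_int (m + 12 * int k) / 12 * (E * qval (peval p) z))) (at z)"
    using has_field_derivative_qval[OF z ratfps_peval, of p] z c
    unfolding theta_peval[OF p(2)] by (simp add: P_def E_def qval_simps ratfps_peval ratfps_mult ratfps_fE)
  have dD: "(qval fDelta has_field_derivative P * (E * D)) (at z)"
    using has_field_derivative_qval[OF z ratfps_fDelta] z
    unfolding theta_fDelta by (simp add: P_def E_def D_def qval_simps ratfps_fDelta ratfps_fE)
  have dDk: "((\<lambda>z. qval fDelta z ^ k) has_field_derivative of_nat k * (P * E) * D ^ k) (at z)"
    using DERIV_power[OF dD, of k] by (cases k) (simp_all add: D_def mult_ac)
  have "((\<lambda>z. qval (peval p) z / qval fDelta z ^ k) has_field_derivative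
      (P * (qval (peval (vtp p)) z + of_int (m + 12 * int k) / 12 * (E * qval (peval p) z)) * D ^ k
       - qval (peval p) z * (of_nat k * (P * E) * D ^ k)) / (D ^ k * D ^ k)) (at z)"
    using DERIV_divide[OF dp dDk] D by (simp add: D_def)
  also have "(P * (qval (peval (vtp p)) z + of_int (m + 12 * int k) / 12 * (E * qval (peval p) z)) * D ^ k
       - qval (peval p) z * (of_nat k * (P * E) * D ^ k)) / (D ^ k * D ^ k)
      = P * (qval (peval (vtp p)) z / D ^ k + of_int m / 12 * E * (qval (peval p) z / D ^ k))"
    using D by (simp add: field_simps)
  also have "qval (peval (vtp p)) z / D ^ k = form_of (vt a) z"
    using vt_Fract[of p k] z by (simp add: Fract_pDelta p(1) form_of_eq quotient_form_def D_def)
  also have "qval (peval p) z / D ^ k = form_of a z"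
    using z by (simp add: p(1) form_of_eq quotient_form_def D_def)
  finally have "((\<lambda>z. qval (peval p) z / qval fDelta z ^ k) has_field_derivative
      P * (form_of (vt a) z + of_int m / 12 * E * form_of a z)) (at z)" .
  then show ?thesis
    unfolding P_def E_def
    by (rule has_field_derivative_transform_within_open[OF _ open_upper])
       (use z in \<open>auto simp: p(1) form_of_eq quotient_form_def\<close>)
qed

section \<open>The connection in coordinates\<close>

abbreviation cf :: "sym \<Rightarrow> nat \<Rightarrow> nat \<Rightarrow> kuv" where
  "cf P i j \<equiv> coeff (coeff P j) i"

lemma sym_eqI: "(\<And>i j. cf P i j = cf Q i j) \<Longrightarrow> P = Q"
  by (intro poly_eqI)

lemma cf_scal [simp]: "cf (scal a * P) i j = a * cf P i j"
  by (simp add: scal_def)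

lemma cf_mult_S: "cf (P * (scal a * gS)) i j = (if i = 0 then 0 else a * cf P (i - 1) j)"
  by (cases i) (simp_all add: scal_def gS_def mult.commute)

lemma cf_mult_T: "cf (P * (scal a * gT)) i j = (if j = 0 then 0 else a * cf P i (j - 1))"
  by (cases j) (simp_all add: scal_def gT_def mult.commute)

lemma cf_dS: "cf (map_poly pderiv P) i j = of_nat (Suc i) * cf P (Suc i) j"
  by (simp add: coeff_map_poly coeff_pderiv)

lemma cf_dT: "cf (pderiv P) i j = of_nat (Suc j) * cf P i (Suc j)"
  by (simp add: coeff_pderiv of_nat_poly)

lemma cf_T_power [simp]: "cf (gT ^ n) i j = (if i = 0 \<and> j = n then 1 else 0)"
proof -
  have "gT ^ n = monom 1 n" by (simp add: gT_def monom_altdef)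
  then show ?thesis by simp
qed

text \<open>The contraction of the connection with a vector field that acts on functions by \<open>D\<close> and on
  which \<open>\<psi>\<close> and \<open>\<omega>\<close> take the values \<open>p\<close> and \<open>w\<close>.\<close>

definition nab :: "(kuv \<Rightarrow> kuv) \<Rightarrow> kuv \<Rightarrow> kuv \<Rightarrow> sym \<Rightarrow> sym" where
  "nab D p w P =
     map_poly (map_poly D) P
     + map_poly pderiv P * (scal p * gS - scal (Xu / 12 * w) * gT)
     + pderiv P * (scal w * gS - scal p * gT)"

lemma nabla_u_eq: "nabla_u = nab Du psi_u omega_u" and nabla_v_eq: "nabla_v = nab Dv psi_v omega_v"
  by (simp_all add: fun_eq_iff nabla_u_def nabla_v_def nab_def)

lemma cf_nab:
  assumes "D 0 = 0"
  shows "cf (nab D p w P) i j =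
    D (cf P i j) + (of_nat i - of_nat j) * p * cf P i j
    - (if j = 0 then 0 else Xu / 12 * w * (of_nat (Suc i) * cf P (Suc i) (j - 1)))
    + (if i = 0 then 0 else w * (of_nat (Suc j) * cf P (i - 1) (Suc j)))"
proof -
  have "cf (map_poly (map_poly D) P) i j = D (cf P i j)"
    by (simp add: coeff_map_poly assms)
  then show ?thesis
    unfolding nab_def right_diff_distrib coeff_add coeff_diff cf_mult_S cf_mult_T cf_dS cf_dT
    by (cases i; cases j) (simp_all add: algebra_simps)
qed

lemma VnI: "(\<And>i j. cf P i j \<in> OX) \<Longrightarrow> (\<And>i j. i + j \<noteq> n \<Longrightarrow> cf P i j = 0) \<Longrightarrow> P \<in> Vn n"
  by (auto simp: Vn_def)

lemma VnD: "P \<in> Vn n \<Longrightarrow> cf P i j \<in> OX" "P \<in> Vn n \<Longrightarrow> i + j \<noteq> n \<Longrightarrow> cf P i j = 0"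
  by (auto simp: Vn_def)

lemma Vn_0 [simp]: "0 \<in> Vn n"
  by (rule VnI) auto

lemma Vn_add: "P \<in> Vn n \<Longrightarrow> Q \<in> Vn n \<Longrightarrow> P + Q \<in> Vn n"
  by (rule VnI) (auto simp: VnD intro: OX_add)

lemma Vn_uminus: "P \<in> Vn n \<Longrightarrow> - P \<in> Vn n"
  by (rule VnI) (auto simp: VnD intro: OX_uminus)

lemma Vn_diff: "P \<in> Vn n \<Longrightarrow> Q \<in> Vn n \<Longrightarrow> P - Q \<in> Vn n"
  using Vn_add[of P n "- Q"] by (simp add: Vn_uminus)

lemma Vn_scal: "a \<in> OX \<Longrightarrow> P \<in> Vn n \<Longrightarrow> scal a * P \<in> Vn n"
  by (rule VnI) (auto simp: VnD intro: OX_mult)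

lemma Vn_T_power: "a \<in> OX \<Longrightarrow> scal a * gT ^ n \<in> Vn n"
  by (rule VnI) auto

lemma Vn_nab:
  assumes D0: "D 0 = 0" and D: "\<And>a. a \<in> OX \<Longrightarrow> D a \<in> OX" and p: "p \<in> OX" and w: "w \<in> OX" and P: "P \<in> Vn n"
  shows "nab D p w P \<in> Vn n"
proof (rule VnI)
  note [simp] = cf_nab[of D, OF D0]
  fix i j
  show "cf (nab D p w P) i j \<in> OX"
    using VnD(1)[OF P] p w by (auto intro!: OX_add OX_diff OX_mult D OX_divide_numeral)
  show "cf (nab D p w P) i j = 0" if "i + j \<noteq> n"
  proof -
    have "cf P i j = 0" "j \<noteq> 0 \<Longrightarrow> cf P (Suc i) (j - 1) = 0" "i \<noteq> 0 \<Longrightarrow> cf P (i - 1) (Suc j) = 0"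
      using VnD(2)[OF P] that by auto
    then show ?thesis by (auto simp: D0)
  qed
qed

lemma gr12_add: "a \<in> gr12 r \<Longrightarrow> b \<in> gr12 r \<Longrightarrow> a + b \<in> gr12 r"
  and gr12_diff: "a \<in> gr12 r \<Longrightarrow> b \<in> gr12 r \<Longrightarrow> a - b \<in> gr12 r"
  and gr12_0 [simp]: "0 \<in> gr12 r"
  and gr12_of_nat: "a \<in> gr12 r \<Longrightarrow> of_nat k * a \<in> gr12 r"
  and gr12_divide_numeral: "a \<in> gr12 r \<Longrightarrow> a / numeral l \<in> gr12 r"
  unfolding gr12_eq
  by (rule graded_add graded_diff graded_0 graded_of_nat graded_divide_of_nat graded_divide_numeral;
      assumption)+

lemma gr12_OX: "a \<in> gr12 r \<Longrightarrow> a \<in> OX"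
  unfolding gr12_eq by (rule graded_OX)

lemma gr_gr12: "a \<in> gr r \<Longrightarrow> a \<in> gr12 r"
  unfolding gr_eq gr12_eq by (erule graded_mono[rotated]) simp

lemma gr12_cong: "[r = s] (mod 12) \<Longrightarrow> gr12 r = gr12 s"
  unfolding gr12_eq by (metis (no_types, opaque_lifting) cong_trans cong_sym)

lemma gr12_mult: "a \<in> gr m \<Longrightarrow> b \<in> gr12 r \<Longrightarrow> a * b \<in> gr12 (m + r)"
  unfolding gr_eq gr12_eq by (erule graded_mult) (auto intro: cong_add)

lemma gr12_Du: "a \<in> gr12 r \<Longrightarrow> Du a \<in> gr12 (r - 4)"
  unfolding gr12_eq by (erule Du_graded) (auto intro: cong_diff)

lemma gr12_Dv: "a \<in> gr12 r \<Longrightarrow> Dv a \<in> gr12 (r - 6)"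
  unfolding gr12_eq by (erule Dv_graded) (auto intro: cong_diff)

lemma V12I: "P \<in> Vn n \<Longrightarrow> (\<And>i j. i + j = n \<Longrightarrow> cf P i j \<in> gr12 (r - int i + int j)) \<Longrightarrow> P \<in> V12 n r"
  unfolding V12_def using VnD(2)[of P n] by fastforce

lemma V12D: "P \<in> V12 n r \<Longrightarrow> P \<in> Vn n" "P \<in> V12 n r \<Longrightarrow> cf P i j \<in> gr12 (r - int i + int j)"
  by (auto simp: V12_def)

lemma V12_0 [simp]: "0 \<in> V12 n r"
  by (rule V12I) auto

lemma V12_add: "P \<in> V12 n r \<Longrightarrow> Q \<in> V12 n r \<Longrightarrow> P + Q \<in> V12 n r"
  by (rule V12I) (auto dest: V12D intro: Vn_add gr12_add)

lemma V12_scal: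
  assumes a: "a \<in> gr m" and P: "P \<in> V12 n r" and s: "[m + r = s] (mod 12)"
  shows "scal a * P \<in> V12 n s"
proof (rule V12I)
  show "scal a * P \<in> Vn n"
    using a P by (auto intro: Vn_scal graded_OX simp: gr_eq V12_def)
  fix i j
  have "[m + (r - int i + int j) = s - int i + int j] (mod 12)"
    using cong_add[OF cong_diff[OF s cong_refl[of "int i"]] cong_refl[of "int j"]]
    by (simp add: algebra_simps)
  then show "cf (scal a * P) i j \<in> gr12 (s - int i + int j)"
    using gr12_mult[OF a V12D(2)[OF P, where i = i and j = j]] gr12_cong by simp
qed

lemma V12_nab:
  assumes D0: "D 0 = 0" and D: "\<And>a r. a \<in> gr12 r \<Longrightarrow> D a \<in> gr12 (r - d)" "\<And>a. a \<in> OX \<Longrightarrow> D a \<in> OX"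
    and p: "p \<in> gr (- d)" and w: "w \<in> gr (- 2 - d)" and P: "P \<in> V12 n r"
  shows "nab D p w P \<in> V12 n (r - d)"
proof (rule V12I)
  show "nab D p w P \<in> Vn n"
    by (rule Vn_nab) (use D0 D p w P in \<open>auto simp: gr_eq V12_def dest: graded_OX\<close>)
  fix i j :: nat
  have 1: "D (cf P i j) \<in> gr12 (r - d - int i + int j)"
    using D(1)[OF V12D(2)[OF P, where i = i and j = j]] by (simp add: algebra_simps)
  have p': "p * cf P i j \<in> gr12 (r - d - int i + int j)"
    using gr12_mult[OF p V12D(2)[OF P, where i = i and j = j]] by (simp add: algebra_simps)
  have 2: "(of_nat i - of_nat j) * p * cf P i j \<in> gr12 (r - d - int i + int j)"
    using gr12_diff[OF gr12_of_nat[OF p', of i] gr12_of_nat[OF p', of j]] by (simp add: algebra_simps)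
  have "Xu * w \<in> gr (2 - d)"
    using w graded_mult[OF graded_Xu, of w "{- 2 - d}" "{2 - d}"] by (simp add: gr_eq)
  then have "Xu * w * cf P (Suc i) (j - 1) \<in> gr12 (2 - d + (r - int (Suc i) + int (j - 1)))"
    by (intro gr12_mult V12D(2)[OF P])
  then have "of_nat (Suc i) * (Xu * w * cf P (Suc i) (j - 1)) / 12
      \<in> gr12 (2 - d + (r - int (Suc i) + int (j - 1)))"
    by (intro gr12_divide_numeral gr12_of_nat)
  moreover have "of_nat (Suc i) * (Xu * w * c) / 12 = Xu / 12 * w * (of_nat (Suc i) * c)" for c
    by simp
  moreover have "2 - d + (r - int (Suc i) + int (j - 1)) = r - d - int i + int j" if "j \<noteq> 0"
    using that by (simp add: of_nat_diff)
  ultimately have 3: "Xu / 12 * w * (of_nat (Suc i) * cf P (Suc i) (j - 1)) \<in> gr12 (r - d - int i + int j)"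
    if "j \<noteq> 0"
    using that by metis
  have "w * cf P (i - 1) (Suc j) \<in> gr12 (- 2 - d + (r - int (i - 1) + int (Suc j)))"
    by (intro gr12_mult w V12D(2)[OF P])
  then have "of_nat (Suc j) * (w * cf P (i - 1) (Suc j)) \<in> gr12 (- 2 - d + (r - int (i - 1) + int (Suc j)))"
    by (rule gr12_of_nat)
  moreover have "- 2 - d + (r - int (i - 1) + int (Suc j)) = r - d - int i + int j" if "i \<noteq> 0"
    using that by (simp add: of_nat_diff)
  ultimately have 4: "w * (of_nat (Suc j) * cf P (i - 1) (Suc j)) \<in> gr12 (r - d - int i + int j)"
    if "i \<noteq> 0"
    using that by (metis mult.left_commute)
  show "cf (nab D p w P) i j \<in> gr12 (r - d - int i + int j)"
    unfolding cf_nab[of D, OF D0] using 3 4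
    by (intro gr12_add gr12_diff 1 2; simp split: if_splits)
qed

lemma psi_omega_gr: "psi_u \<in> gr (- 4)" "psi_v \<in> gr (- 6)" "omega_u \<in> gr (- 6)" "omega_v \<in> gr (- 8)"
proof -
  note D = graded_inverse_Delta
  have u2: "Xu ^ 2 * (1 / Delta) \<in> graded {- 4}"
    by (rule graded_mult[OF graded_power[OF graded_Xu] D]) auto
  have u: "Xu * (1 / Delta) \<in> graded {- 8}"
    by (rule graded_mult[OF graded_Xu D]) auto
  have v: "Xv * (1 / Delta) \<in> graded {- 6}"
    by (rule graded_mult[OF graded_Xv D]) auto
  have eq: "psi_u = Xu ^ 2 * (1 / Delta) / 4" "psi_v = - (54 * (Xv * (1 / Delta)) / 12)"
    "omega_u = - (9 * (Xv * (1 / Delta)) / 2)" "omega_v = 3 * (Xu * (1 / Delta))"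
    by (simp_all add: psi_u_eq psi_v_eq Du_Delta Dv_Delta omega_u_def omega_v_def field_simps)
  show "psi_u \<in> gr (- 4)" "psi_v \<in> gr (- 6)" "omega_u \<in> gr (- 6)" "omega_v \<in> gr (- 8)"
    unfolding gr_eq eq
    by (intro graded_divide_numeral graded_uminus graded_numeral u2 u v)+
qed

lemma psi_omega_OX [simp]: "psi_u \<in> OX" "psi_v \<in> OX" "omega_u \<in> OX" "omega_v \<in> OX"
  using psi_omega_gr by (auto simp: gr_eq dest: graded_OX)

lemma Vn_nabla: "P \<in> Vn n \<Longrightarrow> nabla_u P \<in> Vn n" "P \<in> Vn n \<Longrightarrow> nabla_v P \<in> Vn n"
  unfolding nabla_u_eq nabla_v_eq by (auto intro!: Vn_nab OX_derivations)

lemma V12_nabla: "P \<in> V12 n 0 \<Longrightarrow> nabla_u P \<in> V12 n (- 4)" "P \<in> V12 n 0 \<Longrightarrow> nabla_v P \<in> V12 n (- 6)"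
  using V12_nab[of Du 4 psi_u omega_u P n 0] V12_nab[of Dv 6 psi_v omega_v P n 0]
  by (auto simp: nabla_u_eq nabla_v_eq gr12_Du gr12_Dv OX_derivations psi_omega_gr)

section \<open>One-forms on Z\<close>

text \<open>Contraction with the vector field \<open>vt\<close>. On the curve \<open>Z\<close>, to which \<open>vt\<close> is tangent, it
  identifies one-forms with sections.\<close>

definition contract :: "sym \<times> sym \<Rightarrow> sym" where
  "contract = (\<lambda>(A, B). scal (6 * Xv) * A + scal (Xu ^ 2 / 3) * B)"

definition nabla_vt :: "sym \<Rightarrow> sym" where
  "nabla_vt = nab vt 0 1"

lemma vt_psi: "6 * Xv * psi_u + Xu ^ 2 / 3 * psi_v = 0"
  and vt_omega: "6 * Xv * omega_u + Xu ^ 2 / 3 * omega_v = 1"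
proof -
  show "6 * Xv * psi_u + Xu ^ 2 / 3 * psi_v = 0"
    by (simp add: psi_u_eq psi_v_eq Du_Delta Dv_Delta field_simps)
  have "6 * Xv * omega_u + Xu ^ 2 / 3 * omega_v = (Xu ^ 3 - 27 * Xv ^ 2) / Delta"
    by (simp add: omega_u_def omega_v_def field_simps power2_eq_square power3_eq_cube)
  then show "6 * Xv * omega_u + Xu ^ 2 / 3 * omega_v = 1"
    by (simp add: Delta_def [symmetric])
qed

lemma cf_nabla_vt: "cf (nabla_vt P) i j = vt (cf P i j)
    - (if j = 0 then 0 else Xu / 12 * (of_nat (Suc i) * cf P (Suc i) (j - 1)))
    + (if i = 0 then 0 else of_nat (Suc j) * cf P (i - 1) (Suc j))"
  unfolding nabla_vt_def by (subst cf_nab) simp_all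

lemma contract_nabla0: "contract (nabla0 P) = nabla_vt P"
proof (rule sym_eqI)
  fix i j
  define a b where "a = 6 * Xv" and "b = Xu ^ 2 / 3"
  have psi: "a * psi_u + b * psi_v = 0" and omega: "a * omega_u + b * omega_v = 1"
    using vt_psi vt_omega by (simp_all add: a_def b_def)
  define x y z where "x = (of_nat i - of_nat j) * cf P i j"
    and "y = (if j = 0 then 0 else Xu / 12 * (of_nat (Suc i) * cf P (Suc i) (j - 1)))"
    and "z = (if i = 0 then 0 else of_nat (Suc j) * cf P (i - 1) (Suc j))"
  have u: "cf (nabla_u P) i j = Du (cf P i j) + psi_u * x - omega_u * y + omega_u * z"
    unfolding nabla_u_eq by (subst cf_nab) (simp_all add: x_def y_def z_def)
  have v: "cf (nabla_v P) i j = Dv (cf P i j) + psi_v * x - omega_v * y + omega_v * z"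
    unfolding nabla_v_eq by (subst cf_nab) (simp_all add: x_def y_def z_def)
  have "cf (contract (nabla0 P)) i j = a * cf (nabla_u P) i j + b * cf (nabla_v P) i j"
    by (simp add: contract_def nabla0_def a_def b_def)
  also have "\<dots> = (a * Du (cf P i j) + b * Dv (cf P i j)) + (a * psi_u + b * psi_v) * x
      + (a * omega_u + b * omega_v) * (z - y)"
    unfolding u v by (simp add: algebra_simps)
  also have "\<dots> = vt (cf P i j) - y + z"
    unfolding psi omega by (simp add: vt_def a_def b_def)
  finally show "cf (contract (nabla0 P)) i j = cf (nabla_vt P) i j"
    by (simp add: cf_nabla_vt y_def z_def)
qed

lemma contract_add: "contract (x + y) = contract x + contract y"
  by (simp add: contract_def case_prod_beta algebra_simps)

lemma contract_diff: "contract (x - y) = contract x - contract y"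
  by (simp add: contract_def case_prod_beta algebra_simps)

lemma Vn_contract: "x \<in> Vn n \<times> Vn n \<Longrightarrow> contract x \<in> Vn n"
  by (auto simp: contract_def intro!: Vn_add Vn_scal OX_intros)

text \<open>The forms \<open>\<psi>\<close> and \<open>\<omega>\<close> are a basis, and \<open>d\<Delta> = 12 \<Delta> \<psi>\<close>. Modulo \<open>d\<Delta>\<close> only the component along \<open>\<omega>\<close> remains, which
  is the contraction with \<open>vt\<close>.\<close>

lemma I1_iff:
  assumes "x \<in> Vn n \<times> Vn n" shows "x \<in> I1 n \<longleftrightarrow> contract x \<in> I0 n"
proof
  assume "x \<in> I1 n"
  then obtain A B P where x: "x = (scal (Delta - 1) * A + scal (Du Delta) * P,
      scal (Delta - 1) * B + scal (Dv Delta) * P)" and V: "A \<in> Vn n" "B \<in> Vn n" "P \<in> Vn n"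
    unfolding I1_def by blast
  have "contract x = scal (Delta - 1) * contract (A, B)"
    by (rule sym_eqI, simp add: x contract_def Du_Delta Dv_Delta) (simp add: field_simps)
  moreover have "contract (A, B) \<in> Vn n" using V by (intro Vn_contract) auto
  ultimately show "contract x \<in> I0 n" unfolding I0_def by blast
next
  obtain A B where x: "x = (A, B)" and V: "A \<in> Vn n" "B \<in> Vn n" using assms by auto
  assume "contract x \<in> I0 n"
  then obtain R where R: "contract x = scal (Delta - 1) * R" "R \<in> Vn n" unfolding I0_def by blast
  \<comment> \<open>the \<open>\<psi>\<close>-component, the contraction with the Euler field\<close>
  define Q where "Q = scal (4 * Xu) * A + scal (6 * Xv) * B"
  define Q' where "Q' = scal (1 / (12 * Delta)) * Q"
  have "1 / Delta / 12 \<in> OX" by (intro OX_divide_numeral) simp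
  then have "1 / (12 * Delta) \<in> OX" by (simp add: mult.commute)
  then have Q': "Q' \<in> Vn n"
    unfolding Q'_def Q_def by (intro Vn_scal Vn_add V OX_intros) auto
  have *: "omega_u * (6 * Xv * s + Xu ^ 2 / 3 * t) + Du Delta * (1 / (12 * Delta) * (4 * Xu * s + 6 * Xv * t)) = s"
    "omega_v * (6 * Xv * s + Xu ^ 2 / 3 * t) + Dv Delta * (1 / (12 * Delta) * (4 * Xu * s + 6 * Xv * t)) = t"
    for s t
  proof -
    have "omega_u * (6 * Xv * s + Xu ^ 2 / 3 * t) + Du Delta * (1 / (12 * Delta) * (4 * Xu * s + 6 * Xv * t))
        = (Xu ^ 3 - 27 * Xv ^ 2) * s / Delta"
      by (simp add: omega_u_def Du_Delta field_simps power2_eq_square power3_eq_cube)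
    then show "omega_u * (6 * Xv * s + Xu ^ 2 / 3 * t) + Du Delta * (1 / (12 * Delta) * (4 * Xu * s + 6 * Xv * t)) = s"
      by (simp add: Delta_def [symmetric])
    have "omega_v * (6 * Xv * s + Xu ^ 2 / 3 * t) + Dv Delta * (1 / (12 * Delta) * (4 * Xu * s + 6 * Xv * t))
        = (Xu ^ 3 - 27 * Xv ^ 2) * t / Delta"
      by (simp add: omega_v_def Dv_Delta field_simps power2_eq_square power3_eq_cube)
    then show "omega_v * (6 * Xv * s + Xu ^ 2 / 3 * t) + Dv Delta * (1 / (12 * Delta) * (4 * Xu * s + 6 * Xv * t)) = t"
      by (simp add: Delta_def [symmetric])
  qed
  have R': "(Delta - 1) * cf R i j = 6 * Xv * cf A i j + Xu ^ 2 / 3 * cf B i j" for i j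
    using arg_cong[OF R(1), of "\<lambda>P. cf P i j"] by (simp add: contract_def x)
  have "A = scal (Delta - 1) * (scal omega_u * R) + scal (Du Delta) * Q'"
  proof (rule sym_eqI)
    fix i j
    have "cf (scal (Delta - 1) * (scal omega_u * R) + scal (Du Delta) * Q') i j =
        omega_u * ((Delta - 1) * cf R i j) + Du Delta * (1 / (12 * Delta) * (4 * Xu * cf A i j + 6 * Xv * cf B i j))"
      unfolding Q'_def Q_def coeff_add cf_scal by (simp only: mult.left_commute)
    also have "\<dots> = cf A i j"
      unfolding R' by (rule *(1))
    finally show "cf A i j = cf (scal (Delta - 1) * (scal omega_u * R) + scal (Du Delta) * Q') i j" ..
  qed
  moreover have "B = scal (Delta - 1) * (scal omega_v * R) + scal (Dv Delta) * Q'"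
  proof (rule sym_eqI)
    fix i j
    have "cf (scal (Delta - 1) * (scal omega_v * R) + scal (Dv Delta) * Q') i j =
        omega_v * ((Delta - 1) * cf R i j) + Dv Delta * (1 / (12 * Delta) * (4 * Xu * cf A i j + 6 * Xv * cf B i j))"
      unfolding Q'_def Q_def coeff_add cf_scal by (simp only: mult.left_commute)
    also have "\<dots> = cf B i j"
      unfolding R' by (rule *(2))
    finally show "cf B i j = cf (scal (Delta - 1) * (scal omega_v * R) + scal (Dv Delta) * Q') i j" ..
  qed
  ultimately show "x \<in> I1 n"
    unfolding I1_def x using Q' R(2) by (blast intro: Vn_scal psi_omega_OX)
qed

text \<open>By Euler's identity \<open>12 \<Delta> = 4 u \<partial>\<Delta>/\<partial>u + 6 v \<partial>\<Delta>/\<partial>v\<close>, the partial derivatives of \<open>\<Delta>\<close> generate the unit ideal.\<close>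

lemma I2_eq: "I2 n = Vn n"
proof
  show "I2 n \<subseteq> Vn n"
    unfolding I2_def by (auto intro!: Vn_add Vn_diff Vn_scal OX_intros)
  show "Vn n \<subseteq> I2 n"
  proof
    fix P assume P: "P \<in> Vn n"
    define A B where "A = scal (- (Xv / 2 / Delta)) * P" and "B = scal (Xu / 3 / Delta) * P"
    \<comment> \<open>Euler's identity divided by \<open>12 \<Delta>\<close>\<close>
    have "Du Delta * (Xu / 3 / Delta * a) + Dv Delta * (Xv / 2 / Delta * a) = a" for a
    proof -
      have "Du Delta * (Xu / 3 / Delta * a) + Dv Delta * (Xv / 2 / Delta * a) = (Xu ^ 3 - 27 * Xv ^ 2) * a / Delta"
        by (simp add: Du_Delta Dv_Delta field_simps power2_eq_square power3_eq_cube)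
      then show ?thesis by (simp add: Delta_def [symmetric])
    qed
    then have "P = scal (Delta - 1) * 0 + (scal (Du Delta) * B - scal (Dv Delta) * A)"
      by (intro sym_eqI) (simp add: A_def B_def)
    moreover have "A \<in> Vn n" "B \<in> Vn n"
      unfolding A_def B_def by (intro Vn_scal OX_intros P; simp)+
    ultimately show "P \<in> I2 n"
      unfolding I2_def using Vn_0[of n] by blast
  qed
qed

section \<open>Reduction to the coefficient of the lowest vector\<close>

text \<open>The equations that a section with coefficients \<open>c\<^sub>k\<close> at \<open>S\<^sup>n\<^sup>-\<^sup>k T\<^sup>k\<close> has to satisfy in order that its image under
  \<open>nabla_vt\<close> has the coefficient \<open>p i\<close> at \<open>S\<^sup>i T\<^sup>n\<^sup>-\<^sup>i\<close>, solved for \<open>c\<^sub>k\<close> in terms of the previous ones, with \<open>c\<close> the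
  coefficient of \<open>S\<^sup>n\<close>. The value at \<open>n + 1\<close> uses \<open>p 0\<close>: it is the discrepancy that remains at \<open>T\<^sup>n\<close>, divided by
  \<open>n + 1\<close>.\<close>

fun descend :: "nat \<Rightarrow> (nat \<Rightarrow> kuv) \<Rightarrow> kuv \<Rightarrow> nat \<Rightarrow> kuv" where
  "descend n p c 0 = c"
| "descend n p c (Suc 0) = p n - vt c"
| "descend n p c (Suc (Suc k)) =
     (p (n - Suc k) - vt (descend n p c (Suc k)) + of_nat (n - k) * (Xu / 12 * descend n p c k))
     / of_nat (Suc (Suc k))"

text \<open>The coefficients of the section \<open>a T\<^sup>n\<close>.\<close>

abbreviation lowest :: "kuv \<Rightarrow> nat \<Rightarrow> kuv" where
  "lowest a \<equiv> (\<lambda>i. if i = 0 then a else 0)"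

lemma cf_nabla_vt_antidiagonal:
  assumes "i \<le> n"
  shows "cf (nabla_vt P) i (n - i) = vt (cf P i (n - i))
    - (if i = n then 0 else Xu / 12 * (of_nat (Suc i) * cf P (Suc i) (n - Suc i)))
    + (if i = 0 then 0 else of_nat (Suc (n - i)) * cf P (i - 1) (Suc (n - i)))"
  unfolding cf_nabla_vt using assms by (cases i) auto

lemma of_nat_Suc_neq_0: "(1 + of_nat k :: kuv) \<noteq> 0" "(2 + of_nat k :: kuv) \<noteq> 0"
  using kuv_of_nat_nonzero[of k] kuv_of_nat_nonzero[of "Suc k"] by (simp_all add: add.assoc [symmetric])

text \<open>The equations determine the coefficients of \<open>P\<close> successively, starting from that of \<open>S\<^sup>n\<close>.\<close>

lemma descend_coefficients:
  assumes p: "\<And>i. p i = cf (nabla_vt P) i (n - i)"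
  shows "k \<le> n \<Longrightarrow> descend n p (cf P n 0) k = cf P (n - k) k"
    and "descend n p (cf P n 0) (Suc n) = 0"
proof -
  show *: "k \<le> n \<Longrightarrow> descend n p (cf P n 0) k = cf P (n - k) k" for k
  proof (induction k rule: induct_nat_012)
    case 1
    then show ?case
      using cf_nabla_vt_antidiagonal[of n n P] by (simp add: p)
  next
    case (ge2 k)
    define i where "i = n - Suc k"
    have i: "i \<le> n" "i \<noteq> 0" "i \<noteq> n" "Suc i = n - k" "n - i = Suc k" "n - Suc i = k"
        "i - 1 = n - Suc (Suc k)" "n - (n - k) = k"
      using ge2.prems by (auto simp: i_def)
    have "p i = vt (cf P i (Suc k)) - Xu / 12 * (of_nat (n - k) * cf P (n - k) k)
        + of_nat (Suc (Suc k)) * cf P (n - Suc (Suc k)) (Suc (Suc k))"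
      using cf_nabla_vt_antidiagonal[OF i(1), of P] i(2,3) unfolding i(4-7) by (simp add: p i(5,8))
    moreover have "descend n p (cf P n 0) k = cf P (n - k) k"
      "descend n p (cf P n 0) (Suc k) = cf P i (Suc k)"
      using ge2 by (auto simp: i_def)
    ultimately show ?case
      using of_nat_Suc_neq_0[of k] by (simp add: i_def [symmetric] field_simps)
  qed simp
  show "descend n p (cf P n 0) (Suc n) = 0"
  proof (cases n)
    case 0
    then show ?thesis using cf_nabla_vt_antidiagonal[of 0 0 P] by (simp add: p)
  next
    case (Suc k)
    then show ?thesis
      using cf_nabla_vt_antidiagonal[of 0 n P] *[of k] *[of "Suc k"] by (simp add: p)
  qed
qed

definition descend_section :: "nat \<Rightarrow> (nat \<Rightarrow> kuv) \<Rightarrow> kuv \<Rightarrow> sym" where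
  "descend_section n p c = (\<Sum>k\<le>n. monom (monom (descend n p c k) (n - k)) k)"

lemma cf_descend_section:
  "cf (descend_section n p c) i j = (if i + j = n then descend n p c j else 0)"
proof -
  have "cf (descend_section n p c) i j = (\<Sum>k\<le>n. if k = j then (if i + j = n then descend n p c j else 0) else 0)"
    unfolding descend_section_def coeff_sum by (intro sum.cong) auto
  then show ?thesis by simp
qed

lemma descend_section_Vn:
  assumes "\<And>k. k \<le> n \<Longrightarrow> descend n p c k \<in> OX" shows "descend_section n p c \<in> Vn n"
  by (rule VnI) (auto simp: cf_descend_section assms)

text \<open>The recursion clears all coefficients but that of \<open>T\<^sup>n\<close>.\<close>

lemma nabla_vt_descend_section:
  assumes Q: "Q \<in> Vn n" and p: "\<And>i. i \<le> n \<Longrightarrow> p i = cf Q i (n - i)"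
    and OX: "\<And>k. k \<le> n \<Longrightarrow> descend n p c k \<in> OX"
  shows "Q - nabla_vt (descend_section n p c) = scal (of_nat (Suc n) * descend n p c (Suc n)) * gT ^ n"
proof (rule sym_eqI)
  define P where "P = descend_section n p c"
  have P: "P \<in> Vn n" unfolding P_def using OX by (rule descend_section_Vn)
  have cfP: "cf P i (n - i) = descend n p c (n - i)" if "i \<le> n" for i
    using that by (simp add: P_def cf_descend_section)
  fix i j
  show "cf (Q - nabla_vt (descend_section n p c)) i j =
        cf (scal (of_nat (Suc n) * descend n p c (Suc n)) * gT ^ n) i j"
  proof (cases "i + j = n")
    case False
    have "nabla_vt P \<in> Vn n"
      unfolding nabla_vt_def using P by (intro Vn_nab OX_derivations) auto
    with False show ?thesis
      using VnD(2)[OF Q False] VnD(2)[of "nabla_vt P" n i j] by (auto simp: P_def)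
  next
    case True
    then have j: "j = n - i" "i \<le> n" by auto
    have eq: "cf (nabla_vt P) i j = vt (descend n p c j)
      - (if i = n then 0 else Xu / 12 * (of_nat (Suc i) * descend n p c (n - Suc i)))
      + (if i = 0 then 0 else of_nat (Suc j) * descend n p c (Suc j))"
      unfolding j(1) cf_nabla_vt_antidiagonal[OF j(2)] using j cfP
      by (auto simp: P_def cf_descend_section)
    have "p i - vt (descend n p c j)
      + (if i = n then 0 else Xu / 12 * (of_nat (Suc i) * descend n p c (n - Suc i)))
      = of_nat (Suc j) * descend n p c (Suc j)"
    proof (cases j)
      case 0
      then show ?thesis using j by simp
    next
      case (Suc k)
      have "Suc i = n - k" "n - Suc i = k" "i = n - Suc k" "i \<noteq> n" using Suc j by auto
      then show ?thesis
        using Suc of_nat_Suc_neq_0[of k] by (simp add: field_simps)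
    qed
    then have "p i - cf (nabla_vt P) i j
        = (if i = 0 then of_nat (Suc j) * descend n p c (Suc j) else 0)"
      unfolding eq by (cases "i = 0") (simp_all add: algebra_simps)
    then show ?thesis
      using p[OF j(2)] j unfolding P_def [symmetric] coeff_diff cf_scal cf_T_power by auto
  qed
qed

lemma graded_cong_mult:
  "a \<in> graded {m} \<Longrightarrow> b \<in> graded {w. [w = r] (mod N)} \<Longrightarrow> a * b \<in> graded {w. [w = m + r] (mod N)}"
  by (erule graded_mult) (auto intro: cong_add)

lemma graded_cong_vt:
  "a \<in> graded {w. [w = r] (mod N)} \<Longrightarrow> vt a \<in> graded {w. [w = r + 2] (mod N)}"
  by (erule vt_graded) (auto intro: cong_add)

text \<open>The modulus \<open>N\<close> is 12 for invariant sections on \<open>Z\<close> and 0 for homogeneous sections on \<open>X\<close>.\<close>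

lemma descend_graded:
  assumes p: "\<And>i. i \<le> n \<Longrightarrow> p i \<in> graded {w. [w = 2 + int n - 2 * int i] (mod N)}"
    and c: "c \<in> graded {w. [w = - int n] (mod N)}"
  shows "k \<le> Suc n \<Longrightarrow> descend n p c k \<in> graded {w. [w = - int n + 2 * int k] (mod N)}"
proof (induction k rule: induct_nat_012)
  case 0
  then show ?case using c by simp
next
  case 1
  show ?case
    using graded_diff[OF _ graded_cong_vt[OF c], of "p n"] p[of n] by (simp add: algebra_simps)
next
  case (ge2 k)
  define G where "G = graded {w. [w = - int n + 2 * int (Suc (Suc k))] (mod N)}"
  have "p (n - Suc k) \<in> G"
    using p[of "n - Suc k"] ge2.prems by (simp add: G_def of_nat_diff algebra_simps)
  moreover have "vt (descend n p c (Suc k)) \<in> G"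
    using graded_cong_vt[OF ge2.IH(2)] ge2.prems by (simp add: G_def algebra_simps)
  moreover have "Xu / 12 * descend n p c k \<in> G"
    using graded_cong_mult[OF graded_divide_numeral[OF graded_Xu] ge2.IH(1)] ge2.prems
    by (simp add: G_def algebra_simps)
  ultimately show ?case
    unfolding descend.simps(3) G_def
    by (intro graded_divide_of_nat graded_add graded_diff graded_of_nat)
qed

lemma descend_J:
  assumes p: "\<And>i. i \<le> n \<Longrightarrow> p i - p' i \<in> J" and c: "c - c' \<in> J"
  shows "k \<le> Suc n \<Longrightarrow> descend n p c k - descend n p' c' k \<in> J"
proof (induction k rule: induct_nat_012)
  case 0
  then show ?case using c by simp
next
  case 1
  show ?case
    using J_diff[OF p[of n] J_vt[OF c]] by (simp add: vt.diff algebra_simps)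
next
  case (ge2 k)
  define x y z where "x = p (n - Suc k) - p' (n - Suc k)"
    and "y = descend n p c (Suc k) - descend n p' c' (Suc k)"
    and "z = descend n p c k - descend n p' c' k"
  have "x \<in> J" "y \<in> J" "z \<in> J"
    using ge2 p by (auto simp: x_def y_def z_def)
  moreover have "of_nat (n - k) * (Xu / 12) \<in> OX"
    by (intro OX_intros) auto
  ultimately have "(x - vt y + of_nat (n - k) * (Xu / 12) * z) / of_nat (Suc (Suc k)) \<in> J"
    by (intro J_divide_of_nat J_add J_diff J_vt J_mult)
  moreover have "(x - vt y + of_nat (n - k) * (Xu / 12) * z) / of_nat (Suc (Suc k))
      = descend n p c (Suc (Suc k)) - descend n p' c' (Suc (Suc k))"
  proof -
    have gen: "(x1 - x2 - (v1 - v2) + (t1 - t2)) / N = (x1 - v1 + t1) / N - (x2 - v2 + t2) / N"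
      for x1 x2 v1 v2 t1 t2 N :: kuv
      by (simp add: diff_divide_distrib add_divide_distrib)
    show ?thesis
      unfolding descend.simps x_def y_def z_def vt.diff right_diff_distrib mult.assoc gen ..
  qed
  ultimately show ?case by simp
qed

lemma gr_mod_0: "gr m = graded {w. [w = m] (mod 0)}"
  by (simp add: gr_eq)

lemma I0_iff: "P \<in> Vn n \<Longrightarrow> P \<in> I0 n \<longleftrightarrow> (\<forall>i\<le>n. cf P i (n - i) \<in> J)"
proof
  assume "P \<in> I0 n"
  then obtain R where "P = scal (Delta - 1) * R" "R \<in> Vn n" by (auto simp: I0_def)
  then show "\<forall>i\<le>n. cf P i (n - i) \<in> J"
    using VnD(1) by (fastforce simp: J_def)
next
  assume P: "P \<in> Vn n" and J: "\<forall>i\<le>n. cf P i (n - i) \<in> J"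
  define R where "R = scal (1 / (Delta - 1)) * P"
  have D: "Delta - 1 \<noteq> 0"
  proof
    assume "Delta - 1 = 0"
    then have "pDelta = 1" by (metis Delta_eq eq_iff_diff_eq_0 to_fract_1 to_fract_eq_iff)
    moreover have "coeff (coeff pDelta 0) 3 = 1"
      by (simp add: pDelta_def pu_def pv_def eval_nat_numeral coeff_pCons numeral_poly)
    ultimately show False by simp
  qed
  have "R \<in> Vn n"
  proof (rule VnI)
    fix i j
    show "cf R i j = 0" if "i + j \<noteq> n"
      using VnD(2)[OF P that] by (simp add: R_def)
    show "cf R i j \<in> OX"
    proof (cases "i + j = n")
      case True
      then have "i \<le> n" "j = n - i" by auto
      then obtain c where "cf P i j = (Delta - 1) * c" "c \<in> OX" using J by (auto simp: J_def)
      then show ?thesis using D by (simp add: R_def)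
    qed (use VnD(2)[OF P] in \<open>auto simp: R_def\<close>)
  qed
  moreover have "P = scal (Delta - 1) * R"
    using D by (intro sym_eqI) (simp add: R_def)
  ultimately show "P \<in> I0 n" unfolding I0_def by blast
qed

lemma Vn_nabla_vt: "P \<in> Vn n \<Longrightarrow> nabla_vt P \<in> Vn n"
  unfolding nabla_vt_def by (intro Vn_nab OX_derivations) auto

lemma V12_descend_section:
  assumes "\<And>k. k \<le> n \<Longrightarrow> descend n p c k \<in> gr12 (- int n + 2 * int k)"
  shows "descend_section n p c \<in> V12 n 0"
proof (rule V12I)
  show "descend_section n p c \<in> Vn n"
    using assms by (intro descend_section_Vn) (auto dest: gr12_OX)
  fix i j assume ij: "i + j = n"
  then have "descend n p c j \<in> gr12 (- int n + 2 * int j)" by (intro assms) auto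
  moreover have "- int n + 2 * int j = 0 - int i + int j" using ij by auto
  ultimately show "cf (descend_section n p c) i j \<in> gr12 (0 - int i + int j)"
    unfolding cf_descend_section using ij by metis
qed

lemma I0_coefficient: "Q \<in> I0 n \<Longrightarrow> i \<le> n \<Longrightarrow> cf Q i (n - i) \<in> J"
  using VnD(1) by (fastforce simp: I0_def J_def)

text \<open>A primitive on \<open>Z\<close> determines the coefficient of \<open>S\<^sup>n\<close> modulo \<open>\<Delta> - 1\<close>. Starting the recursion at a homogeneous
  representative \<open>b\<close> changes its outcome by a multiple of \<open>\<Delta> - 1\<close> only; the outcome is then homogeneous and
  vanishes on \<open>Z\<close>, hence it is 0.\<close>

theorem lowest_exact_iff:
  assumes a: "a \<in> gr (int n + 2)"
  shows "(\<exists>P\<in>V12 n 0. scal a * gT ^ n - nabla_vt P \<in> I0 n) \<longleftrightarrow>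
         (\<exists>b\<in>gr (- int n). descend n (lowest a) b (Suc n) = 0)"
proof
  assume "\<exists>b\<in>gr (- int n). descend n (lowest a) b (Suc n) = 0"
  then obtain b where b: "b \<in> gr (- int n)" "descend n (lowest a) b (Suc n) = 0" by blast
  have gr: "descend n (lowest a) b k \<in> gr (- int n + 2 * int k)" if "k \<le> n" for k
    unfolding gr_mod_0
    by (rule descend_graded) (use a b that in \<open>auto simp: gr_eq add.commute\<close>)
  have "scal a * gT ^ n - nabla_vt (descend_section n (lowest a) b) =
        scal (of_nat (Suc n) * descend n (lowest a) b (Suc n)) * gT ^ n"
    using gr a by (intro nabla_vt_descend_section Vn_T_power)
      (auto simp: gr_eq dest: graded_OX)
  also have "\<dots> = 0" unfolding b(2) by (simp add: scal_def)
  finally have "scal a * gT ^ n - nabla_vt (descend_section n (lowest a) b) \<in> I0 n"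
    by (simp add: I0_iff)
  moreover have "descend_section n (lowest a) b \<in> V12 n 0"
    by (rule V12_descend_section) (use gr gr_gr12 in blast)
  ultimately show "\<exists>P\<in>V12 n 0. scal a * gT ^ n - nabla_vt P \<in> I0 n" by blast
next
  assume "\<exists>P\<in>V12 n 0. scal a * gT ^ n - nabla_vt P \<in> I0 n"
  then obtain P where P: "P \<in> V12 n 0" "scal a * gT ^ n - nabla_vt P \<in> I0 n" by blast
  define p where "p i = cf (nabla_vt P) i (n - i)" for i
  have "cf P n 0 \<in> gr12 (- int n)" using V12D(2)[OF P(1), of 0 n] by simp
  then obtain b where b: "b \<in> gr (- int n)" "cf P n 0 - b \<in> J" by (rule gr12_homogenize)
  have p: "p i - lowest a i \<in> J" if "i \<le> n" for i
    using J_uminus[OF I0_coefficient[OF P(2) that]] that by (auto simp: p_def)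
  have "descend n p (cf P n 0) (Suc n) - descend n (lowest a) b (Suc n) \<in> J"
    by (rule descend_J[OF p b(2)]) auto
  then have "- descend n (lowest a) b (Suc n) \<in> J"
    using descend_coefficients(2)[of p P n, OF p_def] by simp
  then have "descend n (lowest a) b (Suc n) \<in> J"
    using J_uminus by fastforce
  moreover have "descend n (lowest a) b (Suc n) \<in> gr (- int n + 2 * int (Suc n))"
    unfolding gr_mod_0
    by (rule descend_graded) (use a b in \<open>auto simp: gr_eq add.commute\<close>)
  ultimately have "descend n (lowest a) b (Suc n) = 0"
    by (intro gr_J_zero)
  with b(1) show "\<exists>b\<in>gr (- int n). descend n (lowest a) b (Suc n) = 0" by blast
qed

text \<open>The recursion started at 0 clears all coefficients but the last, which is then replaced by a
  homogeneous representative.\<close>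

theorem lowest_representative:
  assumes Q: "Q \<in> V12 n 2"
  obtains a P where "a \<in> gr (int n + 2)" "P \<in> V12 n 0" "Q - (scal a * gT ^ n + nabla_vt P) \<in> I0 n"
proof -
  define p where "p i = cf Q i (n - i)" for i
  have p: "p i \<in> graded {w. [w = 2 + int n - 2 * int i] (mod 12)}" if "i \<le> n" for i
    using V12D(2)[OF Q, of "n - i" i] that by (simp add: p_def gr12_eq of_nat_diff algebra_simps)
  have gr: "descend n p 0 k \<in> gr12 (- int n + 2 * int k)" if "k \<le> Suc n" for k
    unfolding gr12_eq by (rule descend_graded[OF p]) (use that in auto)
  define a' where "a' = of_nat (Suc n) * descend n p 0 (Suc n)"
  have "a' \<in> gr12 (int n + 2)"
    using gr12_of_nat[OF gr[of "Suc n"], of "Suc n"] by (simp add: a'_def algebra_simps)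
  then obtain a where a: "a \<in> gr (int n + 2)" "a' - a \<in> J" by (rule gr12_homogenize)
  define P where "P = descend_section n p 0"
  have P: "P \<in> V12 n 0"
    unfolding P_def by (rule V12_descend_section) (use gr in auto)
  have eq: "Q - nabla_vt P = scal a' * gT ^ n"
    unfolding P_def a'_def using gr12_OX[OF gr] V12D(1)[OF Q]
    by (intro nabla_vt_descend_section) (auto simp: p_def)
  have V: "scal a * gT ^ n \<in> Vn n" "nabla_vt P \<in> Vn n" "Q \<in> Vn n"
    using a(1) P Q by (auto intro!: Vn_T_power Vn_nabla_vt simp: gr_eq V12_def dest: graded_OX)
  have "Q - (scal a * gT ^ n + nabla_vt P) = scal a' * gT ^ n - scal a * gT ^ n"
    using eq by (simp add: algebra_simps)
  moreover have "\<forall>i\<le>n. cf (scal a' * gT ^ n - scal a * gT ^ n) i (n - i) \<in> J"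
    using a(2) by simp
  moreover have "Q - (scal a * gT ^ n + nabla_vt P) \<in> Vn n"
    by (intro Vn_diff Vn_add V)
  ultimately have "Q - (scal a * gT ^ n + nabla_vt P) \<in> I0 n"
    by (simp only: I0_iff)
  with a(1) P that show ?thesis by blast
qed

section \<open>The de Rham cohomology as a quotient\<close>

lemma scal_add: "scal (a + b) = scal a + scal b" and scal_mult: "scal (a * b) = scal a * scal b"
  and scal_1 [simp]: "scal 1 = 1" and scal_0 [simp]: "scal 0 = 0" and scal_uminus: "scal (- a) = - scal a"
  by (simp_all add: scal_def one_pCons)

lemma module_X0: "module rat_ring (X0 n)"
  unfolding X0_def
  by (rule module_rat_space)
     (auto simp: Vn_add Vn_uminus Vn_scal rat_const_add rat_const_mult scal_add scal_mult
        distrib_left distrib_right mult.assoc)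

lemma module_X1: "module rat_ring (X1 n)"
  unfolding X1_def
  by (rule module_rat_space)
     (auto simp: Vn_add Vn_uminus Vn_scal rat_const_add rat_const_mult scal_add scal_mult
        distrib_left distrib_right mult.assoc zero_prod_def)

lemma X1_simps [simp]:
  "carrier (X1 n) = Vn n \<times> Vn n" "\<zero>\<^bsub>X1 n\<^esub> = 0" "x \<oplus>\<^bsub>X1 n\<^esub> y = x + y"
  "c \<odot>\<^bsub>X1 n\<^esub> x = (scal (rat_const c) * fst x, scal (rat_const c) * snd x)"
  by (simp_all add: X1_def rat_space_def case_prod_beta)

lemma X0_simps [simp]:
  "carrier (X0 n) = Vn n" "\<zero>\<^bsub>X0 n\<^esub> = 0" "P \<oplus>\<^bsub>X0 n\<^esub> Q = P + Q"
  "c \<odot>\<^bsub>X0 n\<^esub> P = scal (rat_const c) * P"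
  by (simp_all add: X0_def rat_space_def)

lemma I0_subset: "I0 n \<subseteq> Vn n"
  by (auto simp: I0_def intro!: Vn_scal OX_diff)

lemma I0_add: "P \<in> I0 n \<Longrightarrow> Q \<in> I0 n \<Longrightarrow> P + Q \<in> I0 n"
  using I0_subset[of n] I0_iff[of P n] I0_iff[of Q n] I0_iff[of "P + Q" n]
  by (auto simp: subset_iff Vn_add J_add)

lemma I0_scal: "a \<in> OX \<Longrightarrow> P \<in> I0 n \<Longrightarrow> scal a * P \<in> I0 n"
  using I0_subset[of n] I0_iff[of P n] I0_iff[of "scal a * P" n]
  by (auto simp: subset_iff Vn_scal J_mult)

lemma I0_0 [simp]: "0 \<in> I0 n"
  by (simp add: I0_iff)

lemma contract_scal: "contract (scal a * A, scal a * B) = scal a * contract (A, B)"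
  by (rule sym_eqI) (simp add: contract_def algebra_simps)

lemma I1_subset: "I1 n \<subseteq> Vn n \<times> Vn n"
  unfolding I1_def by (auto intro!: Vn_add Vn_scal OX_intros)

lemma I1_eq: "I1 n = {x \<in> Vn n \<times> Vn n. contract x \<in> I0 n}"
  using I1_iff[of _ n] I1_subset[of n] by blast

lemma submodule_I0: "submodule (I0 n) rat_ring (X0 n)"
  by (rule submodule_rat_ringI[OF module_X0]) (use I0_subset in \<open>auto simp: I0_add I0_scal\<close>)

lemma submodule_I1: "submodule (I1 n) rat_ring (X1 n)"
proof (rule submodule_rat_ringI[OF module_X1])
  show "x \<oplus>\<^bsub>X1 n\<^esub> y \<in> I1 n" if "x \<in> I1 n" "y \<in> I1 n" for x y
    using that by (auto simp: I1_eq contract_add I0_add Vn_add)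
  show "c \<odot>\<^bsub>X1 n\<^esub> x \<in> I1 n" if "x \<in> I1 n" for c x
    using that by (auto simp: I1_eq contract_scal I0_scal Vn_scal)
qed (auto simp: I1_eq contract_def zero_prod_def)

lemma submodule_I2: "submodule (I2 n) rat_ring (X2 n)"
  unfolding I2_eq X2_def by (rule submodule_rat_ringI[OF module_X0]) (auto simp: Vn_add Vn_scal)

interpretation X0: rat_quotient "X0 n" "I0 n" for n
  by (rule rat_quotient.intro[OF module_X0 submodule_I0])

interpretation X1: rat_quotient "X1 n" "I1 n" for n
  by (rule rat_quotient.intro[OF module_X1 submodule_I1])

lemma module_X2: "module rat_ring (X2 n)"
  unfolding X2_def by (rule module_X0)

interpretation X2: rat_quotient "X2 n" "I2 n" for n
  by (rule rat_quotient.intro[OF module_X2 submodule_I2])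

abbreviation form_on_Z :: "nat \<Rightarrow> sym \<times> sym \<Rightarrow> (sym \<times> sym) set" where
  "form_on_Z n x \<equiv> I1 n +>\<^bsub>X1 n\<^esub> x"

lemma form_on_Z_eqI:
  assumes "x \<in> Vn n \<times> Vn n" "y \<in> Vn n \<times> Vn n" "contract x - contract y \<in> I0 n"
  shows "form_on_Z n x = form_on_Z n y"
proof (rule X1.rcos_eqI)
  have "x - y \<in> Vn n \<times> Vn n" using assms by (auto simp: Vn_diff)
  then show "x - y \<in> I1 n"
    using assms by (simp only: I1_iff contract_diff)
qed (use assms in auto)

lemma form_on_Z_eqD:
  assumes "x \<in> Vn n \<times> Vn n" "y \<in> Vn n \<times> Vn n" "form_on_Z n x = form_on_Z n y"
  shows "contract x - contract y \<in> I0 n"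
proof -
  have "x \<in> form_on_Z n y"
    using assms X1.a_rcos_self[of x n] by simp
  then obtain u where u: "u \<in> I1 n" "x = u + y"
    using X1.in_rcosD[of x n y] by auto
  then have "contract x - contract y = contract u"
    by (simp add: contract_add)
  then show ?thesis using u(1) by (simp add: I1_eq)
qed

lemma form_on_Z_eq_iff:
  assumes "x \<in> Vn n \<times> Vn n" "y \<in> Vn n \<times> Vn n"
  shows "form_on_Z n x = form_on_Z n y \<longleftrightarrow> contract x - contract y \<in> I0 n"
  using form_on_Z_eqI[OF assms] form_on_Z_eqD[OF assms] by blast

text \<open>There are no two-forms on \<open>Z\<close>, so that every one-form is closed.\<close>

lemma all_closed:
  assumes "x \<in> Vn n \<times> Vn n" shows "nablaZ1 n (form_on_Z n x) = \<zero>\<^bsub>Z2 n\<^esub>"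
proof -
  have "nabla1 y \<in> I2 n" if "y \<in> Vn n \<times> Vn n" for y
    using that unfolding I2_eq nabla1_def by (auto intro!: Vn_diff Vn_nabla)
  then have "I2 n +>\<^bsub>X2 n\<^esub> nabla1 y = I2 n" if "y \<in> Vn n \<times> Vn n" for y
    using that X2.a_rcos_const by blast
  moreover have "form_on_Z n x \<subseteq> Vn n \<times> Vn n" "x \<in> form_on_Z n x"
    using assms X1.a_rcos_self[of x n] X1.a_elemrcos_carrier[of x n] by auto
  ultimately have "nablaZ1 n (form_on_Z n x) = I2 n"
    unfolding nablaZ1_def quot_map_def by blast
  then show ?thesis by (simp add: Z2_def X2.zero_quot)
qed

abbreviation invariant_forms :: "nat \<Rightarrow> (sym \<times> sym) set" where
  "invariant_forms n \<equiv> V12 n (- 4) \<times> V12 n (- 6)"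

lemma invariant_forms_Vn: "x \<in> invariant_forms n \<Longrightarrow> x \<in> Vn n \<times> Vn n"
  by (auto dest: V12D)

lemma inv1_eq: "inv1 n = form_on_Z n ` invariant_forms n"
  unfolding inv1_def by auto

lemma closed1_eq: "closed1 n = (Z1 n)\<lparr>carrier := inv1 n\<rparr>"
proof -
  have "{\<eta> \<in> inv1 n. nablaZ1 n \<eta> = \<zero>\<^bsub>Z2 n\<^esub>} = inv1 n"
    using all_closed[OF invariant_forms_Vn] by (auto simp: inv1_eq)
  then show ?thesis by (simp add: closed1_def)
qed

lemma Z1_rules:
  assumes "x \<in> Vn n \<times> Vn n"
  shows "y \<in> Vn n \<times> Vn n \<Longrightarrow> form_on_Z n x \<oplus>\<^bsub>Z1 n\<^esub> form_on_Z n y = form_on_Z n (x + y)"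
    and "c \<odot>\<^bsub>Z1 n\<^esub> form_on_Z n x =
         form_on_Z n (scal (rat_const c) * fst x, scal (rat_const c) * snd x)"
  using X1.rcos_add[of x n y] X1.rcos_smult[of x n c] assms by (simp_all add: Z1_def)

lemma Z1_zero: "\<zero>\<^bsub>Z1 n\<^esub> = form_on_Z n 0"
  using X1.rcos_zero[of n] by (simp add: Z1_def X1.zero_quot)

lemma const_gr_0: "rat_const c \<in> gr 0"
  by (simp add: gr_eq)

lemma submodule_inv1: "submodule (inv1 n) rat_ring (Z1 n)"
proof (rule submodule_rat_ringI)
  show "module rat_ring (Z1 n)" unfolding Z1_def by (rule X1.module_quot)
  show "inv1 n \<subseteq> carrier (Z1 n)"
    using invariant_forms_Vn unfolding inv1_eq Z1_def X1.carrier_quot by auto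
  show "\<zero>\<^bsub>Z1 n\<^esub> \<in> inv1 n"
    unfolding Z1_zero inv1_eq by (rule imageI) (simp add: zero_prod_def)
  fix x y assume "x \<in> inv1 n" "y \<in> inv1 n"
  then obtain a b where "x = form_on_Z n a" "y = form_on_Z n b" "a \<in> invariant_forms n" "b \<in> invariant_forms n"
    by (auto simp: inv1_eq)
  moreover from this have "a + b \<in> invariant_forms n" by (auto intro: V12_add)
  ultimately show "x \<oplus>\<^bsub>Z1 n\<^esub> y \<in> inv1 n"
    using invariant_forms_Vn by (auto simp: Z1_rules inv1_eq)
next
  fix c x assume "x \<in> inv1 n"
  then obtain a where a: "x = form_on_Z n a" "a \<in> invariant_forms n"
    by (auto simp: inv1_eq)
  have "(scal (rat_const c) * fst a, scal (rat_const c) * snd a) \<in> invariant_forms n"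
    using a(2) V12_scal[OF const_gr_0] by auto
  then show "c \<odot>\<^bsub>Z1 n\<^esub> x \<in> inv1 n"
    using a invariant_forms_Vn by (simp only: Z1_rules inv1_eq) blast
qed

lemma closed1_simps [simp]:
  "carrier (closed1 n) = form_on_Z n ` invariant_forms n" "\<zero>\<^bsub>closed1 n\<^esub> = form_on_Z n 0"
  "x \<oplus>\<^bsub>closed1 n\<^esub> y = x \<oplus>\<^bsub>Z1 n\<^esub> y" "c \<odot>\<^bsub>closed1 n\<^esub> x = c \<odot>\<^bsub>Z1 n\<^esub> x"
  by (simp_all add: closed1_eq inv1_eq Z1_zero)

lemma module_closed1: "module rat_ring (closed1 n)"
  unfolding closed1_eq
  by (rule submodule.submodule_is_module[OF submodule_inv1]) (simp add: Z1_def X1.module_quot)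

lemma nabla0_Vn: "P \<in> Vn n \<Longrightarrow> nabla0 P \<in> Vn n \<times> Vn n"
  by (simp add: nabla0_def Vn_nabla)

lemma nabla0_invariant: "P \<in> V12 n 0 \<Longrightarrow> nabla0 P \<in> invariant_forms n"
  by (simp add: nabla0_def V12_nabla)

lemma nabla_vt_add: "nabla_vt (P + Q) = nabla_vt P + nabla_vt Q"
  by (rule sym_eqI) (simp add: cf_nabla_vt vt.add algebra_simps)

lemma nabla_vt_scal: "vt a = 0 \<Longrightarrow> nabla_vt (scal a * P) = scal a * nabla_vt P"
  by (rule sym_eqI, simp add: cf_nabla_vt vt.mult) (simp add: algebra_simps)

lemma contract_0 [simp]: "contract 0 = 0" and nabla_vt_0 [simp]: "nabla_vt 0 = 0"
  by (simp_all add: contract_def nabla_vt_def nab_def zero_prod_def)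

lemma nablaZ0_form: "P \<in> Vn n \<Longrightarrow> nablaZ0 n (I0 n +>\<^bsub>X0 n\<^esub> P) = form_on_Z n (nabla0 P)"
  unfolding nablaZ0_def quot_map_def
proof (rule X0.Union_rcos)
  fix u assume P: "P \<in> Vn n" and u: "u \<in> I0 n"
  obtain R where R: "u = scal (Delta - 1) * R" "R \<in> Vn n" using u by (auto simp: I0_def)
  have "vt (Delta - 1) = 0" by (simp add: vt.diff)
  then have "nabla_vt u \<in> I0 n"
    unfolding R(1) nabla_vt_scal[OF \<open>vt (Delta - 1) = 0\<close>] I0_def using Vn_nabla_vt[OF R(2)] by blast
  moreover have "u \<in> Vn n" using u I0_subset by blast
  ultimately show "form_on_Z n (nabla0 (u \<oplus>\<^bsub>X0 n\<^esub> P)) = form_on_Z n (nabla0 P)"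
    using P by (intro form_on_Z_eqI nabla0_Vn) (auto simp: Vn_add contract_nabla0 nabla_vt_add)
qed simp

lemma exact1_eq: "exact1 n = (\<lambda>P. form_on_Z n (nabla0 P)) ` V12 n 0"
proof -
  have "exact1 n = (\<lambda>P. nablaZ0 n (I0 n +>\<^bsub>X0 n\<^esub> P)) ` V12 n 0"
    unfolding exact1_def inv0_def by auto
  also have "\<dots> = (\<lambda>P. form_on_Z n (nabla0 P)) ` V12 n 0"
    by (intro image_cong refl nablaZ0_form V12D(1))
  finally show ?thesis .
qed

lemma submodule_exact1: "submodule (exact1 n) rat_ring (closed1 n)"
proof (rule submodule_rat_ringI[OF module_closed1])
  have nab: "P \<in> V12 n 0 \<Longrightarrow> nabla0 P \<in> Vn n \<times> Vn n" for P
    by (intro nabla0_Vn V12D(1))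
  show "exact1 n \<subseteq> carrier (closed1 n)"
    using nabla0_invariant by (auto simp: exact1_eq)
  have "form_on_Z n 0 = form_on_Z n (nabla0 0)"
    by (intro form_on_Z_eqI nabla0_Vn) (simp_all add: contract_nabla0 zero_prod_def[where 'a = sym and 'b = sym, symmetric] mem_Times_iff)
  then show "\<zero>\<^bsub>closed1 n\<^esub> \<in> exact1 n"
    unfolding exact1_eq by auto
  fix x y assume "x \<in> exact1 n" "y \<in> exact1 n"
  then obtain P Q where PQ: "P \<in> V12 n 0" "Q \<in> V12 n 0" "x = form_on_Z n (nabla0 P)" "y = form_on_Z n (nabla0 Q)"
    by (auto simp: exact1_eq)
  have "form_on_Z n (nabla0 P + nabla0 Q) = form_on_Z n (nabla0 (P + Q))"
    using PQ(1,2) nab by (intro form_on_Z_eqI nabla0_Vn)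
      (auto simp: contract_add contract_nabla0 nabla_vt_add mem_Times_iff Vn_add V12D(1))
  then have "x \<oplus>\<^bsub>closed1 n\<^esub> y = form_on_Z n (nabla0 (P + Q))"
    using nab[OF PQ(1)] nab[OF PQ(2)] by (simp add: PQ(3,4) Z1_rules)
  then show "x \<oplus>\<^bsub>closed1 n\<^esub> y \<in> exact1 n"
    using PQ(1,2) V12_add unfolding exact1_eq by blast
next
  fix c x assume "x \<in> exact1 n"
  then obtain P where P: "P \<in> V12 n 0" "x = form_on_Z n (nabla0 P)"
    by (auto simp: exact1_eq)
  define a where "a = rat_const c"
  have a: "vt a = 0" "a \<in> OX" by (simp_all add: a_def vt_def)
  have "scal a * P \<in> V12 n 0"
    unfolding a_def by (rule V12_scal[OF const_gr_0 P(1)]) simp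
  moreover have "form_on_Z n (scal a * fst (nabla0 P), scal a * snd (nabla0 P)) = form_on_Z n (nabla0 (scal a * P))"
    using P(1) a nabla0_Vn[of P n]
    by (intro form_on_Z_eqI nabla0_Vn)
      (auto simp: contract_scal contract_nabla0 nabla_vt_scal Vn_scal V12D(1) mem_Times_iff)
  then have "c \<odot>\<^bsub>closed1 n\<^esub> x = form_on_Z n (nabla0 (scal a * P))"
    using nabla0_Vn[OF V12D(1)[OF P(1)]] by (simp add: P(2) Z1_rules a_def)
  ultimately show "c \<odot>\<^bsub>closed1 n\<^esub> x \<in> exact1 n"
    unfolding exact1_eq by blast
qed

interpretation H1: rat_quotient "closed1 n" "exact1 n" for n
  by (rule rat_quotient.intro[OF module_closed1 submodule_exact1])

lemma module_H1dR: "module rat_ring (H1dR n)"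
  unfolding H1dR_def by (rule H1.module_quot)

definition lowest_form :: "nat \<Rightarrow> kuv \<Rightarrow> sym \<times> sym" where
  "lowest_form n a = (scal (a * omega_u) * gT ^ n, scal (a * omega_v) * gT ^ n)"

lemma contract_lowest_form: "contract (lowest_form n a) = scal a * gT ^ n"
proof (rule sym_eqI)
  fix i j
  have "6 * Xv * (a * omega_u * t) + Xu ^ 2 / 3 * (a * omega_v * t)
      = (6 * Xv * omega_u + Xu ^ 2 / 3 * omega_v) * (a * t)" for t
    by (simp add: algebra_simps)
  then show "cf (contract (lowest_form n a)) i j = cf (scal a * gT ^ n) i j"
    unfolding contract_def lowest_form_def case_prod_conv coeff_add cf_scal vt_omega by simp
qed

lemma V12_T_power:
  assumes "a \<in> gr12 r" "[s = r - int n] (mod 12)" shows "scal a * gT ^ n \<in> V12 n s"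
proof (rule V12I)
  show "scal a * gT ^ n \<in> Vn n" using assms by (intro Vn_T_power gr12_OX)
  have "[s + int n = r] (mod 12)"
    using cong_add[OF assms(2) cong_refl[of "int n"]] by simp
  then have "gr12 r = gr12 (s + int n)" using gr12_cong cong_sym by blast
  then show "cf (scal a * gT ^ n) i j \<in> gr12 (s - int i + int j)" for i j
    using assms(1) by auto
qed

lemma lowest_form_invariant:
  assumes "a \<in> gr (int n + 2)" shows "lowest_form n a \<in> invariant_forms n"
proof -
  have "a * omega_u \<in> gr12 (int n + 2 + - 6)" "a * omega_v \<in> gr12 (int n + 2 + - 8)"
    by (intro gr12_mult assms gr_gr12 psi_omega_gr)+
  then show ?thesis
    unfolding lowest_form_def by (auto intro!: V12_T_power)
qed

text \<open>Contraction with \<open>vt\<close> reduces all statements to those about invariant sections modulo \<open>\<Delta> - 1\<close> and the image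
  of \<open>nabla_vt\<close>, where \<open>lowest_representative\<close> and \<open>lowest_exact_iff\<close> apply.\<close>

theorem H1dR_presentation:
  fixes n
  defines "cls \<equiv> \<lambda>a. H1_class n (lowest_form n a)"
  shows "a \<in> gr (int n + 2) \<Longrightarrow> b \<in> gr (int n + 2) \<Longrightarrow> cls (a + b) = cls a \<oplus>\<^bsub>H1dR n\<^esub> cls b"
    and "a \<in> gr (int n + 2) \<Longrightarrow> cls (rat_const c * a) = c \<odot>\<^bsub>H1dR n\<^esub> cls a"
    and "cls ` gr (int n + 2) = carrier (H1dR n)"
    and "a \<in> gr (int n + 2) \<Longrightarrow>
         cls a = \<zero>\<^bsub>H1dR n\<^esub> \<longleftrightarrow> (\<exists>b\<in>gr (- int n). descend n (lowest a) b (Suc n) = 0)"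
proof -
  note V = invariant_forms_Vn[OF lowest_form_invariant]
  have closed: "form_on_Z n (lowest_form n a) \<in> carrier (closed1 n)" if "a \<in> gr (int n + 2)" for a
    using lowest_form_invariant[OF that] by simp
  have cls: "cls a = exact1 n +>\<^bsub>closed1 n\<^esub> form_on_Z n (lowest_form n a)" for a
    by (simp add: cls_def H1_class_def)
  show "cls (a + b) = cls a \<oplus>\<^bsub>H1dR n\<^esub> cls b" if "a \<in> gr (int n + 2)" "b \<in> gr (int n + 2)"
  proof -
    have "lowest_form n (a + b) = lowest_form n a + lowest_form n b"
      by (simp add: lowest_form_def scal_add algebra_simps)
    then show ?thesis
      using H1.rcos_add[OF closed[OF that(1)] closed[OF that(2)]] V[OF that(1)] V[OF that(2)]
      by (simp add: cls H1dR_def Z1_rules)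
  qed
  show "cls (rat_const c * a) = c \<odot>\<^bsub>H1dR n\<^esub> cls a" if "a \<in> gr (int n + 2)"
  proof -
    have "lowest_form n (rat_const c * a) =
        (scal (rat_const c) * fst (lowest_form n a), scal (rat_const c) * snd (lowest_form n a))"
      by (simp add: lowest_form_def scal_mult algebra_simps)
    then show ?thesis
      using H1.rcos_smult[OF closed[OF that], of c] V[OF that]
      by (simp add: cls H1dR_def Z1_rules)
  qed
  have "cls ` gr (int n + 2) \<subseteq> carrier (H1dR n)"
    using closed by (auto simp: cls H1dR_def H1.carrier_quot simp del: closed1_simps(1))
  moreover have "carrier (H1dR n) \<subseteq> cls ` gr (int n + 2)"
  proof
    fix X assume "X \<in> carrier (H1dR n)"
    then obtain x where x: "x \<in> invariant_forms n" "X = exact1 n +>\<^bsub>closed1 n\<^esub> form_on_Z n x"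
      by (auto simp: H1dR_def H1.carrier_quot)
    have "Xv \<in> gr 6" "Xu ^ 2 \<in> gr 8"
      using graded_Xv graded_power[OF graded_Xu, of 2] by (simp_all add: gr_eq)
    then have "6 * Xv \<in> gr 6" "Xu ^ 2 / 3 \<in> gr 8"
      by (simp_all add: gr_eq graded_numeral graded_divide_numeral)
    then have "contract x \<in> V12 n 2"
      using x(1) unfolding contract_def by (auto intro!: V12_add intro: V12_scal)
    then obtain a P where aP: "a \<in> gr (int n + 2)" "P \<in> V12 n 0"
      "contract x - (scal a * gT ^ n + nabla_vt P) \<in> I0 n"
      by (rule lowest_representative)
    note VP = nabla0_Vn[OF V12D(1)[OF aP(2)]]
    have "form_on_Z n x = form_on_Z n (nabla0 P + lowest_form n a)"
      using aP(3) invariant_forms_Vn[OF x(1)] V[OF aP(1)] VP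
      by (intro form_on_Z_eqI)
        (auto simp: contract_add contract_nabla0 contract_lowest_form Vn_add mem_Times_iff add.commute)
    also have "\<dots> = form_on_Z n (nabla0 P) \<oplus>\<^bsub>closed1 n\<^esub> form_on_Z n (lowest_form n a)"
      using V[OF aP(1)] VP by (simp add: Z1_rules)
    finally have eq: "form_on_Z n x = form_on_Z n (nabla0 P) \<oplus>\<^bsub>closed1 n\<^esub> form_on_Z n (lowest_form n a)" .
    have "form_on_Z n x \<in> carrier (closed1 n)" "form_on_Z n (nabla0 P) \<in> exact1 n"
      unfolding closed1_simps(1) exact1_eq using x(1) aP(2) by blast+
    then have "X = cls a"
      unfolding x(2) cls by (intro H1.rcos_eqI[OF _ closed[OF aP(1)] _ eq])
    with aP(1) show "X \<in> cls ` gr (int n + 2)" by blast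
  qed
  ultimately show "cls ` gr (int n + 2) = carrier (H1dR n)" by blast
  show "cls a = \<zero>\<^bsub>H1dR n\<^esub> \<longleftrightarrow> (\<exists>b\<in>gr (- int n). descend n (lowest a) b (Suc n) = 0)"
    if a: "a \<in> gr (int n + 2)"
  proof -
    have "cls a = \<zero>\<^bsub>H1dR n\<^esub> \<longleftrightarrow> form_on_Z n (lowest_form n a) \<in> exact1 n"
      using H1.a_rcos_const[of "form_on_Z n (lowest_form n a)" n] H1.a_rcos_self[OF closed[OF a]]
      by (auto simp: cls H1dR_def H1.zero_quot)
    also have "\<dots> \<longleftrightarrow> (\<exists>P\<in>V12 n 0. contract (lowest_form n a) - contract (nabla0 P) \<in> I0 n)"
      unfolding exact1_eq image_iff
      by (intro bex_cong refl form_on_Z_eq_iff V[OF a] nabla0_Vn V12D(1))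
    also have "\<dots> \<longleftrightarrow> (\<exists>b\<in>gr (- int n). descend n (lowest a) b (Suc n) = 0)"
      unfolding contract_lowest_form contract_nabla0 by (rule lowest_exact_iff[OF a])
    finally show ?thesis .
  qed
qed

section \<open>Bol's identity\<close>

lemma descend_recursion:
  assumes "k \<le> n"
  shows "vt (descend n p c k) = p (n - k)
    + of_nat (Suc (n - k)) * (Xu / 12 * (if k = 0 then 0 else descend n p c (k - 1)))
    - of_nat (Suc k) * descend n p c (Suc k)"
proof (cases k)
  case (Suc j)
  then have "Suc (n - k) = n - j" using assms by simp
  then show ?thesis
    using kuv_of_nat_nonzero[of "Suc j"] by (simp add: Suc del: of_nat_Suc)
qed simp

lemma descend_scale:
  "descend n (lowest (rat_const c * a)) (rat_const c * b) k = rat_const c * descend n (lowest a) b k"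
proof (induction k rule: induct_nat_012)
  case 1
  show ?case by (simp add: vt.mult vt.const algebra_simps)
next
  case (ge2 k)
  show ?case
    unfolding descend.simps ge2 by (simp add: vt.mult vt.const algebra_simps)
qed simp

text \<open>Only the last step of the recursion involves \<open>a\<close>. Every \<open>b\<close> therefore admits exactly one \<open>a\<close> for which the
  recursion ends with 0.\<close>

lemma descend_last:
  "of_nat (Suc n) * descend n (lowest a) b (Suc n) = a + of_nat (Suc n) * descend n (lowest 0) b (Suc n)"
proof -
  have same: "k \<le> n \<Longrightarrow> descend n (lowest a) b k = descend n (lowest 0) b k" for k
    by (induction k rule: induct_nat_012) simp_all
  have "vt (descend n (lowest a) b n) = vt (descend n (lowest 0) b n)"
    "(if n = 0 then 0 else descend n (lowest a) b (n - 1)) = (if n = 0 then 0 else descend n (lowest 0) b (n - 1))"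
    by (simp_all add: same)
  then show ?thesis
    unfolding descend_recursion[OF order_refl] by (simp del: of_nat_Suc)
qed

lemma sum_shift_down:
  fixes h f :: "nat \<Rightarrow> 'a::comm_ring"
  shows "(\<Sum>k\<le>n. h k * (if k = 0 then 0 else f (k - 1))) = (\<Sum>k\<le>n. (if k = n then 0 else h (Suc k)) * f k)"
proof (cases n)
  case (Suc m)
  have "(\<Sum>k\<le>n. h k * (if k = 0 then 0 else f (k - 1))) = (\<Sum>k\<le>m. h (Suc k) * f k)"
    by (simp add: Suc sum.atMost_Suc_shift del: sum.atMost_Suc)
  also have "\<dots> = (\<Sum>k\<le>n. (if k = n then 0 else h (Suc k)) * f k)"
    by (simp add: Suc)
  finally show ?thesis .
qed simp

lemma sum_shift_up:
  fixes h f :: "nat \<Rightarrow> 'a::comm_ring"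
  assumes "f (Suc n) = 0"
  shows "(\<Sum>k\<le>n. h k * f (Suc k)) = (\<Sum>k\<le>n. (if k = 0 then 0 else h (k - 1)) * f k)"
proof -
  have "(\<Sum>k\<le>n. h k * f (Suc k)) = (\<Sum>k\<le>Suc n. (if k = 0 then 0 else h (k - 1)) * f k)"
    by (subst sum.atMost_Suc_shift) simp
  then show ?thesis by (simp add: assms)
qed

text \<open>The coefficients of a single \<open>f\<^sub>k\<close>, with \<open>m = n - k\<close>, in the derivative of \<open>g\<^sub>j\<close> below.\<close>

lemma binomial_coefficient_identity:
  fixes e u :: complex
  shows "of_nat (m choose j) * ((of_nat k - of_nat m) * e * e ^ (m - j))
    + (if m = 0 then 0 else of_nat (m - 1 choose j) * (of_nat m * u * e ^ (m - 1 - j)))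
    - (if k = 0 then 0 else of_nat (Suc m choose j) * (of_nat k * e ^ (Suc m - j)))
    + of_nat (m choose j) * (of_nat (m - j) * e ^ (m - j - 1) * (e ^ 2 - u))
    = (if j = 0 then 0 else - of_nat (Suc (m + k) - j) * (of_nat (m choose (j - 1)) * e ^ (m - (j - 1))))"
proof (cases "j \<le> m")
  case False
  then consider "j = Suc m" | "j > Suc m" by linarith
  then show ?thesis by cases (use False in \<open>auto simp: binomial_eq_0\<close>)
next
  case True
  then obtain r where m: "m = j + r" using le_Suc_ex by blast
  have U: "(if m = 0 then 0 else of_nat (m - 1 choose j) * (of_nat m * u * e ^ (m - 1 - j)))
      = of_nat (m choose j) * of_nat r * u * e ^ (r - 1)"
  proof (cases r)
    case 0
    then show ?thesis by (auto simp: m binomial_eq_0)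
  next
    case (Suc s)
    have "(Suc s) * (Suc (j + s) choose j) = Suc (j + s) * (j + s choose j)"
      using binomial_absorb_comp[of "Suc (j + s)" j] by simp
    then have "(of_nat (Suc s) * of_nat (Suc (j + s) choose j) :: complex)
        = of_nat (Suc (j + s)) * of_nat (j + s choose j)"
      by (metis of_nat_mult)
    then show ?thesis unfolding m Suc by (auto simp: mult_ac)
  qed
  have Er: "of_nat r * (e ^ (r - 1) * e ^ 2) = of_nat r * (e * e ^ r)"
    by (cases r) (simp_all add: power2_eq_square mult_ac)
  show ?thesis
  proof (cases j)
    case 0
    then show ?thesis
      using U Er unfolding m by (simp add: algebra_simps)
  next
    case (Suc i)
    have "Suc i * (m choose Suc i) = Suc r * (m choose i)"
      using binomial_absorption[of i m] binomial_absorb_comp[of m i] by (simp add: m Suc del: binomial_Suc_Suc mult_Suc)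
    then have I: "(of_nat (Suc i) * of_nat (m choose Suc i) :: complex) = of_nat (Suc r) * of_nat (m choose i)"
      by (metis of_nat_mult)
    have K: "(if k = 0 then 0 else of_nat (Suc m choose j) * (of_nat k * e ^ (Suc m - j)))
        = of_nat k * ((of_nat (m choose i) + of_nat (m choose j)) * (e * e ^ r))"
      by (simp add: m Suc)
    have R: "(if j = 0 then 0 else - of_nat (Suc (m + k) - j) * (of_nat (m choose (j - 1)) * e ^ (m - (j - 1))))
        = - (of_nat (Suc r) + of_nat k) * (of_nat (m choose i) * (e * e ^ r))"
      by (simp add: m Suc)
    have "m - j = r" by (simp add: m)
    have D: "of_nat (m choose j) * (of_nat r * e ^ (r - 1) * (e ^ 2 - u)) =
        of_nat (m choose j) * (of_nat r * (e * e ^ r)) - of_nat (m choose j) * of_nat r * u * e ^ (r - 1)"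
      unfolding Er [symmetric] by (simp add: algebra_simps)
    have "m - j = r" by (simp add: m)
    have "b * ((c - M) * e * E) + v - c * ((b' + b) * (e * E)) + (b * (x * (e * E)) - v) = - (x' + c) * (b' * (e * E))"
      if "y * b = x' * b'" "M = y + x" for b b' c M E v x x' y :: complex
    proof -
      have "b * ((c - M) * e * E) + v - c * ((b' + b) * (e * E)) + (b * (x * (e * E)) - v)
          = - (y * b) * (e * E) - c * (b' * (e * E))"
        unfolding that(2) by (simp add: algebra_simps)
      then show ?thesis unfolding that(1) by (simp add: algebra_simps)
    qed
    from this[OF I, of "of_nat m" "of_nat r"] show ?thesis
      unfolding U K R unfolding \<open>m - j = r\<close> unfolding D by (simp add: m Suc)
  qed
qed

text \<open>For \<open>f\<^sub>k\<close> of weight \<open>2 k - n\<close> with derivatives \<open>d\<^sub>k\<close>, and for \<open>e\<close> with derivative \<open>e\<^sup>2 - u\<close>, the left side is the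
  derivative of the coefficient \<open>g\<^sub>j\<close> of \<open>x\<^sup>j\<close> in \<open>\<Sum>\<^sub>k f\<^sub>k (x + e)\<^sup>n\<^sup>-\<^sup>k\<close>. The terms with \<open>u\<close> cancel, and what
  remains is \<open>a\<close> for \<open>j = 0\<close> and a multiple of \<open>g\<^sub>j\<^sub>-\<^sub>1\<close> otherwise.\<close>

lemma sum_derivative_identity:
  fixes f d :: "nat \<Rightarrow> complex" and e u a :: complex
  assumes d: "\<And>k. k \<le> n \<Longrightarrow> d k = (of_nat k - of_nat (n - k)) * e * f k + (if k = n then a else 0)
      + of_nat (Suc (n - k)) * (u * (if k = 0 then 0 else f (k - 1))) - of_nat (Suc k) * f (Suc k)"
    and last: "f (Suc n) = 0"
  shows "(\<Sum>k\<le>n. of_nat (n - k choose j) *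
      (d k * e ^ (n - k - j) + f k * (of_nat (n - k - j) * e ^ (n - k - j - 1) * (e ^ 2 - u))))
    = (if j = 0 then a
       else - of_nat (Suc n - j) * (\<Sum>k\<le>n. of_nat (n - k choose (j - 1)) * (f k * e ^ (n - k - (j - 1)))))"
    (is "?L = ?R")
proof -
  define b where "b k = (of_nat (n - k choose j) :: complex)" for k
  have "?L = (\<Sum>k\<le>n. b k * ((of_nat k - of_nat (n - k)) * e * e ^ (n - k - j)) * f k)
      + (\<Sum>k\<le>n. if k = n then (if j = 0 then a else 0) else 0)
      + (\<Sum>k\<le>n. b k * (of_nat (Suc (n - k)) * u * e ^ (n - k - j)) * (if k = 0 then 0 else f (k - 1)))
      - (\<Sum>k\<le>n. b k * (of_nat (Suc k) * e ^ (n - k - j)) * f (Suc k))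
      + (\<Sum>k\<le>n. b k * (of_nat (n - k - j) * e ^ (n - k - j - 1) * (e ^ 2 - u)) * f k)"
    unfolding sum.distrib [symmetric] sum_subtractf [symmetric]
  proof (rule sum.cong[OF refl])
    fix k assume k: "k \<in> {..n}"
    have "b k * ((if k = n then a else 0) * e ^ (n - k - j)) = (if k = n then (if j = 0 then a else 0) else 0)"
      by (auto simp: b_def)
    then show "of_nat (n - k choose j) *
      (d k * e ^ (n - k - j) + f k * (of_nat (n - k - j) * e ^ (n - k - j - 1) * (e ^ 2 - u)))
      = b k * ((of_nat k - of_nat (n - k)) * e * e ^ (n - k - j)) * f k
      + (if k = n then (if j = 0 then a else 0) else 0)
      + b k * (of_nat (Suc (n - k)) * u * e ^ (n - k - j)) * (if k = 0 then 0 else f (k - 1))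
      - b k * (of_nat (Suc k) * e ^ (n - k - j)) * f (Suc k)
      + b k * (of_nat (n - k - j) * e ^ (n - k - j - 1) * (e ^ 2 - u)) * f k"
      using k unfolding d[of k, OF atMost_iff[THEN iffD1, OF k]] b_def [symmetric]
      by (simp only: distrib_left distrib_right left_diff_distrib right_diff_distrib mult_ac)
  qed
  also have "\<dots> = (if j = 0 then a else 0)
      + (\<Sum>k\<le>n. (b k * ((of_nat k - of_nat (n - k)) * e * e ^ (n - k - j))
      + (if k = n then 0 else b (Suc k) * (of_nat (Suc (n - Suc k)) * u * e ^ (n - Suc k - j)))
      - (if k = 0 then 0 else b (k - 1) * (of_nat (Suc (k - 1)) * e ^ (n - (k - 1) - j)))
      + b k * (of_nat (n - k - j) * e ^ (n - k - j - 1) * (e ^ 2 - u))) * f k)"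
    unfolding sum_shift_down[where f = f] sum_shift_up[where f = f, OF last]
    by (simp add: sum.distrib sum_subtractf distrib_right left_diff_distrib del: of_nat_Suc)
  also have "(\<Sum>k\<le>n. (b k * ((of_nat k - of_nat (n - k)) * e * e ^ (n - k - j))
      + (if k = n then 0 else b (Suc k) * (of_nat (Suc (n - Suc k)) * u * e ^ (n - Suc k - j)))
      - (if k = 0 then 0 else b (k - 1) * (of_nat (Suc (k - 1)) * e ^ (n - (k - 1) - j)))
      + b k * (of_nat (n - k - j) * e ^ (n - k - j - 1) * (e ^ 2 - u))) * f k) =
      (\<Sum>k\<le>n. (if j = 0 then 0 else - of_nat (Suc n - j) *
         (of_nat (n - k choose (j - 1)) * e ^ (n - k - (j - 1)))) * f k)"
  proof (rule sum.cong[OF refl])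
    fix k assume "k \<in> {..n}"
    then obtain m where m: "n = m + k" by (metis atMost_iff le_add_diff_inverse2)
    have "(if k = n then 0 else b (Suc k) * (of_nat (Suc (n - Suc k)) * u * e ^ (n - Suc k - j))) =
       (if m = 0 then 0 else of_nat (m - 1 choose j) * (of_nat m * u * e ^ (m - 1 - j)))"
      by (cases m) (auto simp: b_def m)
    moreover have "(if k = 0 then 0 else b (k - 1) * (of_nat (Suc (k - 1)) * e ^ (n - (k - 1) - j))) =
       (if k = 0 then 0 else of_nat (Suc m choose j) * (of_nat k * e ^ (Suc m - j)))"
      by (cases k) (auto simp: b_def m)
    moreover have "n - k = m" by (simp add: m)
    ultimately show "(b k * ((of_nat k - of_nat (n - k)) * e * e ^ (n - k - j))
      + (if k = n then 0 else b (Suc k) * (of_nat (Suc (n - Suc k)) * u * e ^ (n - Suc k - j)))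
      - (if k = 0 then 0 else b (k - 1) * (of_nat (Suc (k - 1)) * e ^ (n - (k - 1) - j)))
      + b k * (of_nat (n - k - j) * e ^ (n - k - j - 1) * (e ^ 2 - u))) * f k =
      (if j = 0 then 0 else - of_nat (Suc n - j) *
         (of_nat (n - k choose (j - 1)) * e ^ (n - k - (j - 1)))) * f k"
      using binomial_coefficient_identity[of m j k e u] by (simp only: b_def m add.commute[of m k])
  qed
  also have "(if j = 0 then a else 0) + \<dots> = ?R"
    by (simp add: sum_distrib_left mult_ac)
  finally show ?thesis .
qed

lemma qD_eqI:
  assumes "\<And>z. Im z > 0 \<Longrightarrow> (g has_field_derivative (2 * of_real pi * \<i>) * h z) (at z)"
    and "\<And>z. Im z \<le> 0 \<Longrightarrow> h z = 0"
  shows "qD g = h"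
proof
  fix z show "qD g z = h z"
    using assms(1)[of z, THEN DERIV_imp_deriv] assms(2)[of z] by (auto simp: qD_def not_less)
qed

text \<open>The functions \<open>g\<^sub>n = b, g\<^sub>n\<^sub>-\<^sub>1, \<dots>, g\<^sub>0, a\<close> are obtained from each other by \<open>q d/dq\<close>, up to the factors
  \<open>-1, -2, \<dots>, -n, 1\<close>.\<close>

theorem bol_identity:
  assumes a: "a \<in> gr (int n + 2)" and b: "b \<in> gr (- int n)"
    and rel: "descend n (lowest a) b (Suc n) = 0"
  shows "(qD ^^ (n + 1)) (form_of b) = (\<lambda>z. (- 1) ^ n * fact n * form_of a z)"
proof -
  define t where "t = descend n (lowest a) b"
  have t: "t k \<in> gr (2 * int k - int n)" if "k \<le> Suc n" for k
  proof -
    have "t k \<in> graded {w. [w = - int n + 2 * int k] (mod 0)}"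
      unfolding t_def
      by (rule descend_graded) (use a b that in \<open>auto simp: gr_eq add.commute\<close>)
    also have "{w. [w = - int n + 2 * int k] (mod 0)} = {2 * int k - int n}" by auto
    finally show ?thesis by (simp only: gr_eq)
  qed
  have tOX: "t k \<in> OX" if "k \<le> Suc n" for k by (rule gr_OX[OF t[OF that]])
  define f where "f k = form_of (t k)" for k
  define e u where "e z = qval fE z / 12" and "u z = qval fU z / 12" for z
  define g where "g j z = (\<Sum>k\<le>n. of_nat (n - k choose j) * (f k z * e z ^ (n - k - j)))" for j z
  define P where "P = 2 * of_real pi * \<i>"
  define d where "d k z = (of_nat k - of_nat (n - k)) * e z * f k z + (if k = n then form_of a z else 0)
      + of_nat (Suc (n - k)) * (u z * (if k = 0 then 0 else f (k - 1) z)) - of_nat (Suc k) * f (Suc k) z" for k z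
  have df: "(f k has_field_derivative P * d k z) (at z)" if k: "k \<le> n" and z: "Im z > 0" for k z
  proof -
    define s where "s = (if k = 0 then 0 else t (k - 1))"
    have s: "s \<in> OX" "form_of s z = (if k = 0 then 0 else f (k - 1) z)"
      using tOX[of "k - 1"] k by (auto simp: s_def f_def graded_OX[OF graded_0])
    have l: "lowest a (n - k) \<in> OX" "form_of (lowest a (n - k)) z = (if k = n then form_of a z else 0)"
      using k gr_OX[OF a] by (auto simp: graded_OX[OF graded_0])
    have XuOX: "Xu \<in> OX" by (rule graded_OX[OF graded_Xu])
    have u12: "Xu / 12 * s = rat_const (1 / 12) * (Xu * s)"
      by (simp add: rat_const_inverse_numeral)
    have us: "Xu / 12 * s \<in> OX" "form_of (Xu / 12 * s) z = u z * form_of s z"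
      unfolding u12 using XuOX s(1) z graded_OX[OF graded_const]
      by (simp_all add: OX_mult form_of_mult form_of_const form_of_Xu u_def of_rat_divide)
    have lin: "form_of (x + of_nat i * y + - (of_nat j * w)) z = form_of x z + of_nat i * form_of y z - of_nat j * form_of w z"
      if "x \<in> OX" "y \<in> OX" "w \<in> OX" for x y w i j
    proof -
      have "of_nat i * y \<in> OX" "of_nat j * w \<in> OX"
        using that graded_of_nat[of _ UNIV] by (auto simp: OX_eq)
      then show ?thesis
        using that by (simp add: form_of_add form_of_uminus form_of_of_nat OX_add OX_uminus
            del: add_uminus_conv_diff)
    qed
    have "vt (t k) = lowest a (n - k) + of_nat (Suc (n - k)) * (Xu / 12 * s) + - (of_nat (Suc k) * t (Suc k))"
      unfolding t_def descend_recursion[OF k] s_def by simp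
    then have "form_of (vt (t k)) z = form_of (lowest a (n - k)) z
        + of_nat (Suc (n - k)) * (u z * form_of s z) - of_nat (Suc k) * f (Suc k) z"
      using k by (simp only: lin l(1) us tOX f_def Suc_le_mono)
    moreover have "of_int (2 * int k - int n) / 12 * qval fE z * form_of (t k) z =
        (of_nat k - of_nat (n - k)) * e z * f k z"
      using k by (simp add: of_nat_diff e_def f_def)
    ultimately have "form_of (vt (t k)) z + of_int (2 * int k - int n) / 12 * qval fE z * form_of (t k) z = d k z"
      unfolding d_def s(2) [symmetric] l(2) [symmetric] by (simp only: add_ac add_diff_eq)
    then show ?thesis
      using form_of_derivative[OF t z, of k] k by (simp add: f_def P_def)
  qed
  have de: "(e has_field_derivative P * (e z ^ 2 - u z)) (at z)" if z: "Im z > 0" for z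
  proof -
    have c: "fps_const (1 / 12 :: complex) \<in> ratfps" by (intro ratfps_const) auto
    have "(qval fE has_field_derivative P * (qval fE z ^ 2 / 12 - qval fU z)) (at z)"
      using has_field_derivative_qval[OF z ratfps_fE] z c unfolding ramanujan_fE
      by (simp add: P_def qval_simps qval_power ratfps_fE ratfps_fU ratfps_mult ratfps_power)
    from DERIV_cdivide[OF this, of 12] show ?thesis
      by (simp add: e_def [abs_def] u_def power_divide field_simps)
  qed
  have ft: "f (Suc n) z = 0" for z by (simp add: f_def t_def rel)
  have outside: "form_of a z = 0" "g j z = 0" if "Im z \<le> 0" for z j
    using form_of_outside[OF _ that] gr_OX[OF a] tOX by (auto simp: g_def f_def intro!: sum.neutral)
  have dg: "(g j has_field_derivative P * (if j = 0 then form_of a z else - of_nat (Suc n - j) * g (j - 1) z)) (at z)"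
    if z: "Im z > 0" for j z
  proof -
    have "((\<lambda>z. g j z) has_field_derivative (\<Sum>k\<le>n. of_nat (n - k choose j) *
        (P * d k z * e z ^ (n - k - j) + f k z * (of_nat (n - k - j) * e z ^ (n - k - j - 1) * (P * (e z ^ 2 - u z)))))) (at z)"
      unfolding g_def
      by (rule derivative_eq_intros df de z refl | simp add: mult_ac)+
    also have "(\<Sum>k\<le>n. of_nat (n - k choose j) *
        (P * d k z * e z ^ (n - k - j) + f k z * (of_nat (n - k - j) * e z ^ (n - k - j - 1) * (P * (e z ^ 2 - u z)))))
      = P * (\<Sum>k\<le>n. of_nat (n - k choose j) *
        (d k z * e z ^ (n - k - j) + f k z * (of_nat (n - k - j) * e z ^ (n - k - j - 1) * (e z ^ 2 - u z))))"
      unfolding sum_distrib_left by (intro sum.cong refl) (simp add: algebra_simps)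
    also have "(\<Sum>k\<le>n. of_nat (n - k choose j) *
        (d k z * e z ^ (n - k - j) + f k z * (of_nat (n - k - j) * e z ^ (n - k - j - 1) * (e z ^ 2 - u z))))
      = (if j = 0 then form_of a z else - of_nat (Suc n - j) * g (j - 1) z)"
      unfolding g_def by (rule sum_derivative_identity) (simp_all only: d_def ft)
    finally show ?thesis .
  qed
  have "(qD ^^ m) (form_of b) = (\<lambda>z. (- 1) ^ m * fact m * g (n - m) z)" if "m \<le> n" for m
    using that
  proof (induction m)
    case 0
    have "g n z = form_of b z" for z
    proof -
      have "g n z = (\<Sum>k\<le>n. if k = 0 then f 0 z else 0)"
        unfolding g_def by (intro sum.cong refl) (auto simp: binomial_eq_0)
      then show ?thesis by (simp add: f_def t_def)
    qed
    then show ?case by (simp add: fun_eq_iff)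
  next
    case (Suc m)
    have "qD (\<lambda>z. (- 1) ^ m * fact m * g (n - m) z) = (\<lambda>z. (- 1) ^ Suc m * fact (Suc m) * g (n - Suc m) z)"
    proof (rule qD_eqI)
      fix z assume z: "Im z > 0"
      have "n - m \<noteq> 0" "Suc n - (n - m) = Suc m" "n - m - 1 = n - Suc m" using Suc.prems by auto
      then show "((\<lambda>z. (- 1) ^ m * fact m * g (n - m) z) has_field_derivative
          2 * of_real pi * \<i> * ((- 1) ^ Suc m * fact (Suc m) * g (n - Suc m) z)) (at z)"
        using DERIV_cmult[OF dg[OF z, of "n - m"], of "(- 1) ^ m * fact m"]
        by (simp add: P_def mult_ac del: of_nat_Suc)
    qed (simp add: outside)
    with Suc show ?case by simp
  qed
  from this[of n] have "(qD ^^ n) (form_of b) = (\<lambda>z. (- 1) ^ n * fact n * g 0 z)" by simp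
  moreover have "qD (\<lambda>z. (- 1) ^ n * fact n * g 0 z) = (\<lambda>z. (- 1) ^ n * fact n * form_of a z)"
  proof (rule qD_eqI)
    fix z assume z: "Im z > 0"
    show "((\<lambda>z. (- 1) ^ n * fact n * g 0 z) has_field_derivative
        2 * of_real pi * \<i> * ((- 1) ^ n * fact n * form_of a z)) (at z)"
      using DERIV_cmult[OF dg[OF z, of 0], of "(- 1) ^ n * fact n"] by (simp add: P_def mult_ac)
  qed (simp add: outside)
  ultimately show ?thesis by simp
qed

text \<open>Every \<open>b\<close> occurs in \<open>bol_identity\<close>, by \<open>descend_last\<close>; the constant \<open>(-1)\<^sup>n n!\<close> is absorbed by scaling \<open>a\<close> and
  \<open>b\<close> together.\<close>

theorem bol_image_eq:
  "bol_image n = {f \<in> wh_modular_forms (int n + 2).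
     \<exists>b\<in>gr (- int n). descend n (lowest (gr_of_form (int n + 2) f)) b (Suc n) = 0}" (is "_ = ?K")
proof -
  define c :: rat where "c = (- 1) ^ n * fact n"
  have "of_rat (fact n) = (fact n :: complex)"
    by (metis of_nat_fact of_rat_of_nat_eq)
  then have c: "c \<noteq> 0" "of_rat c = ((- 1) ^ n * fact n :: complex)"
    by (simp_all add: c_def of_rat_mult of_rat_power of_rat_minus)
  have scale: "rat_const r * x \<in> gr m" if "x \<in> gr m" for r x m
    using that by (simp add: gr_eq graded_scale)
  show ?thesis
  proof (intro equalityI subsetI)
    fix f assume "f \<in> bol_image n"
    then obtain h where h: "h \<in> wh_modular_forms (- int n)" "f = (qD ^^ (n + 1)) h"
      by (auto simp: bol_image_def)
    obtain b where b: "b \<in> gr (- int n)" "h = form_of b" using wh_eq_form_of[OF h(1)] by blast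
    \<comment> \<open>the element for which, by \<open>descend_last\<close>, the recursion ends with 0\<close>
    define a where "a = - (of_nat (Suc n) * descend n (lowest 0) b (Suc n))"
    have "descend n (lowest 0) b (Suc n) \<in> graded {w. [w = - int n + 2 * int (Suc n)] (mod 0)}"
      by (rule descend_graded) (use b in \<open>auto simp: gr_eq\<close>)
    then have "descend n (lowest 0) b (Suc n) \<in> gr (int n + 2)" by (simp add: gr_eq algebra_simps)
    then have a: "a \<in> gr (int n + 2)"
      unfolding a_def gr_eq by (intro graded_uminus graded_of_nat)
    have "of_nat (Suc n) * descend n (lowest a) b (Suc n) = 0"
      unfolding descend_last[of n a] by (simp add: a_def)
    then have rel: "descend n (lowest a) b (Suc n) = 0"
      using kuv_of_nat_nonzero[of n] by simp
    have "f = form_of (rat_const c * a)"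
      unfolding h(2) b(2) bol_identity[OF a b(1) rel] by (simp add: fun_eq_iff form_of_scale gr_OX[OF a] c)
    moreover have "descend n (lowest (rat_const c * a)) (rat_const c * b) (Suc n) = 0"
      unfolding descend_scale rel by simp
    ultimately have "f \<in> wh_modular_forms (int n + 2)"
      "descend n (lowest (gr_of_form (int n + 2) f)) (rat_const c * b) (Suc n) = 0"
      by (simp_all only: form_of_wh[OF scale[OF a]] gr_of_form_form_of[OF scale[OF a]])
    then show "f \<in> ?K" using scale[OF b(1)] by blast
  next
    fix f assume "f \<in> ?K"
    then obtain b where f: "f \<in> wh_modular_forms (int n + 2)" and b: "b \<in> gr (- int n)"
      and rel: "descend n (lowest (gr_of_form (int n + 2) f)) b (Suc n) = 0" by blast
    note a = gr_of_form[OF f]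
    define r where "r = rat_const (1 / c)"
    have "(qD ^^ (n + 1)) (form_of (r * b)) = (\<lambda>z. (- 1) ^ n * fact n * form_of (r * gr_of_form (int n + 2) f) z)"
      unfolding r_def
      by (rule bol_identity[OF scale[OF a(1)] scale[OF b]]) (unfold descend_scale rel, simp)
    also have "\<dots> = f"
      using c by (simp add: r_def form_of_scale gr_OX[OF a(1)] a(2) of_rat_divide flip: c(2))
    finally show "f \<in> bol_image n"
      unfolding bol_image_def using form_of_wh[OF scale[OF b, of "1 / c"]] by (auto simp: r_def intro!: rev_image_eqI)
  qed
qed

section \<open>The comparison isomorphism\<close>

lemma module_wh_space: "module rat_ring (wh_space m)"
proof (rule module_rat_ringI)
  have add: "(\<lambda>z. f z + g z) \<in> wh_modular_forms m" if f: "f \<in> wh_modular_forms m" and g: "g \<in> wh_modular_forms m" for f g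
  proof -
    obtain a b where ab: "a \<in> gr m" "b \<in> gr m" "form_of a = f" "form_of b = g"
      using wh_eq_form_of[OF f] wh_eq_form_of[OF g] by blast
    then have "form_of (a + b) = (\<lambda>z. f z + g z)" by (auto simp: form_of_add gr_OX)
    moreover have "a + b \<in> gr m" using ab by (simp add: gr_eq graded_add)
    ultimately show ?thesis using form_of_wh by metis
  qed
  have smult: "(\<lambda>z. of_rat c * f z) \<in> wh_modular_forms m" if f: "f \<in> wh_modular_forms m" for c f
  proof -
    obtain a where a: "a \<in> gr m" "form_of a = f" using wh_eq_form_of[OF f] by blast
    then have "form_of (rat_const c * a) = (\<lambda>z. of_rat c * f z)" by (auto simp: form_of_scale gr_OX)
    moreover have "rat_const c * a \<in> gr m" using a by (simp add: gr_eq graded_scale)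
    ultimately show ?thesis using form_of_wh by metis
  qed
  show "abelian_group (wh_space m)"
  proof (rule abelian_groupI)
    fix f assume f: "f \<in> carrier (wh_space m)"
    then show "\<exists>g\<in>carrier (wh_space m). g \<oplus>\<^bsub>wh_space m\<^esub> f = \<zero>\<^bsub>wh_space m\<^esub>"
      using smult[of f "- 1"] by (intro bexI[of _ "\<lambda>z. of_rat (- 1) * f z"]) (simp_all add: wh_space_def of_rat_minus)
  qed (use add smult[of _ 0] form_of_wh[of 0 m] in \<open>auto simp: wh_space_def add_ac gr_eq fun_eq_iff
         dest!: fun_cong[of "form_of 0"]\<close>)
  show "c \<odot>\<^bsub>wh_space m\<^esub> f \<in> carrier (wh_space m)" if "f \<in> carrier (wh_space m)" for c f
    using smult that by (simp add: wh_space_def)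
qed (simp_all add: wh_space_def of_rat_add of_rat_mult algebra_simps)

theorem theorem1p2:
  fixes n :: nat
  shows "submodule (bol_image n) rat_ring (wh_space (int n + 2)) \<and>
    (\<exists>\<Phi>. rat_space_iso (quot_space (wh_space (int n + 2)) (bol_image n)) (H1dR n) \<Phi> \<and>
      (\<forall>f \<in> wh_modular_forms (int n + 2).
         \<Phi> (bol_image n +>\<^bsub>wh_space (int n + 2)\<^esub> f) = H1_class n (omega_form n f)))"
proof -
  define h where "h f = H1_class n (omega_form n f)" for f
  have h: "h f = H1_class n (lowest_form n (gr_of_form (int n + 2) f))" for f
    by (simp add: h_def omega_form_def lowest_form_def Let_def)
  note gr = gr_of_form(1)
  have add: "gr_of_form (int n + 2) (\<lambda>z. f z + g z) = gr_of_form (int n + 2) f + gr_of_form (int n + 2) g"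
    if "f \<in> wh_modular_forms (int n + 2)" "g \<in> wh_modular_forms (int n + 2)" for f g
  proof -
    have "form_of (gr_of_form (int n + 2) f + gr_of_form (int n + 2) g) = (\<lambda>z. f z + g z)"
      by (rule ext) (simp add: form_of_add gr_of_form that gr_OX[OF gr])
    moreover have "gr_of_form (int n + 2) f + gr_of_form (int n + 2) g \<in> gr (int n + 2)"
      using that[THEN gr] by (simp add: gr_eq graded_add)
    ultimately show ?thesis using gr_of_form_form_of by metis
  qed
  have smult: "gr_of_form (int n + 2) (\<lambda>z. of_rat c * f z) = rat_const c * gr_of_form (int n + 2) f"
    if "f \<in> wh_modular_forms (int n + 2)" for c f
  proof -
    have "form_of (rat_const c * gr_of_form (int n + 2) f) = (\<lambda>z. of_rat c * f z)"
      by (rule ext) (simp add: form_of_scale gr_of_form that gr_OX[OF gr])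
    moreover have "rat_const c * gr_of_form (int n + 2) f \<in> gr (int n + 2)"
      using that[THEN gr] by (simp add: gr_eq graded_scale)
    ultimately show ?thesis using gr_of_form_form_of by metis
  qed
  have onto: "gr_of_form (int n + 2) ` wh_modular_forms (int n + 2) = gr (int n + 2)"
    using gr form_of_wh gr_of_form_form_of by (force intro!: rev_image_eqI)
  have "submodule (bol_image n) rat_ring (wh_space (int n + 2)) \<and>
    (\<exists>\<Phi>. rat_space_iso (quot_space (wh_space (int n + 2)) (bol_image n)) (H1dR n) \<Phi> \<and>
      (\<forall>f \<in> carrier (wh_space (int n + 2)). \<Phi> (bol_image n +>\<^bsub>wh_space (int n + 2)\<^esub> f) = h f))"
  proof (rule rat_space_iso_kernel[OF module_wh_space module_H1dR])
    show "h (f \<oplus>\<^bsub>wh_space (int n + 2)\<^esub> g) = h f \<oplus>\<^bsub>H1dR n\<^esub> h g"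
      if "f \<in> carrier (wh_space (int n + 2))" "g \<in> carrier (wh_space (int n + 2))" for f g
      using that H1dR_presentation(1)[OF gr gr] by (simp add: wh_space_def h add)
    show "h (c \<odot>\<^bsub>wh_space (int n + 2)\<^esub> f) = c \<odot>\<^bsub>H1dR n\<^esub> h f"
      if "f \<in> carrier (wh_space (int n + 2))" for c f
      using that H1dR_presentation(2)[OF gr] by (simp add: wh_space_def h smult)
    show "h ` carrier (wh_space (int n + 2)) = carrier (H1dR n)"
      unfolding H1dR_presentation(3) [symmetric] onto [symmetric] image_image
      by (simp add: wh_space_def h)
    show "bol_image n = {f \<in> carrier (wh_space (int n + 2)). h f = \<zero>\<^bsub>H1dR n\<^esub>}"
      unfolding bol_image_eq using H1dR_presentation(4)[OF gr] by (auto simp: wh_space_def h)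
  qed
  then show ?thesis by (simp add: wh_space_def h_def)
qed

end
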